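(* Let $K$ be a field, $N>1$, and let $R$ be a homogeneous $K$-algebra of solvable type with respect to $x=(x_1,\dots,x_N)$ and a monomial ordering $\leq$ of $\mathbb{N}^N$. Let $I$ be a left ideal of $R$ generated by non-zero homogeneous elements $f_1,\dots,f_n\in R$, where $n>0$, and let $d$ be the maximum of the degrees of $f_1,\dots,f_n$. Then the elements of the reduced Gröbner basis of $I$ (with respect to $\leq$) have degree at most $$D(N-1,d)=2\left(\frac{d^2}{2}+d\right)^{2^{N-2}}.$$
   Context: Here $\mathbb{N}=\{0,1,2,\dots\}$ and $|\alpha|=\alpha_1+\cdots+\alpha_N$ for $\alpha\in\mathbb{N}^N$. A monomial ordering of $\mathbb{N}^N$ is a total ordering compatible with addition whose smallest element is $0$. $K$-algebras are associative with unit. For a $K$-algebra $R$ and $x=(x_1,\dots,x_N)\in R^N$ put $x^\alpha:=x_1^{\alpha_1}\cdots x_N^{\alpha_N}$; these are the monomials. $R$ is of solvable type with respect to $x$ and $\leq$ if $\{x^\alpha\}_{\alpha\in\mathbb{N}^N}$ is a $K$-basis of $R$ and for $1\leq i<j\leq N$ there are $0\neq c_{ij}\in K$ and $p_{ij}\in R$ with $x_jx_i=c_{ij}x_ix_j+p_{ij}$ and $\operatorname{lm}(p_{ij})<x_ix_j$. Here monomials are ordered by $x^\alpha\leq x^\beta\iff\alpha\leq\beta$, $\operatorname{lm}(f)$ is the $\leq$-largest monomial occurring in $f\neq 0$, $\operatorname{lc}(f)$ is its coefficient, and $\operatorname{lm}(0):=0$ is smaller than every monomial. $R$ is homogeneous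 if each $p_{ij}$ is a $K$-linear combination of monomials $x^\alpha$ with $|\alpha|=2$. Then $R$ is a graded $K$-algebra with $d$-th homogeneous component $R_{(d)}=\bigoplus_{|\alpha|=d}Kx^\alpha$; "homogeneous element" and "degree" refer to this grading. A monomial $x^\alpha$ divides $x^\beta$ if $\alpha_i\leq\beta_i$ for all $i$. A Gröbner basis of a left ideal $I$ of $R$ is a finite set $G\subseteq I$ generating $I$ as a left ideal such that for every nonzero $f\in I$ there is a nonzero $g\in G$ with $\operatorname{lm}(g)\mid\operatorname{lm}(f)$. It is reduced if for each $g\in G$, $\operatorname{lc}(g)=1$ and no monomial occurring in $g$ is divisible by $\operatorname{lm}(g')$ for any nonzero $g'\in G\setminus\{g\}$. Every left ideal of $R$ has a unique reduced Gröbner basis. *)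

theory Defs
  imports Complex_Main "HOL-Library.Poly_Mapping"
begin

text \<open>Multi-indices in \<open>\<nat>\<^sup>N\<close> are finitely supported functions vanishing outside \<open>{0..<N}\<close>; the
  indices \<open>1,\<dots>,N\<close> of the literature are shifted to \<open>0,\<dots>,N-1\<close>.\<close>

definition exps :: "nat \<Rightarrow> (nat \<Rightarrow>\<^sub>0 nat) set" where
  "exps N = {\<alpha>. Poly_Mapping.keys \<alpha> \<subseteq> {..<N}}"

definition exp_size :: "(nat \<Rightarrow>\<^sub>0 nat) \<Rightarrow> nat" where
  "exp_size \<alpha> = (\<Sum>i\<in>Poly_Mapping.keys \<alpha>. Poly_Mapping.lookup \<alpha> i)"

definition exp_dvd :: "(nat \<Rightarrow>\<^sub>0 nat) \<Rightarrow> (nat \<Rightarrow>\<^sub>0 nat) \<Rightarrow> bool" where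
  "exp_dvd \<alpha> \<beta> \<longleftrightarrow> (\<forall>i. Poly_Mapping.lookup \<alpha> i \<le> Poly_Mapping.lookup \<beta> i)"

definition monomial_ordering :: "nat \<Rightarrow> ((nat \<Rightarrow>\<^sub>0 nat) \<times> (nat \<Rightarrow>\<^sub>0 nat)) set \<Rightarrow> bool" where
  "monomial_ordering N r \<longleftrightarrow>
     linear_order_on (exps N) r \<and>
     (\<forall>\<alpha>\<in>exps N. \<forall>\<beta>\<in>exps N. \<forall>\<gamma>\<in>exps N. (\<alpha>, \<beta>) \<in> r \<longrightarrow> (\<alpha> + \<gamma>, \<beta> + \<gamma>) \<in> r) \<and>
     (\<forall>\<alpha>\<in>exps N. (0, \<alpha>) \<in> r)"

definition left_ideal :: "'r::ring_1 set \<Rightarrow> bool" where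
  "left_ideal I \<longleftrightarrow>
     0 \<in> I \<and> (\<forall>a\<in>I. \<forall>b\<in>I. a + b \<in> I) \<and> (\<forall>r. \<forall>a\<in>I. r * a \<in> I)"

locale K_algebra = vector_space scale
  for scale :: "'k::field \<Rightarrow> 'r::ring_1 \<Rightarrow> 'r" (infixr \<open>*s\<close> 75) +
  assumes scale_mult_left: "(a *s u) * v = a *s (u * v)"
    and scale_mult_right: "u * (a *s v) = a *s (u * v)"

locale algebra_monomials = K_algebra scale
  for scale :: "'k::field \<Rightarrow> 'r::ring_1 \<Rightarrow> 'r" (infixr \<open>*s\<close> 75) +
  fixes N :: nat and x :: "nat \<Rightarrow> 'r"
    and r :: "((nat \<Rightarrow>\<^sub>0 nat) \<times> (nat \<Rightarrow>\<^sub>0 nat)) set"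
begin

definition mon :: "(nat \<Rightarrow>\<^sub>0 nat) \<Rightarrow> 'r" where
  "mon \<alpha> = prod_list (map (\<lambda>i. x i ^ Poly_Mapping.lookup \<alpha> i) [0..<N])"

definition monomials_basis :: bool where
  "monomials_basis \<longleftrightarrow>
     inj_on mon (exps N) \<and> independent (mon ` exps N) \<and> span (mon ` exps N) = UNIV"

text \<open>The notions up to \<open>degree\<close> are meaningful only if \<open>monomials_basis\<close> holds.\<close>

definition coeff :: "'r \<Rightarrow> (nat \<Rightarrow>\<^sub>0 nat) \<Rightarrow> 'k" where
  "coeff f \<alpha> = representation (mon ` exps N) f (mon \<alpha>)"

definition supp :: "'r \<Rightarrow> (nat \<Rightarrow>\<^sub>0 nat) set" where
  "supp f = {\<alpha> \<in> exps N. coeff f \<alpha> \<noteq> 0}"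

text \<open>The leading monomial is represented by its exponent, and only used for \<open>f \<noteq> 0\<close>; the
  convention that \<open>lm 0\<close> lies below every monomial is spelled out where it matters.\<close>

definition lm :: "'r \<Rightarrow> (nat \<Rightarrow>\<^sub>0 nat)" where
  "lm f = (THE \<alpha>. \<alpha> \<in> supp f \<and> (\<forall>\<beta>\<in>supp f. (\<beta>, \<alpha>) \<in> r))"

definition lc :: "'r \<Rightarrow> 'k" where
  "lc f = (if f = 0 then 0 else coeff f (lm f))"

definition component :: "nat \<Rightarrow> 'r set" where
  "component d = span (mon ` {\<alpha> \<in> exps N. exp_size \<alpha> = d})"

definition homogeneous_element :: "'r \<Rightarrow> bool" where
  "homogeneous_element f \<longleftrightarrow> (\<exists>d. f \<in> component d)"

text \<open>For \<open>f \<noteq> 0\<close> this is the largest \<open>d\<close> such that the component of \<open>f\<close> in degree \<open>d\<close> is nonzero.\<close>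

definition degree :: "'r \<Rightarrow> nat" where
  "degree f = Max (exp_size ` supp f)"

definition commutation_relation :: "nat \<Rightarrow> nat \<Rightarrow> 'k \<Rightarrow> 'r \<Rightarrow> bool" where
  "commutation_relation i j c p \<longleftrightarrow>
     c \<noteq> 0 \<and> x j * x i = c *s (x i * x j) + p \<and>
     (p = 0 \<or>
       (let \<epsilon> = Poly_Mapping.single i 1 + Poly_Mapping.single j 1
        in (lm p, \<epsilon>) \<in> r \<and> lm p \<noteq> \<epsilon>))"

definition groebner_basis :: "'r set \<Rightarrow> 'r set \<Rightarrow> bool" where
  "groebner_basis G I \<longleftrightarrow>
     finite G \<and> G \<subseteq> I \<and> left_ideal hull G = I \<and>
     (\<forall>f\<in>I. f \<noteq> 0 \<longrightarrow> (\<exists>g\<in>G. g \<noteq> 0 \<and> exp_dvd (lm g) (lm f)))"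

definition reduced_groebner_basis :: "'r set \<Rightarrow> 'r set \<Rightarrow> bool" where
  "reduced_groebner_basis G I \<longleftrightarrow>
     groebner_basis G I \<and>
     (\<forall>g\<in>G. lc g = 1 \<and>
        (\<forall>\<alpha>\<in>supp g. \<forall>g'\<in>G - {g}. g' \<noteq> 0 \<longrightarrow> \<not> exp_dvd (lm g') \<alpha>))"

end

locale solvable_algebra = algebra_monomials +
  assumes ordering: "monomial_ordering N r"
    and basis: "monomials_basis"
    and solvable: "i < j \<Longrightarrow> j < N \<Longrightarrow> \<exists>c p. commutation_relation i j c p"

text \<open>The pair \<open>c\<close>, \<open>p\<close> in a commutation relation is uniquely determined by \<open>i\<close> and \<open>j\<close>, because
  \<open>x i * x j\<close> is a basis element that does not occur in \<open>p\<close>.\<close>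

locale homogeneous_solvable_algebra = solvable_algebra +
  assumes homogeneous:
    "i < j \<Longrightarrow> j < N \<Longrightarrow> commutation_relation i j c p \<Longrightarrow> p \<in> component 2"

end

theory Submission
  imports Defs "HOL-Library.Multiset" "HOL-Computational_Algebra.Polynomial"
begin

text \<open>The proof follows Dube's cone decompositions, but only their Hilbert functions are recorded: a
  cone is a pair (degree of its vertex, dimension). Straightening words shows that leading exponents
  are additive, so a homogeneous left ideal has as many leading exponents in degree \<open>t\<close> as its
  degree-\<open>t\<close> part has dimensions. Adding the generators one at a time (the one of degree \<open>d\<close> first)
  and using \<open>(I + R f) / I \<cong> R / (I : f)\<close>, both \<open>I\<close>, up to one full cone of degree \<open>d\<close>, and the
  complement of its leading exponents have \<open>d\<close>-standard decompositions. Making these exact and comparing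
  with the Hilbert polynomial of \<open>R\<close> yields a recursion for the two sequences of Macaulay
  constants, which bounds every cone degree. The elements of the reduced Groebner basis correspond to
  minimal leading exponents, whose degree exceeds that of some cone in the complement by at most one.\<close>

section \<open>Numerical cone decompositions\<close>

text \<open>The Hilbert function of \<open>R\<close> is split into a full cone of degree
  \<open>d\<close> and two \<open>d\<close>-standard collections \<open>Q\<close> and
  \<open>P\<close>. Each dimension then gives one equation for two unknown constants, so only their
  sum is estimated; as both are nonnegative, this is enough. A homogeneous element of degree
  \<open>d\<close> generates a shifted copy of \<open>R\<close>, since \<open>R\<close> has no zero
  divisors. Splitting off this copy leaves no room for further cones of full dimension, so both
  sequences start at \<open>d\<close>. The maximal degree is taken because standard collections are
  moved upwards by subdivision.

  Zero-dimensional cones are invisible to the Hilbert polynomial. They are excluded beyond the last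
  constants because the counts without them already satisfy the identity there.

  The shape of the bound: two numbers with sum at most 2X have binomials of order two with sum about
  2X^2 at most, so a bound 2X turns into 2X^2 when the dimension drops by one. The start is 3d <=
  d^2 + 2d = 2E with E = d^2/2 + d, and N-2 squarings follow. Noncommutativity matters only for the
  additivity of leading exponents.\<close>

text \<open>For \<open>m = 0\<close> and \<open>t > a\<close> the truncated subtraction makes the binomial coefficient vanish, so that
  only the vertex of a zero-dimensional cone is counted.\<close>

definition cone_count :: "nat \<Rightarrow> nat \<Rightarrow> nat \<Rightarrow> nat" where
  "cone_count a m t = (if t < a then 0 else (t - a + m - 1) choose (t - a))"

lemma cone_count_zero_dim: "cone_count a 0 t = of_bool (t = a)"
  by (auto simp: cone_count_def binomial_eq_0)

lemma cone_count_Suc_dim: "a \<le> t \<Longrightarrow> cone_count a (Suc m) t = (t - a + m) choose m"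
  using binomial_symmetric[of m "t - a + m"] by (simp add: cone_count_def)

text \<open>Each element other than the vertex is filed under the first variable occurring in it,
  which leaves one cone of each dimension from 1 to \<open>m\<close>, a degree higher. Numerically
  this is the hockey-stick identity.\<close>

lemma cone_count_split:
  assumes "m > 0"
  shows "cone_count c m t = of_bool (t = c) + (\<Sum>i=1..m. cone_count (Suc c) i t)"
proof (cases "t \<le> c")
  case True
  then show ?thesis using assms by (auto simp: cone_count_def)
next
  case False
  then obtain s where s: "t = Suc c + s" using less_imp_Suc_add[of c t] by auto
  obtain k where k: "m = Suc k" using assms by (cases m) auto
  have "(\<Sum>i=1..m. cone_count (Suc c) i t) = (\<Sum>i\<le>k. cone_count (Suc c) (Suc i) t)"
    unfolding k using sum.shift_bounds_cl_Suc_ivl[of "\<lambda>i. cone_count (Suc c) i t" 0 k]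
    by (simp add: atMost_atLeast0)
  also have "\<dots> = (\<Sum>i\<le>k. (s + i) choose i)"
    by (intro sum.cong) (simp_all add: s cone_count_Suc_dim)
  also have "\<dots> = Suc (s + k) choose k"
    using sum_choose_lower[of s k] by simp
  finally show ?thesis using False k s by (simp add: cone_count_Suc_dim)
qed

type_synonym cones = "(nat \<times> nat) multiset"

definition hilb :: "cones \<Rightarrow> nat \<Rightarrow> nat" where
  "hilb P t = (\<Sum>(a, m)\<in>#P. cone_count a m t)"

lemma hilb_simps [simp]:
  "hilb {#} t = 0"
  "hilb (add_mset (a, m) P) t = cone_count a m t + hilb P t"
  "hilb (P + Q) t = hilb P t + hilb Q t"
  by (simp_all add: hilb_def)

text \<open>Zero-dimensional cones are exempt: subdividing in degree \<open>c\<close> leaves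
  vertices in degree \<open>c\<close>, and these must not prevent the result from being standard
  from \<open>Suc c\<close> on.\<close>

definition standard :: "nat \<Rightarrow> cones \<Rightarrow> bool" where
  "standard c P \<longleftrightarrow> (\<forall>(a, m)\<in>#P. m > 0 \<longrightarrow>
     c \<le> a \<and> (\<forall>b\<in>{c..a}. \<exists>m'\<ge>m. (b, m') \<in># P))"

lemma standardD:
  assumes "standard c P" "(a, m) \<in># P" "m > 0"
  shows "c \<le> a" "\<And>b. c \<le> b \<Longrightarrow> b \<le> a \<Longrightarrow> \<exists>m'\<ge>m. (b, m') \<in># P"
proof -
  have "case (a, m) of (a, m) \<Rightarrow> m > 0 \<longrightarrow> c \<le> a \<and> (\<forall>b\<in>{c..a}. \<exists>m'\<ge>m. (b, m') \<in># P)"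
    using assms(1,2) unfolding standard_def by (rule bspec)
  then show "c \<le> a" "\<And>b. c \<le> b \<Longrightarrow> b \<le> a \<Longrightarrow> \<exists>m'\<ge>m. (b, m') \<in># P"
    using assms(3) by simp_all
qed

lemma standardI:
  assumes "\<And>a m. (a, m) \<in># P \<Longrightarrow> m > 0 \<Longrightarrow> c \<le> a"
    and "\<And>a m b. (a, m) \<in># P \<Longrightarrow> m > 0 \<Longrightarrow> c \<le> b \<Longrightarrow> b \<le> a \<Longrightarrow> \<exists>m'\<ge>m. (b, m') \<in># P"
  shows "standard c P"
  unfolding standard_def
proof (intro ballI, clarify)
  fix a m assume "(a, m) \<in># P" "0 < m"
  then show "c \<le> a \<and> (\<forall>b\<in>{c..a}. \<exists>m'\<ge>m. (b, m') \<in># P)"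
    using assms[of a m] by simp
qed

lemma standard_union:
  assumes "standard c P" "standard c Q"
  shows "standard c (P + Q)"
proof (rule standardI)
  fix a m assume "(a, m) \<in># P + Q" "m > 0"
  then show "c \<le> a" using standardD(1) assms by (metis union_iff)
next
  fix a m b assume "(a, m) \<in># P + Q" "m > 0" "c \<le> b" "b \<le> a"
  then show "\<exists>m'\<ge>m. (b, m') \<in># P + Q" using standardD(2) assms by (metis union_iff)
qed

text \<open>The cone \<open>h K[x\<^sub>1,\<dots>,x\<^sub>m]\<close> consists of its vertex \<open>h\<close> and the cones \<open>x\<^sub>i h K[x\<^sub>i,\<dots>,x\<^sub>m]\<close>.\<close>

definition subdivide_cone :: "nat \<Rightarrow> nat \<times> nat \<Rightarrow> cones" where
  "subdivide_cone c = (\<lambda>(a, m). if a = c \<and> m > 0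
     then add_mset (c, 0) (mset_set (Pair (Suc c) ` {1..m})) else {#(a, m)#})"

definition subdivide :: "nat \<Rightarrow> cones \<Rightarrow> cones" where
  "subdivide c P = (\<Sum>p\<in>#P. subdivide_cone c p)"

lemma subdivide_simps [simp]:
  "subdivide c {#} = {#}"
  "subdivide c (add_mset p P) = subdivide_cone c p + subdivide c P"
  by (simp_all add: subdivide_def)

lemma in_subdivide_cone:
  "p \<in># subdivide_cone c (a, m) \<longleftrightarrow>
     (if a = c \<and> m > 0 then p = (c, 0) \<or> (\<exists>i\<in>{1..m}. p = (Suc c, i)) else p = (a, m))"
  by (auto simp: subdivide_cone_def)

lemma in_subdivide: "p \<in># subdivide c P \<longleftrightarrow> (\<exists>q\<in>#P. p \<in># subdivide_cone c q)"
  by (induction P) auto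

lemma hilb_subdivide [simp]: "hilb (subdivide c P) t = hilb P t"
proof (induction P)
  case (add p P)
  obtain a m where p: "p = (a, m)" by (cases p)
  have "hilb (subdivide_cone c p) t = cone_count a m t"
  proof (cases "a = c \<and> m > 0")
    case True
    have "hilb (mset_set (Pair (Suc c) ` {1..m})) t = (\<Sum>i=1..m. cone_count (Suc c) i t)"
      unfolding hilb_def sum_unfold_sum_mset[symmetric]
      by (subst sum.reindex) (auto simp: inj_on_def)
    then show ?thesis
      using True cone_count_split[of m c t] by (simp add: p subdivide_cone_def cone_count_zero_dim)
  qed (auto simp: p subdivide_cone_def)
  then show ?case using add p by simp
qed simp

text \<open>\<open>Q\<close> holds the cones of degree \<open>c\<close> that are kept unsplit. They
  are never the witnesses required in a degree above \<open>c\<close>, and those witnesses survive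
  subdivision unchanged. The new cones of positive dimension all lie in degree \<open>Suc c\<close>,
  where each is its own witness.\<close>

lemma standard_subdivide:
  assumes "standard c (P + Q)" "\<And>a m. (a, m) \<in># Q \<Longrightarrow> a = c"
  shows "standard (Suc c) (subdivide c P)"
  unfolding standard_def
proof (clarsimp)
  fix a m assume am: "(a, m) \<in># subdivide c P" "0 < m"
  then obtain a0 m0 where q: "(a0, m0) \<in># P" "(a, m) \<in># subdivide_cone c (a0, m0)"
    by (auto simp: in_subdivide)
  show "Suc c \<le> a \<and> (\<forall>b\<in>{Suc c..a}. \<exists>m'\<ge>m. (b, m') \<in># subdivide c P)"
  proof (cases "a0 = c \<and> m0 > 0")
    case True
    then have "a = Suc c" using q(2) am(2) by (auto simp: in_subdivide_cone)
    then show ?thesis using am by (auto intro: exI[of _ m])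
  next
    case False
    then have e: "a0 = a" "m0 = m" using q(2) by (auto simp: in_subdivide_cone)
    have "c \<le> a" using standardD(1)[OF assms(1), of a m] q(1) am(2) e by simp
    then have c: "c < a" using am(2) e False by simp
    have "\<exists>m'\<ge>m. (b, m') \<in># subdivide c P" if b: "b \<in> {Suc c..a}" for b
    proof -
      obtain m' where m': "m' \<ge> m" "(b, m') \<in># P + Q"
        using standardD(2)[OF assms(1), of a m b] q(1) am(2) e b by auto
      then have "(b, m') \<in># P" using assms(2) b by auto
      moreover have "(b, m') \<in># subdivide_cone c (b, m')" using b by (auto simp: in_subdivide_cone)
      ultimately show ?thesis using m' by (auto simp: in_subdivide)
    qed
    then show ?thesis using c by auto
  qed
qed

definition dim_le :: "nat \<Rightarrow> cones \<Rightarrow> bool" where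
  "dim_le n P \<longleftrightarrow> (\<forall>(a, m)\<in>#P. m \<le> n)"

lemma dim_le_subdivide: "dim_le n P \<Longrightarrow> dim_le n (subdivide c P)"
  by (fastforce simp: dim_le_def in_subdivide in_subdivide_cone split: if_splits)

lemma in_subdivide_degree: "(a, m) \<in># P \<Longrightarrow> \<exists>m'. (a, m') \<in># subdivide c P"
  by (rule exI[of _ "if a = c \<and> m > 0 then 0 else m"])
     (auto simp: in_subdivide in_subdivide_cone intro!: bexI[of _ "(a, m)"])

text \<open>Among the pieces of a cone of dimension \<open>n\<close> only the one with
  \<open>i = n\<close> has dimension \<open>n\<close>. Hence the number of top-dimensional cones can
  serve as an induction measure.\<close>

lemma count_dim_subdivide:
  assumes "dim_le n P" "n > 0"
  shows "size {#p \<in># subdivide c P. snd p = n#} = size {#p \<in># P. snd p = n#}"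
  using assms(1)
proof (induction P)
  case (add p P)
  obtain a m where p: "p = (a, m)" by (cases p)
  have m: "m \<le> n" "dim_le n P" using add.prems by (auto simp: dim_le_def p)
  have "size {#p \<in># subdivide_cone c p. snd p = n#} = of_bool (m = n)"
  proof (cases "a = c \<and> m > 0")
    case True
    have "{q \<in> Pair (Suc c) ` {1..m}. snd q = n} = (if m = n then {(Suc c, n)} else {})"
      using m assms(2) by auto
    then show ?thesis using True assms(2) by (simp add: p subdivide_cone_def)
  qed (auto simp: p subdivide_cone_def)
  then show ?case using add m by (simp add: p)
qed simp

text \<open>Repeated subdivision in the lowest degree. The last conclusion follows degrees only: a
  split cone leaves its vertex behind, so its degree still occurs even if its dimension drops to
  zero.\<close>

lemma push_standard:
  assumes "standard c P" "dim_le n P" "c \<le> d"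
  shows "\<exists>Q. standard d Q \<and> dim_le n Q \<and> hilb Q = hilb P \<and> (\<forall>(a, m)\<in>#P. \<exists>m'. (a, m') \<in># Q)"
  using assms(3)
proof (induction d rule: dec_induct)
  case base
  show ?case using assms by (intro exI[of _ P]) auto
next
  case (step k)
  then obtain Q where Q: "standard k Q" "dim_le n Q" "hilb Q = hilb P"
    "\<forall>(a, m)\<in>#P. \<exists>m'. (a, m') \<in># Q" by auto
  have 1: "standard (Suc k) (subdivide k Q)" using standard_subdivide[of k Q "{#}"] Q(1) by simp
  have 2: "hilb (subdivide k Q) = hilb P" by (rule ext) (simp add: Q(3))
  have 3: "\<forall>(a, m)\<in>#P. \<exists>m'. (a, m') \<in># subdivide k Q"
  proof clarify
    fix a m assume "(a, m) \<in># P"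
    then obtain m' where "(a, m') \<in># Q" using Q(4) by auto
    then show "\<exists>m'. (a, m') \<in># subdivide k Q" by (rule in_subdivide_degree)
  qed
  show ?case
    by (rule exI[of _ "subdivide k Q"]) (intro conjI 1 2 3 dim_le_subdivide Q(2))
qed

text \<open>An exact decomposition has, in each degree \<open>s\<close>, at most one cone of positive dimension, and that
  dimension is \<open>i\<close> precisely for \<open>b (i + 1) \<le> s < b i\<close>.\<close>

definition exact_count :: "nat \<Rightarrow> (nat \<Rightarrow> nat) \<Rightarrow> nat \<Rightarrow> nat" where
  "exact_count n b t = (\<Sum>i=1..n. \<Sum>s=b (Suc i)..<b i. cone_count s i t)"

text \<open>In degree \<open>c\<close> a single cone of maximal dimension is kept and all others are subdivided. If that
  dimension is \<open>n\<close>, the number of remaining \<open>n\<close>-dimensional cones drops by one. The function \<open>z\<close>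
  collects the zero-dimensional cones.\<close>

lemma exact_decomposition:
  assumes "standard c P" "dim_le n P"
  shows "\<exists>b z. b (Suc n) = c \<and> (\<forall>i\<in>{1..n}. b (Suc i) \<le> b i) \<and>
           (\<forall>t. hilb P t = exact_count n b t + z t) \<and> finite {t. z t \<noteq> 0} \<and>
           (\<forall>(a, m)\<in>#P. a < b 1 \<or> z a > 0)"
  using assms
proof (induction n arbitrary: c P)
  case 0
  have fin: "finite {t. hilb P t \<noteq> 0}"
  proof (rule finite_subset)
    show "{t. hilb P t \<noteq> 0} \<subseteq> fst ` set_mset P"
    proof (rule subsetI, rule ccontr)
      fix t assume t: "t \<in> {t. hilb P t \<noteq> 0}" "t \<notin> fst ` set_mset P"
      have "(case p of (a, m) \<Rightarrow> cone_count a m t) = 0" if "p \<in># P" for p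
      proof -
        have "snd p = 0" "fst p \<noteq> t" using 0(2) that t(2) by (auto simp: dim_le_def)
        then show ?thesis by (auto simp: cone_count_zero_dim split_def)
      qed
      then have "hilb P t = 0" unfolding hilb_def by (intro sum_mset.neutral) auto
      then show False using t(1) by simp
    qed
  qed simp
  have pos: "hilb P a > 0" if am: "(a, m) \<in># P" for a m
  proof -
    have "m = 0" using 0(2) am by (auto simp: dim_le_def)
    then obtain P' where "P = add_mset (a, 0) P'" using am by (metis mset_add)
    then show ?thesis by (simp add: cone_count_zero_dim)
  qed
  have "\<forall>(a, m)\<in>#P. a < c \<or> hilb P a > 0" by (auto dest: pos)
  then show ?case
    by - (rule exI[of _ "\<lambda>_. c"], rule exI[of _ "hilb P"], use fin in \<open>simp add: exact_count_def\<close>)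
next
  case (Suc n)
  define k where "k = size {#p \<in># P. snd p = Suc n#}"
  show ?case using k_def Suc.prems
  proof (induction k arbitrary: c P)
    case 0
    have "snd p \<noteq> Suc n" if "p \<in># P" for p
    proof -
      have "{#p \<in># P. snd p = Suc n#} = {#}" using 0(1) by (metis size_eq_0_iff_empty)
      then show ?thesis using that by (cases p) auto
    qed
    then have "dim_le n P" using 0(3) by (force simp: dim_le_def le_Suc_eq)
    from Suc.IH[OF 0(2) this] obtain b z where
      bz: "b (Suc n) = c" "\<forall>i\<in>{1..n}. b (Suc i) \<le> b i"
        "\<forall>t. hilb P t = exact_count n b t + z t" "finite {t. z t \<noteq> 0}"
        "\<forall>(a, m)\<in>#P. a < b 1 \<or> z a > 0" by blast
    \<comment> \<open>No cone has the top dimension, so the interval for that dimension is made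
      empty by repeating the endpoint \<open>c\<close>.\<close>
    define b' where "b' = b(Suc (Suc n) := c)"
    have "exact_count (Suc n) b' t = exact_count n b t" for t
      using bz(1) by (simp add: exact_count_def b'_def)
    moreover have "b' (Suc (Suc n)) = c" "b' 1 = b 1" "\<forall>i\<in>{1..Suc n}. b' (Suc i) \<le> b' i"
      using bz(1,2) by (auto simp: b'_def le_Suc_eq)
    ultimately show ?case using bz(3-5)
      by - (rule exI[of _ b'], rule exI[of _ z], simp)
  next
    case (Suc k)
    note IH = Suc.IH and P = Suc.prems
    have "{#p \<in># P. snd p = Suc n#} \<noteq> {#}" using P(1) by (metis nat.simps(3) size_empty)
    then obtain p where "p \<in># {#p \<in># P. snd p = Suc n#}" by (rule multiset_nonemptyE)
    then obtain a where a: "(a, Suc n) \<in># P" by (cases p) auto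
    \<comment> \<open>Standardness carries any cone of dimension \<open>Suc n\<close> down to degree
      \<open>c\<close>; \<open>dim_le\<close> then makes the dimension there exactly
      \<open>Suc n\<close>.\<close>
    obtain m' where m': "m' \<ge> Suc n" "(c, m') \<in># P"
      using standardD[OF P(2) a] by auto
    then have cP: "(c, Suc n) \<in># P" using P(3) by (force simp: dim_le_def)
    define P1 where "P1 = P - {#(c, Suc n)#}"
    have P1: "P = add_mset (c, Suc n) P1" using cP by (simp add: P1_def)
    have dl: "dim_le (Suc n) P1" using P(3) by (auto simp: P1 dim_le_def)
    have "standard (Suc c) (subdivide c P1)"
      using standard_subdivide[of c P1 "{#(c, Suc n)#}"] P(2) P1 by simp
    moreover have "k = size {#p \<in># subdivide c P1. snd p = Suc n#}"
      using P(1) dl by (simp add: count_dim_subdivide P1)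
    ultimately obtain b z where
      bz: "b (Suc (Suc n)) = Suc c" "\<forall>i\<in>{1..Suc n}. b (Suc i) \<le> b i"
        "\<forall>t. hilb (subdivide c P1) t = exact_count (Suc n) b t + z t" "finite {t. z t \<noteq> 0}"
        "\<forall>(a, m)\<in>#subdivide c P1. a < b 1 \<or> z a > 0"
      using IH[of "subdivide c P1" "Suc c"] dim_le_subdivide[OF dl] by blast
    \<comment> \<open>Lowering the top endpoint from \<open>Suc c\<close> to \<open>c\<close>
      accounts for precisely the cone that was kept.\<close>
    define b' where "b' = b(Suc (Suc n) := c)"
    have le: "Suc c \<le> b (Suc n)" using bz(1,2) by force
    have "{c..<b (Suc n)} = insert c {Suc c..<b (Suc n)}" using le by auto
    then have "exact_count (Suc n) b' t = cone_count c (Suc n) t + exact_count (Suc n) b t" for t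
      using bz(1) by (simp add: exact_count_def b'_def)
    then have 1: "hilb P t = exact_count (Suc n) b' t + z t" for t
      using bz(3) by (simp add: P1)
    have "b (Suc n) \<le> b 1"
    proof -
      have "i \<in> {1..Suc n} \<Longrightarrow> b i \<le> b 1" for i
      proof (induction i)
        case (Suc i)
        then show ?case using bz(2) by (cases "i = 0") (auto intro: order_trans)
      qed simp
      then show ?thesis by simp
    qed
    \<comment> \<open>The kept cone has degree \<open>c\<close>, and c < b (n+1) <= b 1; every other
      degree survives subdivision.\<close>
    then have 2: "a < b 1 \<or> z a > 0" if "(a, m) \<in># P" for a m
      using that le bz(5) in_subdivide_degree[of a m P1 c] by (fastforce simp: P1)
    have "\<forall>i\<in>{1..Suc n}. b' (Suc i) \<le> b' i" using bz(2) le by (auto simp: b'_def)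
    moreover have "b' (Suc (Suc n)) = c" "b' 1 = b 1" by (auto simp: b'_def)
    moreover have "\<forall>(a, m)\<in>#P. a < b 1 \<or> z a > 0" by (auto dest!: 2)
    ultimately show ?case using 1 bz(4)
      by - (rule exI[of _ b'], rule exI[of _ z], simp)
  qed
qed

section \<open>Complements of monomial ideals\<close>

text \<open>Dickson's lemma. \<open>F\<close> takes care of the first \<open>N\<close> coordinates.
  Elements with a large last coordinate are covered by \<open>F\<close> itself, and the remaining
  ones lie in finitely many slices on which that coordinate is fixed.\<close>

lemma dickson:
  fixes g :: "'a \<Rightarrow> nat \<Rightarrow> nat"
  shows "\<exists>F\<subseteq>M. finite F \<and> (\<forall>a\<in>M. \<exists>f\<in>F. \<forall>i<N. g f i \<le> g a i)"
proof (induction N arbitrary: M)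
  case 0
  show ?case
  proof (cases "M = {}")
    case False
    then obtain a where "a \<in> M" by blast
    then show ?thesis by (intro exI[of _ "{a}"]) auto
  qed auto
next
  case (Suc N)
  obtain F where F: "F \<subseteq> M" "finite F" "\<forall>a\<in>M. \<exists>f\<in>F. \<forall>i<N. g f i \<le> g a i"
    using Suc by meson
  \<comment> \<open>Any common upper bound of the last coordinates works; a sum also makes sense for
    empty \<open>F\<close>.\<close>
  define K where "K = (\<Sum>f\<in>F. g f N)"
  have K: "g f N \<le> K" if "f \<in> F" for f
    unfolding K_def by (rule member_le_sum) (use that F(2) in auto)
  have "\<forall>k. \<exists>H\<subseteq>{a\<in>M. g a N = k}. finite H \<and>
      (\<forall>a\<in>{a\<in>M. g a N = k}. \<exists>f\<in>H. \<forall>i<N. g f i \<le> g a i)"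
    using Suc by meson
  from choice[OF this] obtain H where H0: "\<forall>k. H k \<subseteq> {a\<in>M. g a N = k} \<and> finite (H k) \<and>
      (\<forall>a\<in>{a\<in>M. g a N = k}. \<exists>f\<in>H k. \<forall>i<N. g f i \<le> g a i)" ..
  then have H: "\<And>k. H k \<subseteq> {a\<in>M. g a N = k}" "\<And>k. finite (H k)"
      "\<And>k a. a \<in> M \<Longrightarrow> g a N = k \<Longrightarrow> \<exists>f\<in>H k. \<forall>i<N. g f i \<le> g a i" by simp_all
  have "\<exists>f\<in>F \<union> (\<Union>k<K. H k). \<forall>i<Suc N. g f i \<le> g a i" if a: "a \<in> M" for a
  proof (cases "g a N < K")
    case True
    obtain f where "f \<in> H (g a N)" "\<forall>i<N. g f i \<le> g a i" using H(3) a by blast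
    moreover have "g f N = g a N" using H(1) calculation(1) by blast
    ultimately show ?thesis using True by (intro bexI[of _ f]) (auto simp: less_Suc_eq)
  next
    case False
    obtain f where "f \<in> F" "\<forall>i<N. g f i \<le> g a i" using F(3) a by blast
    then show ?thesis using K[of f] False by (intro bexI[of _ f]) (auto simp: less_Suc_eq)
  qed
  moreover have "(\<Union>k<K. H k) \<subseteq> M" using H(1) by blast
  ultimately show ?case using F(1,2) H(2)
    by (intro exI[of _ "F \<union> (\<Union>k<K. H k)"]) simp
qed

section \<open>Exponents, divisibility and cones of monomials\<close>

abbreviation lookup where "lookup \<equiv> Poly_Mapping.lookup"

lemma exps_iff: "\<alpha> \<in> exps N \<longleftrightarrow> (\<forall>i\<ge>N. lookup \<alpha> i = 0)"
  unfolding exps_def by (simp add: subset_iff in_keys_iff) (metis linorder_not_less neq0_conv)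

lemma exps_zero [simp]: "0 \<in> exps N"
  by (simp add: exps_iff)

lemma exps_add [simp]: "\<alpha> + \<beta> \<in> exps N \<longleftrightarrow> \<alpha> \<in> exps N \<and> \<beta> \<in> exps N"
  by (auto simp: exps_iff lookup_add)

lemma exps_single [simp]: "i < N \<Longrightarrow> Poly_Mapping.single i k \<in> exps N"
  by (auto simp: exps_iff lookup_single when_def)

lemma exp_size_eq_sum:
  "finite A \<Longrightarrow> Poly_Mapping.keys \<alpha> \<subseteq> A \<Longrightarrow> exp_size \<alpha> = (\<Sum>i\<in>A. lookup \<alpha> i)"
  unfolding exp_size_def by (rule sum.mono_neutral_left) (auto simp: in_keys_iff)

lemma exp_size_zero [simp]: "exp_size 0 = 0"
  by (simp add: exp_size_def)

lemma exp_size_add [simp]: "exp_size (\<alpha> + \<beta>) = exp_size \<alpha> + exp_size \<beta>"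
proof -
  let ?A = "Poly_Mapping.keys \<alpha> \<union> Poly_Mapping.keys \<beta>"
  have "exp_size (\<alpha> + \<beta>) = (\<Sum>i\<in>?A. lookup (\<alpha> + \<beta>) i)"
    by (rule exp_size_eq_sum) (auto simp: in_keys_iff lookup_add)
  also have "\<dots> = (\<Sum>i\<in>?A. lookup \<alpha> i) + (\<Sum>i\<in>?A. lookup \<beta> i)"
    by (simp add: lookup_add sum.distrib)
  also have "\<dots> = exp_size \<alpha> + exp_size \<beta>"
    by (simp add: exp_size_eq_sum[symmetric])
  finally show ?thesis .
qed

lemma exp_size_single [simp]: "exp_size (Poly_Mapping.single i k) = k"
  by (cases "k = 0") (simp_all add: exp_size_def)

lemma exp_dvd_iff: "exp_dvd \<alpha> \<beta> \<longleftrightarrow> (\<exists>\<gamma>. \<beta> = \<alpha> + \<gamma>)"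
proof
  assume "exp_dvd \<alpha> \<beta>"
  then have "\<beta> = \<alpha> + (\<beta> - \<alpha>)"
    by (intro poly_mapping_eqI) (simp add: lookup_add lookup_minus exp_dvd_def)
  then show "\<exists>\<gamma>. \<beta> = \<alpha> + \<gamma>" ..
qed (auto simp: exp_dvd_def lookup_add)

lemma exp_dvd_refl [simp]: "exp_dvd \<alpha> \<alpha>"
  by (simp add: exp_dvd_def)

lemma exp_dvd_trans: "exp_dvd \<alpha> \<beta> \<Longrightarrow> exp_dvd \<beta> \<gamma> \<Longrightarrow> exp_dvd \<alpha> \<gamma>"
  by (auto simp: exp_dvd_def intro: order_trans)

lemma exp_dvd_antisym: "exp_dvd \<alpha> \<beta> \<Longrightarrow> exp_dvd \<beta> \<alpha> \<Longrightarrow> \<alpha> = \<beta>"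
  by (intro poly_mapping_eqI) (auto simp: exp_dvd_def intro: antisym)

lemma exp_dvd_add: "exp_dvd \<alpha> (\<alpha> + \<beta>)"
  by (auto simp: exp_dvd_iff)

lemma exp_size_mono: "exp_dvd \<alpha> \<beta> \<Longrightarrow> exp_size \<alpha> \<le> exp_size \<beta>"
  by (auto simp: exp_dvd_iff)

lemma lookup_le_exp_size: "lookup \<alpha> i \<le> exp_size \<alpha>"
  unfolding exp_size_def
  by (cases "i \<in> Poly_Mapping.keys \<alpha>") (auto intro: member_le_sum simp: in_keys_iff)

lemma finite_exps_size [simp]: "finite {\<alpha> \<in> exps N. exp_size \<alpha> = t}"
proof (rule finite_imageD)
  let ?f = "\<lambda>\<alpha>. map (lookup \<alpha>) [0..<N]"
  have "?f ` {\<alpha> \<in> exps N. exp_size \<alpha> = t} \<subseteq> {xs. set xs \<subseteq> {..t} \<and> length xs = N}"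
    using lookup_le_exp_size by auto
  then show "finite (?f ` {\<alpha> \<in> exps N. exp_size \<alpha> = t})"
    by (rule finite_subset) (simp add: finite_lists_length_eq)
  show "inj_on ?f {\<alpha> \<in> exps N. exp_size \<alpha> = t}"
  proof (rule inj_onI)
    fix \<alpha> \<beta> assume *: "\<alpha> \<in> {\<alpha> \<in> exps N. exp_size \<alpha> = t}" "\<beta> \<in> {\<alpha> \<in> exps N. exp_size \<alpha> = t}"
      "?f \<alpha> = ?f \<beta>"
    show "\<alpha> = \<beta>"
    proof (rule poly_mapping_eqI)
      fix i show "lookup \<alpha> i = lookup \<beta> i"
        using * by (cases "i < N") (auto simp: exps_iff)
    qed
  qed
qed

definition orthant :: "(nat \<Rightarrow>\<^sub>0 nat) \<Rightarrow> nat set \<Rightarrow> (nat \<Rightarrow>\<^sub>0 nat) set" where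
  "orthant h u = {\<beta>. exp_dvd h \<beta> \<and> (\<forall>i. i \<notin> u \<longrightarrow> lookup \<beta> i = lookup h i)}"

lemma orthant_self [simp]: "h \<in> orthant h u"
  by (simp add: orthant_def)

lemma orthant_empty [simp]: "orthant h {} = {h}"
  by (auto simp: orthant_def intro: poly_mapping_eqI)

lemma orthant_subset_exps: "h \<in> exps N \<Longrightarrow> u \<subseteq> {..<N} \<Longrightarrow> orthant h u \<subseteq> exps N"
  by (auto simp: orthant_def exps_iff) (metis in_mono lessThan_iff linorder_not_less)

lemma orthant_all: "orthant 0 {..<N} = exps N"
  by (auto simp: orthant_def exps_iff exp_dvd_def)

lemma orthant_step:
  assumes "i \<in> u"
  shows "orthant h u = orthant h (u - {i}) \<union> orthant (h + Poly_Mapping.single i 1) u"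
    and "orthant h (u - {i}) \<inter> orthant (h + Poly_Mapping.single i 1) u = {}"
proof -
  let ?e = "Poly_Mapping.single i (Suc 0)"
  have e: "lookup (h + ?e) j = lookup h j + (if i = j then 1 else 0)" for j
    by (simp add: lookup_add lookup_single when_def)
  have "orthant h u = orthant h (u - {i}) \<union> orthant (h + ?e) u"
    and "orthant h (u - {i}) \<inter> orthant (h + ?e) u = {}"
  proof -
    show "orthant h u = orthant h (u - {i}) \<union> orthant (h + ?e) u"
    proof (intro set_eqI iffI)
      fix \<beta> assume b: "\<beta> \<in> orthant h u"
      show "\<beta> \<in> orthant h (u - {i}) \<union> orthant (h + ?e) u"
      proof (cases "lookup \<beta> i = lookup h i")
        case False
        moreover have "lookup h i \<le> lookup \<beta> i" using b by (simp add: orthant_def exp_dvd_def)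
        ultimately have "lookup \<beta> i \<ge> lookup h i + 1" by simp
        then show ?thesis using b assms by (auto simp: orthant_def exp_dvd_def e)
      qed (use b in \<open>auto simp: orthant_def\<close>)
    next
      fix \<beta> assume b: "\<beta> \<in> orthant h (u - {i}) \<union> orthant (h + ?e) u"
      have "exp_dvd h \<beta>" using b by (auto simp: orthant_def intro: exp_dvd_trans[OF exp_dvd_add])
      then show "\<beta> \<in> orthant h u" using b assms by (auto simp: orthant_def e)
    qed
    show "orthant h (u - {i}) \<inter> orthant (h + ?e) u = {}"
    proof -
      have False if "\<beta> \<in> orthant h (u - {i})" "\<beta> \<in> orthant (h + ?e) u" for \<beta>
      proof -
        have "lookup \<beta> i = lookup h i" using that(1) by (simp add: orthant_def)
        moreover have "lookup (h + ?e) i \<le> lookup \<beta> i" using that(2) by (simp add: orthant_def exp_dvd_def)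
        ultimately show False by (simp add: e)
      qed
      then show ?thesis by blast
    qed
  qed
  then show "orthant h u = orthant h (u - {i}) \<union> orthant (h + Poly_Mapping.single i 1) u"
    and "orthant h (u - {i}) \<inter> orthant (h + Poly_Mapping.single i 1) u = {}" by simp_all
qed

lemma card_orthant_step:
  assumes "i \<in> u" "h \<in> exps N" "u \<subseteq> {..<N}"
  shows "card {\<beta> \<in> orthant h u - M. exp_size \<beta> = t} =
    card {\<beta> \<in> orthant h (u - {i}) - M. exp_size \<beta> = t} +
    card {\<beta> \<in> orthant (h + Poly_Mapping.single i 1) u - M. exp_size \<beta> = t}"
proof -
  let ?A = "{\<beta> \<in> orthant h (u - {i}) - M. exp_size \<beta> = t}"
  let ?B = "{\<beta> \<in> orthant (h + Poly_Mapping.single i 1) u - M. exp_size \<beta> = t}"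
  have fin: "finite {\<beta> \<in> orthant h' u' - M. exp_size \<beta> = t}"
    if hu: "h' \<in> exps N" "u' \<subseteq> {..<N}" for h' u'
  proof (rule finite_subset)
    show "{\<beta> \<in> orthant h' u' - M. exp_size \<beta> = t} \<subseteq> {\<beta> \<in> exps N. exp_size \<beta> = t}"
      using orthant_subset_exps[OF hu] by blast
  qed simp
  have i: "i < N" using assms by auto
  have "{\<beta> \<in> orthant h u - M. exp_size \<beta> = t} = {\<beta> \<in> orthant h (u - {i}) - M. exp_size \<beta> = t} \<union>
    {\<beta> \<in> orthant (h + Poly_Mapping.single i 1) u - M. exp_size \<beta> = t}"
    by (subst orthant_step(1)[OF assms(1)]) auto
  moreover have "card (?A \<union> ?B) = card ?A + card ?B"
  proof (rule card_Un_disjoint)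
    show "finite ?A" by (rule fin) (use assms in auto)
    show "finite ?B" by (rule fin) (use assms i in simp_all)
    show "?A \<inter> ?B = {}" using orthant_step(2)[OF assms(1), of h] by blast
  qed
  ultimately show ?thesis by simp
qed

text \<open>Pascal's rule, the numerical form of \<open>orthant_step\<close>: the elements that do
  not use a given direction, and those that do.\<close>

lemma cone_count_Pascal:
  "cone_count a (Suc m) t = cone_count a m t + cone_count (Suc a) (Suc m) t"
proof (cases "a < t")
  case True
  then obtain s where s: "t = Suc (a + s)" using less_imp_Suc_add by blast
  then show ?thesis by (simp add: cone_count_def)
qed (auto simp: cone_count_def)

lemma card_orthant:
  assumes "h \<in> exps N" "u \<subseteq> {..<N}"
  shows "card {\<beta> \<in> orthant h u. exp_size \<beta> = t} = cone_count (exp_size h) (card u) t"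
proof -
  have "finite u" using assms finite_subset by blast
  then show ?thesis using assms
  proof (induction u arbitrary: h)
    case empty
    have "{\<beta> \<in> orthant h {}. exp_size \<beta> = t} = (if exp_size h = t then {h} else {})" by auto
    then show ?case by (simp add: cone_count_zero_dim)
  next
    case (insert i u)
    show ?case using insert.prems(1)
    proof (induction "t - exp_size h" arbitrary: h rule: less_induct)
      case less
      show ?case
      proof (cases "t < exp_size h")
        case True
        have "exp_size h \<le> exp_size \<beta>" if "\<beta> \<in> orthant h (insert i u)" for \<beta>
          using that by (auto simp: orthant_def intro: exp_size_mono)
        then have none: "{\<beta> \<in> orthant h (insert i u). exp_size \<beta> = t} = {}" using True by force
        show ?thesis unfolding none using True by (simp add: cone_count_def)
      next
        case False
        let ?h = "h + Poly_Mapping.single i 1"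
        have h: "?h \<in> exps N" using less.prems insert.prems by auto
        have 1: "card {\<beta> \<in> orthant h (insert i u). exp_size \<beta> = t} =
          card {\<beta> \<in> orthant h u. exp_size \<beta> = t} + card {\<beta> \<in> orthant ?h (insert i u). exp_size \<beta> = t}"
          using card_orthant_step[of i "insert i u" h N "{}" t] less.prems insert.prems insert.hyps
          by simp
        have 2: "card {\<beta> \<in> orthant h u. exp_size \<beta> = t} = cone_count (exp_size h) (card u) t"
          using insert.IH less.prems insert.prems by simp
        have 3: "card {\<beta> \<in> orthant ?h (insert i u). exp_size \<beta> = t} =
            cone_count (Suc (exp_size h)) (Suc (card u)) t"
        \<comment> \<open>At equality the truncated measure \<open>t - exp_size h\<close> is already
          zero and cannot decrease, so this case is counted directly.\<close>
        proof (cases "t = exp_size h")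
          case True
          have "Suc (exp_size h) \<le> exp_size \<beta>" if "\<beta> \<in> orthant ?h (insert i u)" for \<beta>
            using that exp_size_mono[of ?h \<beta>] by (auto simp: orthant_def)
          then have none: "{\<beta> \<in> orthant ?h (insert i u). exp_size \<beta> = t} = {}" using True by force
          show ?thesis unfolding none using True by (simp add: cone_count_def)
        next
          case neq: False
          show ?thesis using less.hyps[of ?h] h neq False insert.hyps by simp
        qed
        show ?thesis unfolding 1 2 3
          using insert.hyps cone_count_Pascal[of "exp_size h" "card u" t] by simp
      qed
    qed
  qed
qed

text \<open>The second and third clauses are the invariant that keeps standardness alive in the
  recursion: every cone of \<open>P\<close> has a cone of the same dimension at the vertex
  \<open>h\<close> that avoids \<open>M\<close>, and \<open>P\<close> has a cone at \<open>h\<close>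
  at least as large as any that avoids \<open>M\<close>. The last clause ties minimal elements of
  \<open>M\<close> to degrees of cones.\<close>

definition splits_orthant :: "(nat \<Rightarrow>\<^sub>0 nat) set \<Rightarrow> nat set \<Rightarrow> (nat \<Rightarrow>\<^sub>0 nat) \<Rightarrow> cones \<Rightarrow> bool" where
  "splits_orthant M u h P \<longleftrightarrow>
    (\<forall>t. hilb P t = card {\<beta> \<in> orthant h u - M. exp_size \<beta> = t}) \<and>
    (\<forall>a m. (a, m) \<in># P \<longrightarrow> exp_size h \<le> a \<and> (\<exists>v\<subseteq>u. card v = m \<and> orthant h v \<inter> M = {})) \<and>
    (\<forall>v\<subseteq>u. orthant h v \<inter> M = {} \<longrightarrow> (\<exists>m\<ge>card v. (exp_size h, m) \<in># P)) \<and>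
    standard (exp_size h) P \<and>
    (\<forall>\<alpha>\<in>orthant h u \<inter> M. (\<forall>\<beta>\<in>M. exp_dvd \<beta> \<alpha> \<longrightarrow> \<beta> = \<alpha>) \<longrightarrow> \<alpha> \<noteq> h \<longrightarrow>
       (\<exists>a m. (a, m) \<in># P \<and> exp_size \<alpha> \<le> Suc a))"

lemma splits_orthantD:
  assumes "splits_orthant M u h P"
  shows "hilb P t = card {\<beta> \<in> orthant h u - M. exp_size \<beta> = t}"
    and "(a, m) \<in># P \<Longrightarrow> exp_size h \<le> a"
    and "(a, m) \<in># P \<Longrightarrow> \<exists>v\<subseteq>u. card v = m \<and> orthant h v \<inter> M = {}"
    and "v \<subseteq> u \<Longrightarrow> orthant h v \<inter> M = {} \<Longrightarrow> \<exists>m\<ge>card v. (exp_size h, m) \<in># P"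
    and "standard (exp_size h) P"
    and "\<alpha> \<in> orthant h u \<Longrightarrow> \<alpha> \<in> M \<Longrightarrow> \<forall>\<beta>\<in>M. exp_dvd \<beta> \<alpha> \<longrightarrow> \<beta> = \<alpha> \<Longrightarrow> \<alpha> \<noteq> h \<Longrightarrow>
       \<exists>a m. (a, m) \<in># P \<and> exp_size \<alpha> \<le> Suc a"
  using assms unfolding splits_orthant_def by blast+

text \<open>The set \<open>s\<close> in the proof has the largest cardinality among the \<open>v\<close> with \<open>orthant h v\<close> disjoint from
  \<open>M\<close>; splitting along a direction outside \<open>s\<close> keeps a cone of dimension \<open>card s\<close> at the vertex \<open>h\<close>,
  and no cone further out can have a larger dimension.\<close>

lemma monomial_split:
  fixes F :: "(nat \<Rightarrow>\<^sub>0 nat) set"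
  assumes "finite F" "u \<subseteq> {..<N}" "h \<in> exps N"
  defines "M \<equiv> {\<beta>. \<exists>f\<in>F. exp_dvd f \<beta>}"
  shows "\<exists>P. splits_orthant M u h P"
  using assms(2,3)
\<comment> \<open>Either a direction is dropped, or the vertex moves closer to a generator in
  \<open>F\<close> that exceeds it in the chosen direction.\<close>
proof (induction "card u + (\<Sum>f\<in>F. \<Sum>i\<in>u. lookup f i - lookup h i)" arbitrary: u h rule: less_induct)
  case less
  note u = less.prems(1) and h = less.prems(2)
  have finu: "finite u" using u finite_subset by blast
  have up: "\<beta> \<in> M" if "\<alpha> \<in> M" "exp_dvd \<alpha> \<beta>" for \<alpha> \<beta>
    using that exp_dvd_trans unfolding M_def by blast
  have empty_if: "orthant h v \<inter> M = {} \<Longrightarrow> h \<notin> M" for v using orthant_self by blast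
  consider "h \<in> M" | "h \<notin> M" "orthant h u \<inter> M = {}" | "h \<notin> M" "orthant h u \<inter> M \<noteq> {}" by blast
  then show ?case
  proof cases
    case 1
    then have "orthant h u \<subseteq> M" using up by (auto simp: orthant_def)
    then have none: "{\<beta> \<in> orthant h u - M. exp_size \<beta> = t} = {}" for t by blast
    have "\<alpha> = h" if "\<alpha> \<in> orthant h u" "\<forall>\<beta>\<in>M. exp_dvd \<beta> \<alpha> \<longrightarrow> \<beta> = \<alpha>" for \<alpha>
      using that 1 by (auto simp: orthant_def)
    \<comment> \<open>Nothing has to be covered, and \<open>h\<close> is the only minimal element of
      \<open>M\<close> that can occur; there is no cone to compare it with, hence its exemption in
      the last clause.\<close>
    then show ?thesis using 1 empty_if unfolding none splits_orthant_def
      by - (rule exI[of _ "{#}"], simp add: standard_def, blast)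
  next
    case 2
    have eq: "orthant h u - M = orthant h u" using 2 by blast
    have "standard (exp_size h) {#(exp_size h, card u)#}" by (auto simp: standard_def)
    moreover have "\<exists>m\<ge>card v. m = card u" if "v \<subseteq> u" for v using card_mono[OF finu that] by blast
    moreover have "\<forall>\<alpha>\<in>orthant h u \<inter> M. False" using 2 by blast
    ultimately show ?thesis using 2(2) unfolding splits_orthant_def eq card_orthant[OF h u]
      by - (rule exI[of _ "{#(exp_size h, card u)#}"], auto)
  next
    case 3
    define S where "S = {v. v \<subseteq> u \<and> orthant h v \<inter> M = {}}"
    have S: "finite S" "{} \<in> S" using finu 3 by (auto simp: S_def)
    obtain s where s: "s \<in> S" "\<And>v. v \<in> S \<Longrightarrow> card v \<le> card s"
    proof -
      have "Max (card ` S) \<in> card ` S" using S by (intro Max_in) auto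
      then obtain s where s: "s \<in> S" "Max (card ` S) = card s" by auto
      have "card v \<le> card s" if "v \<in> S" for v
        using Max_ge[of "card ` S" "card v"] S(1) that s(2) by simp
      with s(1) show ?thesis by (rule that)
    qed
    have su: "s \<subseteq> u" "orthant h s \<inter> M = {}" using s by (auto simp: S_def)
    then have "s \<noteq> u" using 3 by auto
    then obtain i where i: "i \<in> u" "i \<notin> s" using su by blast
    define e where "e = Poly_Mapping.single i (1::nat)"
    have lke: "lookup e j = (if i = j then 1 else 0)" for j
      by (simp add: e_def lookup_single when_def)
    have he: "h + e \<in> exps N" using h i u by (auto simp: e_def)
    have sz: "exp_size (h + e) = Suc (exp_size h)" by (simp add: e_def)
    obtain f where f: "f \<in> F" "lookup h i < lookup f i"
    proof -
      have "insert i s \<notin> S" using s(2)[of "insert i s"] i finite_subset[OF su(1) finu] by auto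
      then obtain \<delta> f where d: "\<delta> \<in> orthant h (insert i s)" "f \<in> F" "exp_dvd f \<delta>"
        using su i by (auto simp: S_def M_def)
      \<comment> \<open>By maximality of \<open>s\<close>, the cone in the directions
        \<open>insert i s\<close> meets \<open>M\<close> in some \<delta>. Resetting the coordinate
        \<open>i\<close> to that of \<open>h\<close> leads back into the cone over \<open>s\<close>,
        which avoids \<open>M\<close>; so the generator dividing \<delta> must exceed
        \<open>h\<close> at \<open>i\<close>.\<close>
      define \<delta>' where "\<delta>' = \<delta> - Poly_Mapping.single i (lookup \<delta> i - lookup h i)"
      have hi: "lookup h i \<le> lookup \<delta> i" using d(1) by (auto simp: orthant_def exp_dvd_def)
      have lk: "lookup \<delta>' j = (if j = i then lookup h i else lookup \<delta> j)" for j
        using hi by (auto simp: \<delta>'_def lookup_minus lookup_single when_def)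
      have "\<delta>' \<in> orthant h s" using d(1) i by (auto simp: orthant_def exp_dvd_def lk)
      then have "\<not> exp_dvd f \<delta>'" using su(2) d(2) by (auto simp: M_def)
      then have "lookup h i < lookup f i" using d(3)
        by (auto simp: exp_dvd_def lk split: if_splits)
      then show ?thesis using that d(2) by blast
    qed
    let ?m = "\<lambda>u h. card u + (\<Sum>f\<in>F. \<Sum>i\<in>u. lookup f i - lookup h i)"
    have m1: "?m (u - {i}) h < ?m u h"
    proof (rule add_less_le_mono)
      show "card (u - {i}) < card u" using i finu by (rule_tac card_Diff1_less) auto
      show "(\<Sum>f\<in>F. \<Sum>i\<in>u - {i}. lookup f i - lookup h i) \<le> (\<Sum>f\<in>F. \<Sum>i\<in>u. lookup f i - lookup h i)"
        using finu by (intro sum_mono sum_mono2) auto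
    qed
    have m2: "?m u (h + e) < ?m u h"
    proof -
      have "(\<Sum>f\<in>F. \<Sum>i\<in>u. lookup f i - lookup (h + e) i) < (\<Sum>f\<in>F. \<Sum>i\<in>u. lookup f i - lookup h i)"
      proof (rule sum_strict_mono_ex1[OF assms(1)])
        show "\<forall>f\<in>F. (\<Sum>i\<in>u. lookup f i - lookup (h + e) i) \<le> (\<Sum>i\<in>u. lookup f i - lookup h i)"
          by (auto intro!: sum_mono simp: lookup_add)
        have "(\<Sum>i\<in>u. lookup f i - lookup (h + e) i) < (\<Sum>i\<in>u. lookup f i - lookup h i)"
        proof (rule sum_strict_mono_ex1[OF finu])
          show "\<exists>j\<in>u. lookup f j - lookup (h + e) j < lookup f j - lookup h j"
            using i f by (intro bexI[of _ i]) (auto simp: lookup_add lke)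
        qed (auto simp: lookup_add)
        then show "\<exists>f\<in>F. (\<Sum>i\<in>u. lookup f i - lookup (h + e) i) < (\<Sum>i\<in>u. lookup f i - lookup h i)"
          using f by blast
      qed
      then show ?thesis by simp
    qed
    obtain P where P: "splits_orthant M (u - {i}) h P"
      using less.hyps[OF m1 _ h] u by blast
    obtain Q where Q: "splits_orthant M u (h + e) Q"
      using less.hyps[OF m2 u he] by blast
    note PD = splits_orthantD[OF P] and QD = splits_orthantD[OF Q, unfolded sz]
    \<comment> \<open>\<open>M\<close> is closed under multiples, so an element of \<open>M\<close>
      in the cone at \<open>h\<close> would be shifted by \<open>e\<close> to one in the cone at
      \<open>h + e\<close>.\<close>
    have free: "orthant h v \<inter> M = {}" if "orthant (h + e) v \<inter> M = {}" for v
    proof -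
      have "\<beta> + e \<in> orthant (h + e) v" if "\<beta> \<in> orthant h v" for \<beta>
        using that by (auto simp: orthant_def exp_dvd_def lookup_add)
      then show ?thesis using that up exp_dvd_add by blast
    qed
    have max: "\<exists>m\<ge>card v. (exp_size h, m) \<in># P" if "v \<subseteq> u" "orthant h v \<inter> M = {}" for v
    proof -
      have "card v \<le> card s" using s(2) that by (auto simp: S_def)
      moreover obtain m where "m \<ge> card s" "(exp_size h, m) \<in># P"
        using PD(4)[of s] su i by blast
      ultimately show ?thesis by (intro exI[of _ m]) auto
    qed
    have "hilb (P + Q) t = card {\<beta> \<in> orthant h u - M. exp_size \<beta> = t}" for t
      using card_orthant_step[OF i(1) h u, of M t] by (simp add: PD(1) QD(1) e_def)
    moreover have "exp_size h \<le> a \<and> (\<exists>v\<subseteq>u. card v = m \<and> orthant h v \<inter> M = {})"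
      if "(a, m) \<in># P + Q" for a m
    proof (cases "(a, m) \<in># P")
      case True
      then show ?thesis using PD(2,3)[OF True] by blast
    next
      case False
      then have aQ: "(a, m) \<in># Q" using that by simp
      obtain v where "v \<subseteq> u" "card v = m" "orthant (h + e) v \<inter> M = {}" using QD(3)[OF aQ] by blast
      then show ?thesis using free[of v] QD(2)[OF aQ] by auto
    qed
    moreover have "standard (exp_size h) (P + Q)"
    proof (rule standardI)
      fix a m assume am: "(a, m) \<in># P + Q" "0 < m"
      then show "exp_size h \<le> a" using QD(2) PD(2) by (metis Suc_leD union_iff)
    next
      fix a m b assume am: "(a, m) \<in># P + Q" "0 < m" "exp_size h \<le> b" "b \<le> a"
      show "\<exists>m'\<ge>m. (b, m') \<in># P + Q"
      proof (cases "(a, m) \<in># P")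
        case True
        then show ?thesis using standardD(2)[OF PD(5) True am(2-4)] by auto
      next
        case False
        then have aQ: "(a, m) \<in># Q" using am(1) by simp
        show ?thesis
        \<comment> \<open>\<open>Q\<close> is standard only from one degree higher; in the degree of
          \<open>h\<close> itself the witness is the largest cone at \<open>h\<close>.\<close>
        proof (cases "b = exp_size h")
          case True
          obtain v where v: "v \<subseteq> u" "card v = m" "orthant (h + e) v \<inter> M = {}" using QD(3)[OF aQ] by blast
          then show ?thesis using max[OF v(1) free[OF v(3)]] True by auto
        next
          case False
          then show ?thesis using standardD(2)[OF QD(5) aQ am(2), of b] am(3,4) by auto
        qed
      qed
    qed
    moreover have "\<exists>a m. (a, m) \<in># P + Q \<and> exp_size \<alpha> \<le> Suc a"
      if a: "\<alpha> \<in> orthant h u \<inter> M" "\<forall>\<beta>\<in>M. exp_dvd \<beta> \<alpha> \<longrightarrow> \<beta> = \<alpha>" "\<alpha> \<noteq> h" for \<alpha>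
    proof (cases "\<alpha> \<in> orthant h (u - {i})")
      case True
      then show ?thesis using PD(6)[of \<alpha>] a by auto
    next
      case False
      then have a': "\<alpha> \<in> orthant (h + e) u" using a orthant_step(1)[OF i(1), of h] by (auto simp: e_def)
      show ?thesis
      proof (cases "\<alpha> = h + e")
        case True
        \<comment> \<open>The empty set of directions already yields a cone at \<open>h\<close>,
          whose degree is one less than that of the minimal element.\<close>
        obtain m where "(exp_size h, m) \<in># P" using max[of "{}"] 3 by auto
        then show ?thesis using sz True
          by - (rule exI[of _ "exp_size h"], rule exI[of _ m], simp)
      next
        case False
        then show ?thesis using QD(6)[of \<alpha>] a a' by auto
      qed
    qed
    moreover have "\<exists>m\<ge>card v. (exp_size h, m) \<in># P + Q" if "v \<subseteq> u" "orthant h v \<inter> M = {}" for v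
      using max[OF that] by auto
    ultimately have "splits_orthant M u h (P + Q)" unfolding splits_orthant_def by blast
    then show ?thesis ..
  qed
qed

lemma complement_decomposition:
  assumes M: "M \<subseteq> exps N" "\<And>\<alpha> \<beta>. \<alpha> \<in> M \<Longrightarrow> \<beta> \<in> exps N \<Longrightarrow> exp_dvd \<alpha> \<beta> \<Longrightarrow> \<beta> \<in> M"
  shows "\<exists>P. (\<forall>t. hilb P t = card {\<beta> \<in> exps N - M. exp_size \<beta> = t}) \<and> standard 0 P \<and> dim_le N P \<and>
    (\<forall>\<alpha>\<in>M. (\<forall>\<beta>\<in>M. exp_dvd \<beta> \<alpha> \<longrightarrow> \<beta> = \<alpha>) \<longrightarrow> \<alpha> \<noteq> 0 \<longrightarrow>
       (\<exists>a m. (a, m) \<in># P \<and> exp_size \<alpha> \<le> Suc a))"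
proof -
  obtain F where F: "F \<subseteq> M" "finite F" "\<forall>\<alpha>\<in>M. \<exists>f\<in>F. \<forall>i<N. lookup f i \<le> lookup \<alpha> i"
    using dickson[of M N lookup] by blast
  \<comment> \<open>\<open>M'\<close> also contains exponents that use variables beyond
    \<open>N\<close>; it agrees with \<open>M\<close> on \<open>exps N\<close> only.\<close>
  define M' where "M' = {\<beta>. \<exists>f\<in>F. exp_dvd f \<beta>}"
  have dvdI: "exp_dvd f \<alpha>" if "f \<in> F" "\<forall>i<N. lookup f i \<le> lookup \<alpha> i" for f \<alpha>
    using that F(1) M(1) unfolding exp_dvd_def by (metis exps_iff in_mono le0 not_less)
  have sub: "M \<subseteq> M'"
  proof
    fix \<alpha> assume "\<alpha> \<in> M"
    then obtain f where "f \<in> F" "\<forall>i<N. lookup f i \<le> lookup \<alpha> i" using F(3) by blast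
    then show "\<alpha> \<in> M'" using dvdI by (auto simp: M'_def)
  qed
  have sup: "\<beta> \<in> M" if "\<beta> \<in> exps N" "\<beta> \<in> M'" for \<beta>
    using that M(2) F(1) by (auto simp: M'_def)
  have eq: "exps N - M' = exps N - M" using sub sup by blast
  have minimal: "\<forall>\<beta>\<in>M'. exp_dvd \<beta> \<alpha> \<longrightarrow> \<beta> = \<alpha>"
    if "\<alpha> \<in> M" "\<forall>\<beta>\<in>M. exp_dvd \<beta> \<alpha> \<longrightarrow> \<beta> = \<alpha>" for \<alpha>
  proof clarify
    fix \<beta> assume b: "\<beta> \<in> M'" "exp_dvd \<beta> \<alpha>"
    then have "\<beta> \<in> exps N" using that(1) M(1) by (auto simp: exp_dvd_iff)
    then show "\<beta> = \<alpha>" using that b sup by blast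
  qed
  obtain P where "splits_orthant M' {..<N} 0 P"
    using monomial_split[of F "{..<N}" N 0] F(2) unfolding M'_def by auto
  note PD = splits_orthantD[OF this, unfolded orthant_all exp_size_zero eq]
  have "m \<le> N" if am: "(a, m) \<in># P" for a m
  proof -
    obtain v where "v \<subseteq> {..<N}" "card v = m" using PD(3) am by blast
    then show ?thesis using card_mono[of "{..<N}" v] by simp
  qed
  then have dim: "dim_le N P" by (auto simp: dim_le_def)
  have min: "\<exists>a m. (a, m) \<in># P \<and> exp_size \<alpha> \<le> Suc a"
    if "\<alpha> \<in> M" "\<forall>\<beta>\<in>M. exp_dvd \<beta> \<alpha> \<longrightarrow> \<beta> = \<alpha>" "\<alpha> \<noteq> 0" for \<alpha>
  proof -
    have "\<alpha> \<in> exps N" "\<alpha> \<in> M'" using that(1) sub M(1) by auto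
    from PD(6)[OF this minimal[OF that(1,2)] that(3)] show ?thesis .
  qed
  show ?thesis
    by (rule exI[of _ P]) (use PD(1,5) dim min in simp)
qed

section \<open>Macaulay constants\<close>

text \<open>The Hilbert polynomial of a cone of dimension \<open>k + 1\<close> with vertex in degree
  \<open>s\<close>. A real argument permits evaluation at 0, below the vertex, where the count of
  the cone itself is no longer given by the polynomial.\<close>

definition cone_poly :: "nat \<Rightarrow> nat \<Rightarrow> real \<Rightarrow> real" where
  "cone_poly k s x = (x - real s + real k) gchoose k"

lemma cone_poly_0 [simp]: "cone_poly 0 s x = 1"
  by (simp add: cone_poly_def)

lemma cone_poly_diff: "cone_poly (Suc k) s x - cone_poly (Suc k) s (x - 1) = cone_poly k s x"
proof -
  have "(x - real s + real k + 1) gchoose Suc k =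
      ((x - real s + real k) gchoose k) + ((x - real s + real k) gchoose Suc k)"
    by (rule gbinomial_Suc_Suc)
  moreover have e: "x - real s + real (Suc k) = x - real s + real k + 1"
    "x - 1 - real s + real (Suc k) = x - real s + real k" by simp_all
  ultimately show ?thesis unfolding cone_poly_def e by linarith
qed

lemma cone_poly_is_poly: "\<exists>p. cone_poly k s = poly p"
proof (intro exI ext)
  fix x :: real
  have "(\<Prod>i=0..<k. x - real s + real k - real i) = (\<Prod>i=0..<k. poly [:real k - real s - real i, 1:] x)"
    by (intro prod.cong) simp_all
  then show "cone_poly k s x = poly (smult (1 / fact k) (\<Prod>i=0..<k. [:real k - real s - real i, 1:])) x"
    unfolding cone_poly_def gbinomial_prod_rev poly_smult poly_prod by (simp only: mult_1_left times_divide_eq_left)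
qed

lemma cone_count_eq_poly:
  assumes "i > 0" "s \<le> t"
  shows "real (cone_count s i t) = cone_poly (i - 1) s (real t)"
proof -
  obtain k where k: "i = Suc k" using assms(1) by (cases i) auto
  have e: "real t - real s + real k = real (t - s + k)" using assms(2) by (simp add: of_nat_diff)
  show ?thesis
    unfolding k cone_count_Suc_dim[OF assms(2)] cone_poly_def diff_Suc_1 e by (rule binomial_gbinomial)
qed

lemma exact_count_eq_poly:
  assumes "\<And>i. i \<in> {1..n} \<Longrightarrow> c i \<le> t"
  shows "real (exact_count n c t) = (\<Sum>i=1..n. \<Sum>s=c (Suc i)..<c i. cone_poly (i - 1) s (real t))"
  unfolding exact_count_def of_nat_sum
proof (intro sum.cong refl cone_count_eq_poly)
  fix i s assume "i \<in> {1..n}" "s \<in> {c (Suc i)..<c i}"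
  then show "0 < i" "s \<le> t" using assms[of i] by simp_all
qed

text \<open>Upper negation of binomial coefficients. It is the source of the alternating signs in
  the recursion.\<close>

lemma cone_poly_at_0:
  assumes "s > 0"
  shows "cone_poly k s 0 = (-1) ^ k * real ((s - 1) choose k)"
proof -
  have e: "real k - (0 - real s + real k) - 1 = real (s - 1)" using assms by (simp add: of_nat_diff)
  show ?thesis
    using gbinomial_negated_upper[of "0 - real s + real k" k]
    unfolding cone_poly_def e binomial_gbinomial .
qed

lemma sum_choose_interval:
  assumes "0 < l" "l \<le> u"
  shows "(\<Sum>s=l..<u. real ((s - 1) choose k)) = real ((u - 1) choose Suc k) - real ((l - 1) choose Suc k)"
  using assms(2)
proof (induction u rule: dec_induct)
  case (step v)
  then obtain w where "v = Suc w" using assms(1) by (cases v) auto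
  then show ?case using step by simp
qed simp

text \<open>\<open>a\<close> belongs to the ideal without its full cone of degree \<open>d\<close>,
  \<open>b\<close> to the complement of the leading exponents. From degree \<open>B\<close> on no
  zero-dimensional cones are left, so the exact counts alone satisfy the identity.\<close>

locale macaulay_constants =
  fixes a b :: "nat \<Rightarrow> nat" and n d B :: nat
  assumes d: "d > 0"
    and a: "a (Suc n) = d" "\<And>i. i \<in> {1..n} \<Longrightarrow> a (Suc i) \<le> a i"
    and b: "b (Suc n) = d" "\<And>i. i \<in> {1..n} \<Longrightarrow> b (Suc i) \<le> b i"
    and count: "\<And>t. t \<ge> B \<Longrightarrow>
      cone_count 0 n t = cone_count d n t + exact_count n a t + exact_count n b t"
begin

lemma ge_d:
  assumes "i \<in> {1..Suc n}"
  shows "d \<le> a i \<and> d \<le> b i"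
proof -
  have "i \<le> Suc n" using assms by simp
  then show ?thesis
  proof (induction rule: inc_induct)
    case base
    then show ?case using a(1) b(1) by simp
  next
    case (step k)
    then have "k \<in> {1..n}" using assms by auto
    from a(2)[OF this] b(2)[OF this] step.IH show ?case by linarith
  qed
qed

text \<open>Each backward difference in \<open>x\<close> removes the cones of the lowest remaining dimension.\<close>

lemma poly_identity:
  assumes "j \<in> {1..n}"
  shows "cone_poly (n - j) 0 x = cone_poly (n - j) d x
    + (\<Sum>i=j..n. \<Sum>s=a (Suc i)..<a i. cone_poly (i - j) s x)
    + (\<Sum>i=j..n. \<Sum>s=b (Suc i)..<b i. cone_poly (i - j) s x)"
  using assms
proof (induction j arbitrary: x)
  case (Suc j)
  show ?case
  proof (cases "j = 0")
    case True
    obtain p where p: "\<And>k s. cone_poly k s = poly (p k s)"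
      using cone_poly_is_poly by metis
    define q where "q = p (n - 1) d + (\<Sum>i=1..n. \<Sum>s=a (Suc i)..<a i. p (i - 1) s)
      + (\<Sum>i=1..n. \<Sum>s=b (Suc i)..<b i. p (i - 1) s)"
    define T where "T = B + d + (\<Sum>i\<le>n. a i + b i)"
    have T: "a i \<le> T" "b i \<le> T" if "i \<le> n" for i
      using member_le_sum[of i "{..n}" "\<lambda>i. a i + b i"] that by (auto simp: T_def)
    \<comment> \<open>Beyond all endpoints every count is polynomial in \<open>t\<close>. Agreement
      at infinitely many integers makes this an identity of polynomials.\<close>
    have "poly (p (n - 1) 0) (real t) = poly q (real t)" if t: "t \<ge> T" for t
    proof -
      have "real (cone_count 0 n t) = real (cone_count d n t) + real (exact_count n a t) + real (exact_count n b t)"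
        using count[of t] t by (simp add: T_def)
      moreover have "n > 0" "d \<le> t" using Suc.prems t by (auto simp: T_def)
      moreover have "a i \<le> t" "b i \<le> t" if "i \<in> {1..n}" for i
        using T[of i] t that by auto
      ultimately show ?thesis
        using exact_count_eq_poly[of n a t] exact_count_eq_poly[of n b t]
        by (simp add: cone_count_eq_poly p q_def poly_sum)
    qed
    then have "real ` {T..} \<subseteq> {x. poly (p (n - 1) 0 - q) x = 0}" by auto
    moreover have "infinite (real ` {T..})"
      by (simp add: finite_image_iff inj_on_def infinite_Ici)
    ultimately have "p (n - 1) 0 - q = 0" using poly_roots_finite finite_subset by blast
    then have "p (n - 1) 0 = q" by simp
    then have "cone_poly (n - 1) 0 x = poly q x" by (simp add: p)
    then show ?thesis using True by (simp add: q_def poly_sum p)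
  next
    case False
    then have j: "j \<in> {1..n}" "j < n" using Suc.prems by auto
    note IH = Suc.IH[OF j(1)]
    have diff: "(\<Sum>i=j..n. \<Sum>s=c (Suc i)..<c i. cone_poly (i - j) s x)
        - (\<Sum>i=j..n. \<Sum>s=c (Suc i)..<c i. cone_poly (i - j) s (x - 1))
        = (\<Sum>i=Suc j..n. \<Sum>s=c (Suc i)..<c i. cone_poly (i - Suc j) s x)" for c :: "nat \<Rightarrow> nat"
    proof -
      \<comment> \<open>For i = j the summands are constant in \<open>x\<close>, so their difference
        vanishes and the sum starts at \<open>Suc j\<close>.\<close>
      have "{j..n} = insert j {Suc j..n}" using j by auto
      then have "(\<Sum>i=j..n. \<Sum>s=c (Suc i)..<c i. cone_poly (i - j) s x)
        - (\<Sum>i=j..n. \<Sum>s=c (Suc i)..<c i. cone_poly (i - j) s (x - 1))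
        = (\<Sum>i=Suc j..n. \<Sum>s=c (Suc i)..<c i. cone_poly (i - j) s x - cone_poly (i - j) s (x - 1))"
        by (simp add: sum_subtractf)
      also have "\<dots> = (\<Sum>i=Suc j..n. \<Sum>s=c (Suc i)..<c i. cone_poly (i - Suc j) s x)"
      proof (intro sum.cong refl)
        fix i s assume "i \<in> {Suc j..n}"
        then have "i - j = Suc (i - Suc j)" by auto
        then show "cone_poly (i - j) s x - cone_poly (i - j) s (x - 1) = cone_poly (i - Suc j) s x"
          using cone_poly_diff by simp
      qed
      finally show ?thesis .
    qed
    have "n - j = Suc (n - Suc j)" using j by auto
    then have "cone_poly (n - j) s x - cone_poly (n - j) s (x - 1) = cone_poly (n - Suc j) s x" for s
      using cone_poly_diff by simp
    from this[of 0] this[of d] diff[of a] diff[of b] IH[of x] IH[of "x - 1"]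
    show ?thesis by linarith
  qed
qed simp

definition jump :: "(nat \<Rightarrow> nat) \<Rightarrow> nat \<Rightarrow> nat \<Rightarrow> real" where
  "jump c i k = real ((c i - 1) choose k) - real ((c (Suc i) - 1) choose k)"

text \<open>The value of \<open>poly_identity\<close> at 0. The left side there equals 1, and each
  inner sum over an interval of degrees telescopes to a \<open>jump\<close>.\<close>

lemma recursion:
  assumes j: "j \<in> {1..n}"
  shows "(-1) ^ (n - j) * real ((d - 1) choose (n - j))
    + (\<Sum>i=j..n. (-1) ^ (i - j) * (jump a i (Suc (i - j)) + jump b i (Suc (i - j)))) = 1"
proof -
  have inner: "(\<Sum>s=c (Suc i)..<c i. cone_poly k s 0) = (-1) ^ k * jump c i (Suc k)"
    if "0 < c (Suc i)" "c (Suc i) \<le> c i" for c i k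
  proof -
    have "(\<Sum>s=c (Suc i)..<c i. cone_poly k s 0) = (\<Sum>s=c (Suc i)..<c i. (-1) ^ k * real ((s - 1) choose k))"
      using that(1) by (intro sum.cong refl cone_poly_at_0) auto
    then show ?thesis using sum_choose_interval[OF that] by (simp add: jump_def flip: sum_distrib_left)
  qed
  have pos: "0 < a (Suc i)" "0 < b (Suc i)" if "i \<in> {j..n}" for i
    using ge_d[of "Suc i"] that d by auto
  have "cone_poly (n - j) 0 0 = 1"
    by (simp add: cone_poly_def flip: binomial_gbinomial)
  moreover have "(\<Sum>i=j..n. \<Sum>s=a (Suc i)..<a i. cone_poly (i - j) s 0) =
      (\<Sum>i=j..n. (-1) ^ (i - j) * jump a i (Suc (i - j)))"
    by (intro sum.cong refl inner pos a(2)) (use j in auto)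
  moreover have "(\<Sum>i=j..n. \<Sum>s=b (Suc i)..<b i. cone_poly (i - j) s 0) =
      (\<Sum>i=j..n. (-1) ^ (i - j) * jump b i (Suc (i - j)))"
    by (intro sum.cong refl inner pos b(2)) (use j in auto)
  moreover have "(\<Sum>i=j..n. (-1) ^ (i - j) * (jump a i (Suc (i - j)) + jump b i (Suc (i - j)))) =
      (\<Sum>i=j..n. (-1) ^ (i - j) * jump a i (Suc (i - j))) + (\<Sum>i=j..n. (-1) ^ (i - j) * jump b i (Suc (i - j)))"
    by (simp only: distrib_left sum.distrib)
  ultimately show ?thesis
    using poly_identity[OF j, of 0] cone_poly_at_0[OF d, of "n - j"] by linarith
qed

text \<open>The top coefficient of the Hilbert polynomial is already accounted for by the full cone
  of degree \<open>d\<close>. Two nonnegative lengths thus add up to zero.\<close>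

lemma at_n:
  assumes "n \<ge> 1"
  shows "a n = d" "b n = d"
proof -
  have "jump a n 1 + jump b n 1 = 0" using recursion[of n] assms by simp
  moreover have "a n \<ge> d" "b n \<ge> d" using ge_d[of n] assms by auto
  ultimately show "a n = d" "b n = d" using d a(1) b(1) by (auto simp: jump_def)
qed

text \<open>For i = j the jump has order one and contains \<open>a j + b j\<close> linearly; the
  others are moved to the right. With k = i-j+1, a jump of odd order enters with a negative sign and
  is dropped, while one of even order is bounded by its positive part. The term i = n vanishes by
  \<open>at_n\<close>.\<close>

lemma step_bound:
  assumes j: "1 \<le> j" "j < n"
  shows "real (a j + b j) \<le> real (a (Suc j) + b (Suc j)) + 1
    - (-1) ^ (n - j) * real ((d - 1) choose (n - j))
    + (\<Sum>k=2..n - j. if even k then real ((a (j + k - 1) - 1) choose k) + real ((b (j + k - 1) - 1) choose k) else 0)"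
proof -
  define g where "g i = (-1) ^ (i - j) * (jump a i (Suc (i - j)) + jump b i (Suc (i - j)))" for i
  define h where "h k = (if even k
      then real ((a (j + k - 1) - 1) choose k) + real ((b (j + k - 1) - 1) choose k) else 0)" for k
  have jump_nonneg: "0 \<le> jump a i k" "0 \<le> jump b i k" if "i \<in> {1..n}" for i k
    using a(2)[OF that] b(2)[OF that] by (auto simp: jump_def intro!: binomial_right_mono diff_le_mono)
  have gn: "g n = 0" using at_n j a(1) b(1) by (simp add: g_def jump_def)
  have gj: "g j = real (a j + b j) - real (a (Suc j) + b (Suc j))"
    using ge_d[of j] ge_d[of "Suc j"] j d by (simp add: g_def jump_def of_nat_diff)
  have le: "- g (j + k - 1) \<le> h k" if k: "k \<in> {2..n - j}" for k
  proof -
    let ?i = "j + k - 1"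
    have i: "?i \<in> {1..n}" "?i - j = k - 1" "Suc (?i - j) = k" using k j by auto
    have lo: "0 \<le> jump a ?i k + jump b ?i k" using jump_nonneg[OF i(1)] by (simp add: add_nonneg_nonneg)
    have g: "g ?i = (-1) ^ (k - 1) * (jump a ?i k + jump b ?i k)"
      unfolding g_def i(3) using i(2) by simp
    show ?thesis
    proof (cases "even k")
      case True
      then have "odd (k - 1)" using k by auto
      then show ?thesis using g True by (simp add: jump_def h_def)
    next
      case False
      then have "even (k - 1)" by simp
      then show ?thesis using g lo False by (simp add: h_def)
    qed
  qed
  have "{j..n} = insert j (insert n {Suc j..n - 1})" using j by auto
  then have "(\<Sum>i=j..n. g i) = g j + g n + (\<Sum>i=Suc j..n - 1. g i)" using j by simp
  moreover have "(\<Sum>i=Suc j..n - 1. g i) = (\<Sum>k=2..n - j. g (j + k - 1))"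
    by (rule sum.reindex_bij_witness[of _ "\<lambda>k. j + k - 1" "\<lambda>i. Suc i - j"]) (use j in auto)
  moreover have "- (\<Sum>k=2..n - j. g (j + k - 1)) \<le> (\<Sum>k=2..n - j. h k)"
    unfolding sum_negf[symmetric] by (rule sum_mono) (rule le)
  moreover have "(-1) ^ (n - j) * real ((d - 1) choose (n - j)) + (\<Sum>i=j..n. g i) = 1"
    unfolding g_def using recursion[of j] j by simp
  ultimately have "real (a j + b j) \<le> real (a (Suc j) + b (Suc j)) + 1
    - (-1) ^ (n - j) * real ((d - 1) choose (n - j)) + (\<Sum>k=2..n - j. h k)"
    using gn gj by linarith
  then show ?thesis unfolding h_def .
qed

end

section \<open>Estimates that solve the recursion\<close>

lemma sum_two_pow_div_fact_bound:
  assumes "m \<ge> 4"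
  shows "(\<Sum>k=4..m. 2 ^ k / fact k) \<le> (4 / 3 :: real)"
proof -
  define c :: "nat \<Rightarrow> real" where "c k = 2 ^ k / fact k" for k
  \<comment> \<open>The extra last term makes the induction work, because the summands at least
    halve from one to the next; at m = 4 equality holds.\<close>
  have "(\<Sum>k=4..m. c k) + c m \<le> 4 / 3"
    using assms
  proof (induction m rule: dec_induct)
    case base
    then show ?case by (simp add: c_def fact_numeral)
  next
    case (step m)
    have "c (Suc m) = c m * (2 / (1 + real m))"
      by (simp add: c_def field_simps)
    also have "\<dots> \<le> c m * (1 / 2)"
      using step(1) by (intro mult_left_mono) (auto simp: c_def field_simps)
    finally show ?case using step.IH step(1) by simp
  qed
  moreover have "0 \<le> c m" by (simp add: c_def)
  ultimately show ?thesis unfolding c_def by linarith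
qed

lemma add_powers_le_power_add:
  fixes p q :: real
  assumes "0 \<le> p" "0 \<le> q"
  shows "p ^ Suc k + q ^ Suc k \<le> (p + q) ^ Suc k"
proof (induction k)
  case (Suc k)
  have "p * p ^ Suc k + q * q ^ Suc k \<le> (p + q) * (p ^ Suc k + q ^ Suc k)"
    using assms by (simp add: algebra_simps add_nonneg_nonneg)
  also have "\<dots> \<le> (p + q) * (p + q) ^ Suc k" using Suc assms by (intro mult_left_mono) auto
  finally show ?case by simp
qed simp

lemma binomial_le_pow_div_fact: "real (p choose k) \<le> real p ^ k / fact k"
proof -
  have "real (p choose k) * fact k \<le> real p ^ k"
    using binomial_fact_pow[of p k] by (metis of_nat_fact of_nat_le_iff of_nat_mult of_nat_power)
  then show ?thesis by (simp add: field_simps)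
qed

text \<open>For a fixed sum the two binomials are at most the one of the combined argument, and the
  resulting quadratic in the sum is largest at 2X. The slack 3X-3 below 2X^2 pays for all other
  terms of the recursion.\<close>

lemma choose_two_sum_bound:
  fixes p q :: nat and X :: real
  assumes "p > 0" "q > 0" "real (p + q) \<le> 2 * X" "X \<ge> 3 / 2"
  shows "real (p + q) + real ((p - 1) choose 2) + real ((q - 1) choose 2) \<le> 2 * X\<^sup>2 - 3 * X + 3"
proof -
  obtain p' q' where pq: "p = Suc p'" "q = Suc q'" using assms by (metis gr0_implies_Suc)
  have two: "real (k choose 2) = real k * (real k - 1) / 2" for k
    by (simp add: binomial_gbinomial gbinomial_prod_rev numeral_2_eq_2)
  define S where "S = real (p + q)"
  have S: "S = real p' + real q' + 2" by (simp add: S_def pq)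
  have "S + real (p' choose 2) + real (q' choose 2) \<le> S + (S - 2) * (S - 3) / 2"
    unfolding two by (simp add: S field_simps)
  also have "\<dots> \<le> 2 * X\<^sup>2 - 3 * X + 3"
  proof -
    have "0 \<le> (2 * X - S) * (2 * X + S - 3)"
      using assms S by (intro mult_nonneg_nonneg) (simp_all add: pq)
    then show ?thesis by (simp add: field_simps power2_eq_square)
  qed
  finally show ?thesis by (simp add: S_def pq)
qed

context macaulay_constants
begin

definition E :: real where "E = (real d)\<^sup>2 / 2 + real d"

text \<open>The bound 3/2 is attained for d = 1, and it is just what the case m = 3 of the induction
  below requires.\<close>

lemma E_bounds: "3 / 2 \<le> E" "real d \<le> E" "(real d)\<^sup>2 / 2 \<le> E"
proof -
  have "1 \<le> real d" using d by simp
  moreover from this have "1 \<le> (real d)\<^sup>2" by simp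
  ultimately show "3 / 2 \<le> E" "real d \<le> E" "(real d)\<^sup>2 / 2 \<le> E"
    unfolding E_def by linarith+
qed

lemma choose_bound:
  assumes "m \<ge> 3"
  shows "real ((d - 1) choose m) \<le> E ^ (2 ^ (m - 2)) / 3"
proof -
  obtain k where k: "m = k + 3" using assms by (metis add.commute le_Suc_ex)
  have "real ((d - 1) choose m) \<le> real (d - 1) ^ m / fact m" by (rule binomial_le_pow_div_fact)
  also have "\<dots> \<le> real d ^ m / 6"
  proof (rule frac_le)
    have "fact 3 \<le> (fact m :: real)" using assms by (intro fact_mono) auto
    then show "6 \<le> (fact m :: real)" by (simp add: fact_numeral)
    show "real (d - 1) ^ m \<le> real d ^ m" by (intro power_mono) auto
  qed auto
  \<comment> \<open>One factor d^2/2 is separated so that it is absorbed by a single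
    \<open>E\<close>; the other factors \<open>d\<close> cost one \<open>E\<close> each.\<close>
  also have "\<dots> = real d ^ (k + 1) * ((real d)\<^sup>2 / 2) / 3"
    by (simp add: k power_add power2_eq_square power3_eq_cube)
  also have "\<dots> \<le> E ^ (k + 1) * E / 3"
    using E_bounds by (intro divide_right_mono mult_mono power_mono) auto
  also have "\<dots> = E ^ (k + 2) / 3" by simp
  also have "\<dots> \<le> E ^ (2 ^ (m - 2)) / 3"
  proof (intro divide_right_mono power_increasing)
    have "k + 2 \<le> 2 ^ (k + 1)" by (induction k) auto
    then show "k + 2 \<le> 2 ^ (m - 2)" by (simp add: k)
  qed (use E_bounds in auto)
  finally show ?thesis .
qed

text \<open>Going down one dimension squares the bound through the term k = 2. Odd orders are
  absent, and for k >= 4 the k-th power of an earlier bound is only of order \<open>X\<close>, the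
  square root of the target up to a constant factor.\<close>

lemma sum_constants_bound:
  "1 \<le> m \<Longrightarrow> m < n \<Longrightarrow> real (a (n - m) + b (n - m)) \<le> 2 * E ^ (2 ^ (m - 1))"
proof (induction m rule: less_induct)
  case (less m)
  define j where "j = n - m"
  have j: "1 \<le> j" "j < n" "n - j = m" using less.prems by (auto simp: j_def)
  note step = step_bound[OF j(1,2), unfolded j(3)]
  show ?case
  proof (cases "m = 1")
    case True
    then have "Suc j = n" using j by auto
    then have "real (a j + b j) \<le> 2 * real d + 1 + real (d - 1)" using step True at_n by simp
    also have "\<dots> = 3 * real d" using d by (simp add: of_nat_diff)
    also have "\<dots> \<le> 2 * E"
    proof -
      have "real d * 1 \<le> real d * real d" using d by (intro mult_left_mono) auto
      then show ?thesis by (simp add: E_def power2_eq_square)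
    qed
    finally show ?thesis using True by (simp add: j_def)
  next
    case False
    then have m: "m \<ge> 2" using less.prems by auto
    \<comment> \<open>The bound for the preceding index is 2X, and 2X^2 is the target.\<close>
    define X where "X = E ^ (2 ^ (m - 2))"
    define h where "h k = (if even k
      then real ((a (j + k - 1) - 1) choose k) + real ((b (j + k - 1) - 1) choose k) else 0)" for k
    have X1: "E \<le> X" unfolding X_def using E_bounds self_le_power[of E "2 ^ (m - 2)"] by simp
    have IH: "real (a (j + k - 1) + b (j + k - 1)) \<le> 2 * E ^ (2 ^ (m - k))" if "2 \<le> k" "k \<le> m" for k
    proof -
      have "n - (m - k + 1) = j + k - 1" using that j less.prems by (auto simp: j_def)
      then show ?thesis using less.IH[of "m - k + 1"] that less.prems by auto
    qed
    have X2: "2 * E ^ (2 ^ (m - 1)) = 2 * X\<^sup>2"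
    proof -
      have "m - 1 = Suc (m - 2)" using m by simp
      then have "(2::nat) ^ (m - 1) = 2 ^ (m - 2) * 2" by simp
      then show ?thesis by (simp add: X_def power_mult)
    qed
    have hk: "h k \<le> (2 ^ k / fact k) * X" if k: "4 \<le> k" "k \<le> m" for k
    proof -
      define p q where "p = a (j + k - 1)" and "q = b (j + k - 1)"
      have "h k \<le> real ((p - 1) choose k) + real ((q - 1) choose k)"
        by (simp add: h_def p_def q_def)
      also have "\<dots> \<le> real p ^ k / fact k + real q ^ k / fact k"
        by (intro add_mono order_trans[OF binomial_le_pow_div_fact] divide_right_mono power_mono) auto
      also have "\<dots> = (real p ^ k + real q ^ k) / fact k" by (simp add: add_divide_distrib)
      also have "\<dots> \<le> (real p + real q) ^ k / fact k"
        using add_powers_le_power_add[of "real p" "real q" "k - 1"] k by (intro divide_right_mono) auto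
      also have "\<dots> \<le> (2 * E ^ (2 ^ (m - k))) ^ k / fact k"
        using IH[of k] k by (intro divide_right_mono power_mono) (auto simp: p_def q_def)
      also have "\<dots> = (2 ^ k / fact k) * E ^ (2 ^ (m - k) * k)"
        by (simp add: power_mult_distrib power_mult)
      also have "\<dots> \<le> (2 ^ k / fact k) * X"
        unfolding X_def
      proof (intro mult_left_mono power_increasing)
        obtain l where l: "k = l + 4" using k by (metis add.commute le_Suc_ex)
        \<comment> \<open>This is k <= 2^(k-2), which holds from k = 4 on and keeps these powers at
          order \<open>X\<close>.\<close>
        have "l + 4 \<le> 2 ^ (l + 2)" by (induction l) auto
        then have "2 ^ (m - k) * k \<le> 2 ^ (m - k) * 2 ^ (k - 2)" by (simp add: l)
        also have "\<dots> = (2::nat) ^ (m - 2)" using k by (simp flip: power_add)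
        finally show "2 ^ (m - k) * k \<le> 2 ^ (m - 2)" .
      qed (use E_bounds in auto)
      finally show ?thesis .
    qed
    have step': "real (a j + b j) \<le> real (a (Suc j) + b (Suc j)) + 1
        - (-1) ^ m * real ((d - 1) choose m) + (\<Sum>k=2..m. h k)"
      using step by (simp add: h_def)
    have two: "real (a (Suc j) + b (Suc j)) + h 2 \<le> 2 * X\<^sup>2 - 3 * X + 3"
      using choose_two_sum_bound[of "a (Suc j)" "b (Suc j)" X] IH[of 2] m ge_d[of "Suc j"] j d X1 E_bounds(1)
      by (simp add: h_def X_def)
    have "real (a j + b j) \<le> 2 * X\<^sup>2"
    proof -
      consider "m = 2" | "m = 3" | "m \<ge> 4" using m by linarith
      then show ?thesis
      proof cases
        case 1
        then have "(\<Sum>k=2..m. h k) = h 2" "(-1) ^ m * real ((d - 1) choose m) \<ge> 0" by simp_all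
        then show ?thesis using step' two X1 E_bounds(1) by linarith
      next
        case 2
        have "h 3 = 0" by (simp add: h_def)
        have "{2..m} = {2, 3}" using 2 by auto
        then have "(\<Sum>k=2..m. h k) = h 2 + h 3" by simp
        moreover have "- ((-1) ^ m * real ((d - 1) choose m)) \<le> X / 3"
          using choose_bound[of m] 2 by (simp add: X_def)
        ultimately show ?thesis using step' two X1 E_bounds(1) \<open>h 3 = 0\<close> by linarith
      next
        case 3
        have "{2..m} = insert 2 (insert 3 {4..m})" using 3 by auto
        then have "(\<Sum>k=2..m. h k) = h 2 + (\<Sum>k=4..m. h k)" by (simp add: h_def)
        moreover have "(\<Sum>k=4..m. h k) \<le> 4 / 3 * X"
        proof -
          have "(\<Sum>k=4..m. h k) \<le> (\<Sum>k=4..m. 2 ^ k / fact k) * X"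
            unfolding sum_distrib_right by (intro sum_mono hk) auto
          also have "\<dots> \<le> 4 / 3 * X"
            using sum_two_pow_div_fact_bound[OF 3] X1 E_bounds(1) by (intro mult_right_mono) auto
          finally show ?thesis .
        qed
        moreover have "- ((-1) ^ m * real ((d - 1) choose m)) \<le> X / 3"
        proof -
          have "- ((-1) ^ m * real ((d - 1) choose m)) \<le> real ((d - 1) choose m)" by (cases "even m") auto
          then show ?thesis using choose_bound[of m] 3 by (simp add: X_def)
        qed
        \<comment> \<open>The remaining terms 1 + X/3 + 4X/3 fit into the slack 3X-3 exactly when X
          >= 3.\<close>
        moreover have "X \<ge> 3"
        proof -
          have "(3 / 2) ^ 3 \<le> E ^ 3" using E_bounds(1) by (intro power_mono) auto
          also have "\<dots> \<le> X" unfolding X_def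
          proof (rule power_increasing)
            have "(2::nat) ^ 2 \<le> 2 ^ (m - 2)" using 3 by (intro power_increasing) auto
            then show "3 \<le> (2::nat) ^ (m - 2)" by simp
          qed (use E_bounds(1) in auto)
          finally show ?thesis by (simp add: power3_eq_cube)
        qed
        ultimately show ?thesis using step' two by linarith
      qed
    qed
    then show ?thesis unfolding X2 j_def .
  qed
qed

lemma first_constants_bound:
  assumes "2 \<le> n"
  shows "real (a 1 + b 1) \<le> 2 * ((real d)\<^sup>2 / 2 + real d) ^ (2 ^ (n - 2))"
proof -
  have "n - (n - 1) = 1" "n - 1 - 1 = n - 2" using assms by auto
  then show ?thesis using sum_constants_bound[of "n - 1"] assms by (simp add: E_def)
qed

lemma le_first: "i \<in> {1..n} \<Longrightarrow> a i \<le> a 1 \<and> b i \<le> b 1"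
proof (induction i)
  case (Suc i)
  show ?case
  proof (cases "i = 0")
    case False
    then have "i \<in> {1..n}" using Suc.prems by simp
    with Suc.IH a(2)[of i] b(2)[of i] show ?thesis by linarith
  qed simp
qed simp

text \<open>The polynomial identity is read backwards: past the first constants all counts are given
  by their polynomials, so the identity assumed from \<open>B\<close> on is valid from
  there.\<close>

lemma count_beyond_first:
  assumes "n \<ge> 1" "a 1 \<le> t" "b 1 \<le> t"
  shows "cone_count 0 n t = cone_count d n t + exact_count n a t + exact_count n b t"
proof -
  have le: "i \<in> {1..n} \<Longrightarrow> a i \<le> t" "i \<in> {1..n} \<Longrightarrow> b i \<le> t" for i
    using le_first[of i] assms by auto
  have "real (exact_count n a t) = (\<Sum>i=1..n. \<Sum>s=a (Suc i)..<a i. cone_poly (i - 1) s (real t))"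
    "real (exact_count n b t) = (\<Sum>i=1..n. \<Sum>s=b (Suc i)..<b i. cone_poly (i - 1) s (real t))"
    by (rule exact_count_eq_poly, erule le)+
  moreover have "real (cone_count s n t) = cone_poly (n - 1) s (real t)" if "s \<in> {0, d}" for s
    using ge_d[of 1] that assms by (intro cone_count_eq_poly) auto
  ultimately have "real (cone_count 0 n t) = real (cone_count d n t + exact_count n a t + exact_count n b t)"
    using poly_identity[of 1 "real t"] assms(1) by simp
  then show ?thesis by (simp only: of_nat_eq_iff)
qed

end

lemma standard_pair_degree_bound:
  assumes "d > 0" "n \<ge> 2" "standard d P" "dim_le n P" "standard d Q" "dim_le n Q"
    and total: "\<And>t. cone_count 0 n t = cone_count d n t + hilb Q t + hilb P t"
    and p: "(p, m) \<in># P"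
  shows "real (Suc p) \<le> 2 * ((real d)\<^sup>2 / 2 + real d) ^ (2 ^ (n - 2))"
proof -
  obtain b y where bz: "b (Suc n) = d" "\<forall>i\<in>{1..n}. b (Suc i) \<le> b i"
      "\<forall>t. hilb P t = exact_count n b t + y t" "finite {t. y t \<noteq> 0}"
      "\<forall>(c, m)\<in>#P. c < b 1 \<or> y c > 0"
    using exact_decomposition[OF assms(3,4)] by blast
  obtain a z where az: "a (Suc n) = d" "\<forall>i\<in>{1..n}. a (Suc i) \<le> a i"
      "\<forall>t. hilb Q t = exact_count n a t + z t" "finite {t. z t \<noteq> 0}"
    using exact_decomposition[OF assms(5,6)] by blast
  have "finite ({t. y t \<noteq> 0} \<union> {t. z t \<noteq> 0})" using az bz by simp
  then obtain B where B: "\<forall>t\<in>{t. y t \<noteq> 0} \<union> {t. z t \<noteq> 0}. t < B"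
    unfolding finite_nat_set_iff_bounded ..
  have zero: "y t = 0 \<and> z t = 0" if "B \<le> t" for t
  proof (rule ccontr)
    assume "\<not> (y t = 0 \<and> z t = 0)"
    then have "t \<in> {t. y t \<noteq> 0} \<union> {t. z t \<noteq> 0}" by auto
    from bspec[OF B this] that show False by linarith
  qed
  interpret macaulay_constants a b n d B
  proof unfold_locales
    show "cone_count 0 n t = cone_count d n t + exact_count n a t + exact_count n b t" if "B \<le> t" for t
      using total[of t] az(3)[rule_format, of t] bz(3)[rule_format, of t] zero[OF that] by linarith
  qed (use az(1,2) bz(1,2) assms(1) in simp_all)
  \<comment> \<open>A cone at or beyond both constants would have to be counted by \<open>y\<close>.
    But there the identity holds without \<open>y\<close> and \<open>z\<close>, which forces
    \<open>y p = 0\<close>.\<close>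
  have "p < max (a 1) (b 1)"
  proof (rule ccontr)
    assume neg: "\<not> p < max (a 1) (b 1)"
    then have "cone_count 0 n p = cone_count d n p + exact_count n a p + exact_count n b p"
      using assms(2) by (intro count_beyond_first) auto
    moreover have "p < b 1 \<or> y p > 0" using bspec[OF bz(5) p] by simp
    then have "y p > 0" using neg by linarith
    ultimately show False using total[of p] az(3)[rule_format, of p] bz(3)[rule_format, of p] by linarith
  qed
  then have "Suc p \<le> a 1 + b 1" by linarith
  then show ?thesis using first_constants_bound[OF assms(2)] by linarith
qed

section \<open>Multiplication in algebras of solvable type\<close>

context homogeneous_solvable_algebra
begin

section \<open>The monomial ordering within a fixed degree\<close>

definition lt :: "(nat \<Rightarrow>\<^sub>0 nat) \<Rightarrow> (nat \<Rightarrow>\<^sub>0 nat) \<Rightarrow> bool" where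
  "lt \<alpha> \<beta> \<longleftrightarrow> (\<alpha>, \<beta>) \<in> r \<and> \<alpha> \<noteq> \<beta>"

lemma linear: "linear_order_on (exps N) r"
  using ordering by (simp add: monomial_ordering_def)

lemma ord_in_exps: "(\<alpha>, \<beta>) \<in> r \<Longrightarrow> \<alpha> \<in> exps N \<and> \<beta> \<in> exps N"
  using linear by (auto simp: order_on_defs)

lemma ord_refl: "\<alpha> \<in> exps N \<Longrightarrow> (\<alpha>, \<alpha>) \<in> r"
  using linear by (auto simp: order_on_defs refl_on_def)

lemma ord_trans: "(\<alpha>, \<beta>) \<in> r \<Longrightarrow> (\<beta>, \<gamma>) \<in> r \<Longrightarrow> (\<alpha>, \<gamma>) \<in> r"
  using linear unfolding order_on_defs by (meson transD)

lemma ord_antisym: "(\<alpha>, \<beta>) \<in> r \<Longrightarrow> (\<beta>, \<alpha>) \<in> r \<Longrightarrow> \<alpha> = \<beta>"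
  using linear unfolding order_on_defs by (meson antisymD)

lemma ord_total:
  assumes "\<alpha> \<in> exps N" "\<beta> \<in> exps N"
  shows "(\<alpha>, \<beta>) \<in> r \<or> (\<beta>, \<alpha>) \<in> r"
proof (cases "\<alpha> = \<beta>")
  case False
  have "total_on (exps N) r" using linear by (simp add: order_on_defs)
  then show ?thesis using assms False by (auto simp: total_on_def)
qed (use ord_refl[OF assms(1)] in simp)

lemma ord_add: "(\<alpha>, \<beta>) \<in> r \<Longrightarrow> \<gamma> \<in> exps N \<Longrightarrow> (\<alpha> + \<gamma>, \<beta> + \<gamma>) \<in> r"
  using ordering ord_in_exps unfolding monomial_ordering_def by blast

lemma ord_add_mono:
  assumes "(\<alpha>, \<beta>) \<in> r" "(\<gamma>, \<delta>) \<in> r"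
  shows "(\<alpha> + \<gamma>, \<beta> + \<delta>) \<in> r"
proof -
  have "(\<alpha> + \<gamma>, \<beta> + \<gamma>) \<in> r" using assms ord_in_exps by (intro ord_add) blast+
  moreover have "(\<gamma> + \<beta>, \<delta> + \<beta>) \<in> r" using assms ord_in_exps by (intro ord_add) blast+
  ultimately show ?thesis using ord_trans by (simp add: add.commute[of \<gamma>] add.commute[of \<delta>])
qed

lemma lt_irrefl [simp]: "\<not> lt \<alpha> \<alpha>"
  by (simp add: lt_def)

lemma lt_le_trans: "lt \<alpha> \<beta> \<Longrightarrow> (\<beta>, \<gamma>) \<in> r \<Longrightarrow> lt \<alpha> \<gamma>"
  unfolding lt_def using ord_trans ord_antisym by blast

lemma le_lt_trans: "(\<alpha>, \<beta>) \<in> r \<Longrightarrow> lt \<beta> \<gamma> \<Longrightarrow> lt \<alpha> \<gamma>"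
  unfolding lt_def using ord_trans ord_antisym by blast

lemma lt_add: "lt \<alpha> \<beta> \<Longrightarrow> \<gamma> \<in> exps N \<Longrightarrow> lt (\<alpha> + \<gamma>) (\<beta> + \<gamma>)"
  unfolding lt_def using ord_add by auto

lemma lt_add_mono:
  assumes "lt \<alpha> \<beta>" "(\<gamma>, \<delta>) \<in> r"
  shows "lt (\<alpha> + \<gamma>) (\<beta> + \<delta>)"
proof -
  have b: "(\<beta>, \<beta>) \<in> r" using assms(1) ord_in_exps ord_refl by (auto simp: lt_def)
  have "lt (\<alpha> + \<gamma>) (\<beta> + \<gamma>)" using assms ord_in_exps by (intro lt_add) blast+
  then show ?thesis using ord_add_mono[OF b assms(2)] by (rule lt_le_trans)
qed

lemma dvd_imp_ord: "exp_dvd \<alpha> \<beta> \<Longrightarrow> \<beta> \<in> exps N \<Longrightarrow> (\<alpha>, \<beta>) \<in> r"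
proof -
  assume "exp_dvd \<alpha> \<beta>" "\<beta> \<in> exps N"
  then obtain \<gamma> where g: "\<beta> = \<alpha> + \<gamma>" "\<alpha> \<in> exps N" "\<gamma> \<in> exps N" by (auto simp: exp_dvd_iff)
  then have "(0, \<gamma>) \<in> r" using ordering by (simp add: monomial_ordering_def)
  from ord_add[OF this g(2)] show "(\<alpha>, \<beta>) \<in> r" using g by (simp add: add.commute)
qed

lemma ex_max:
  assumes "finite S" "S \<noteq> {}" "S \<subseteq> exps N"
  shows "\<exists>\<alpha>\<in>S. \<forall>\<beta>\<in>S. (\<beta>, \<alpha>) \<in> r"
  using assms
proof (induction S rule: finite_ne_induct)
  case (singleton \<alpha>)
  then show ?case using ord_refl[of \<alpha>] by simp
next
  case (insert \<alpha> S)
  have "S \<subseteq> exps N" "\<alpha> \<in> exps N" using insert.prems by simp_all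
  with insert.IH obtain \<mu> where m: "\<mu> \<in> S" "\<forall>\<beta>\<in>S. (\<beta>, \<mu>) \<in> r" by blast
  have "\<mu> \<in> exps N" using m(1) \<open>S \<subseteq> exps N\<close> by (rule subsetD[rotated])
  from ord_total[OF this \<open>\<alpha> \<in> exps N\<close>] show ?case
  proof
    assume "(\<mu>, \<alpha>) \<in> r"
    then have "\<forall>\<beta>\<in>S. (\<beta>, \<alpha>) \<in> r" using ord_trans[OF bspec[OF m(2)]] by simp
    then show ?thesis using ord_refl[OF \<open>\<alpha> \<in> exps N\<close>] by (intro bexI[of _ \<alpha>]) simp_all
  next
    assume "(\<alpha>, \<mu>) \<in> r"
    then show ?thesis using m by (intro bexI[of _ \<mu>]) simp_all
  qed
qed

text \<open>Only finitely many exponents share a degree. Since all rewriting preserves degrees, this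
  number serves as a termination measure for the ordering.\<close>

definition rank :: "(nat \<Rightarrow>\<^sub>0 nat) \<Rightarrow> nat" where
  "rank \<alpha> = card {\<beta> \<in> exps N. exp_size \<beta> = exp_size \<alpha> \<and> lt \<beta> \<alpha>}"

lemma rank_mono:
  assumes "lt \<beta> \<alpha>" "exp_size \<beta> = exp_size \<alpha>"
  shows "rank \<beta> < rank \<alpha>"
proof -
  define A B where "A = {\<gamma> \<in> exps N. exp_size \<gamma> = exp_size \<beta> \<and> lt \<gamma> \<beta>}"
    and "B = {\<gamma> \<in> exps N. exp_size \<gamma> = exp_size \<alpha> \<and> lt \<gamma> \<alpha>}"
  have "finite B"
    unfolding B_def by (rule finite_subset[OF _ finite_exps_size[of N "exp_size \<alpha>"]]) auto
  have r: "(\<beta>, \<alpha>) \<in> r" using assms(1) by (simp add: lt_def)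
  have "A \<subseteq> B" using assms(2) lt_le_trans[OF _ r] by (auto simp: A_def B_def)
  moreover have "\<beta> \<in> B" using assms ord_in_exps[OF r] by (simp add: B_def)
  moreover have "\<beta> \<notin> A" by (simp add: A_def)
  ultimately have "A \<subset> B" by blast
  then show ?thesis unfolding rank_def using psubset_card_mono[OF \<open>finite B\<close>]
    by (simp add: A_def B_def)
qed

section \<open>Coefficients and supports in the monomial basis\<close>

lemma indep: "independent (mon ` exps N)" and span_mon: "span (mon ` exps N) = UNIV"
  and inj_mon: "inj_on mon (exps N)"
  using basis by (auto simp: monomials_basis_def)

lemma coeff_add [simp]: "coeff (f + g) \<alpha> = coeff f \<alpha> + coeff g \<alpha>"
  by (simp add: coeff_def representation_add[OF indep] span_mon)

lemma coeff_diff [simp]: "coeff (f - g) \<alpha> = coeff f \<alpha> - coeff g \<alpha>"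
  by (simp add: coeff_def representation_diff[OF indep] span_mon)

lemma coeff_scale [simp]: "coeff (c *s f) \<alpha> = c * coeff f \<alpha>"
  by (simp add: coeff_def representation_scale[OF indep] span_mon)

lemma coeff_zero [simp]: "coeff 0 \<alpha> = 0"
  by (simp add: coeff_def representation_zero)

lemma coeff_sum: "coeff (\<Sum>i\<in>A. f i) \<alpha> = (\<Sum>i\<in>A. coeff (f i) \<alpha>)"
  by (simp add: coeff_def representation_sum[OF indep] span_mon)

lemma coeff_mon: "\<alpha> \<in> exps N \<Longrightarrow> \<beta> \<in> exps N \<Longrightarrow> coeff (mon \<alpha>) \<beta> = (if \<alpha> = \<beta> then 1 else 0)"
  using inj_mon by (auto simp: coeff_def representation_basis[OF indep] inj_on_def)

lemma supp_exps: "\<alpha> \<in> supp f \<Longrightarrow> \<alpha> \<in> exps N"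
  by (simp add: supp_def)

lemma finite_supp [simp]: "finite (supp f)"
proof (rule finite_imageD)
  have "mon ` supp f \<subseteq> {b. representation (mon ` exps N) f b \<noteq> 0}"
    by (auto simp: supp_def coeff_def)
  then show "finite (mon ` supp f)" using finite_representation finite_subset by blast
  show "inj_on mon (supp f)" using inj_mon by (rule inj_on_subset) (auto simp: supp_def)
qed

lemma expand: "(\<Sum>\<alpha>\<in>supp f. coeff f \<alpha> *s mon \<alpha>) = f"
proof -
  let ?R = "representation (mon ` exps N) f"
  have "{b. ?R b \<noteq> 0} = mon ` supp f"
    using representation_ne_zero[of "mon ` exps N" f] by (auto simp: supp_def coeff_def)
  then have "f = (\<Sum>b\<in>mon ` supp f. ?R b *s b)"
    using sum_nonzero_representation_eq[OF indep, of f] span_mon by simp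
  also have "\<dots> = (\<Sum>\<alpha>\<in>supp f. coeff f \<alpha> *s mon \<alpha>)"
    by (subst sum.reindex[OF inj_on_subset[OF inj_mon]]) (auto simp: supp_def coeff_def)
  finally show ?thesis ..
qed

lemma supp_empty_iff [simp]: "supp f = {} \<longleftrightarrow> f = 0"
  using expand[of f] by (auto simp: supp_def)

lemma coeff_eqI: "(\<And>\<alpha>. \<alpha> \<in> exps N \<Longrightarrow> coeff f \<alpha> = coeff g \<alpha>) \<Longrightarrow> f = g"
  using supp_empty_iff[of "f - g"] by (simp add: supp_def)

lemma supp_add: "supp (f + g) \<subseteq> supp f \<union> supp g"
  by (auto simp: supp_def)

lemma supp_diff: "supp (f - g) \<subseteq> supp f \<union> supp g"
  by (auto simp: supp_def)

lemma supp_scale: "supp (c *s f) \<subseteq> supp f"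
  by (auto simp: supp_def)

lemma supp_mon [simp]: "\<alpha> \<in> exps N \<Longrightarrow> supp (mon \<alpha>) = {\<alpha>}"
  by (auto simp: supp_def coeff_mon split: if_splits)

lemma supp_sum_mon:
  assumes "finite A" "A \<subseteq> exps N"
  shows "supp (\<Sum>\<alpha>\<in>A. c \<alpha> *s mon \<alpha>) \<subseteq> A"
    and "\<alpha> \<in> A \<Longrightarrow> coeff (\<Sum>\<alpha>\<in>A. c \<alpha> *s mon \<alpha>) \<alpha> = c \<alpha>"
proof -
  have *: "coeff (\<Sum>\<alpha>\<in>A. c \<alpha> *s mon \<alpha>) \<alpha> = (if \<alpha> \<in> A then c \<alpha> else 0)" if "\<alpha> \<in> exps N" for \<alpha>
  proof -
    have "coeff (\<Sum>\<alpha>\<in>A. c \<alpha> *s mon \<alpha>) \<alpha> = (\<Sum>\<beta>\<in>A. if \<beta> = \<alpha> then c \<beta> else 0)"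
      unfolding coeff_sum using assms(2) that by (intro sum.cong) (auto simp: coeff_mon)
    then show ?thesis using assms(1) by simp
  qed
  then show "supp (\<Sum>\<alpha>\<in>A. c \<alpha> *s mon \<alpha>) \<subseteq> A" by (auto simp: supp_def split: if_splits)
  show "coeff (\<Sum>\<alpha>\<in>A. c \<alpha> *s mon \<alpha>) \<alpha> = c \<alpha>" if "\<alpha> \<in> A"
    using * assms(2) that by auto
qed

definition supported :: "((nat \<Rightarrow>\<^sub>0 nat) \<Rightarrow> bool) \<Rightarrow> 'b set" where
  "supported P = {f. \<forall>\<alpha>\<in>supp f. P \<alpha>}"

lemma subspace_supported: "subspace (supported P)"
proof (rule subspaceI)
  show "0 \<in> supported P" by (simp add: supported_def supp_def)
next
  fix f g assume "f \<in> supported P" "g \<in> supported P"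
  then show "f + g \<in> supported P" using supp_add[of f g] by (auto simp: supported_def)
next
  fix c f assume "f \<in> supported P"
  then show "c *s f \<in> supported P" using supp_scale[of c f] by (auto simp: supported_def)
qed

lemma mon_supported: "\<alpha> \<in> exps N \<Longrightarrow> P \<alpha> \<Longrightarrow> mon \<alpha> \<in> supported P"
  by (simp add: supported_def)

lemma supported_mono: "f \<in> supported P \<Longrightarrow> (\<And>\<alpha>. P \<alpha> \<Longrightarrow> Q \<alpha>) \<Longrightarrow> f \<in> supported Q"
  by (auto simp: supported_def)

lemma component_eq_supported: "component d = supported (\<lambda>\<alpha>. exp_size \<alpha> = d)"
proof
  have "mon ` {\<alpha> \<in> exps N. exp_size \<alpha> = d} \<subseteq> supported (\<lambda>\<alpha>. exp_size \<alpha> = d)"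
    by (auto simp: supported_def)
  then show "component d \<subseteq> supported (\<lambda>\<alpha>. exp_size \<alpha> = d)"
    unfolding component_def using subspace_supported by (rule span_minimal)
  show "supported (\<lambda>\<alpha>. exp_size \<alpha> = d) \<subseteq> component d"
  proof
    fix f assume f: "f \<in> supported (\<lambda>\<alpha>. exp_size \<alpha> = d)"
    have "mon \<alpha> \<in> component d" if "\<alpha> \<in> supp f" for \<alpha>
      unfolding component_def using f that by (intro span_base) (auto simp: supported_def supp_exps)
    then have "(\<Sum>\<alpha>\<in>supp f. coeff f \<alpha> *s mon \<alpha>) \<in> component d"
      unfolding component_def by (intro span_sum span_scale)
    then show "f \<in> component d" by (simp only: expand)
  qed
qed

lemma subspace_component: "subspace (component d)"
  by (simp add: component_def)

lemma mult_in_subspace: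
  assumes V: "subspace V"
    and "\<And>\<alpha> \<beta>. \<alpha> \<in> supp f \<Longrightarrow> \<beta> \<in> supp g \<Longrightarrow> mon \<alpha> * mon \<beta> \<in> V"
  shows "f * g \<in> V"
proof -
  have "f * g = (\<Sum>\<alpha>\<in>supp f. coeff f \<alpha> *s mon \<alpha>) * (\<Sum>\<beta>\<in>supp g. coeff g \<beta> *s mon \<beta>)"
    by (simp add: expand)
  also have "\<dots> = (\<Sum>\<alpha>\<in>supp f. \<Sum>\<beta>\<in>supp g. (coeff f \<alpha> *s mon \<alpha>) * (coeff g \<beta> *s mon \<beta>))"
    by (rule sum_product)
  also have "\<dots> \<in> V"
    by (intro subspace_sum[OF V]) (simp add: scale_mult_left scale_mult_right subspace_scale[OF V] assms(2))
  finally show ?thesis .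
qed

lemma lm_greatest:
  assumes "f \<noteq> 0"
  shows "lm f \<in> supp f" "\<And>\<beta>. \<beta> \<in> supp f \<Longrightarrow> (\<beta>, lm f) \<in> r"
proof -
  have "supp f \<subseteq> exps N" using supp_exps by blast
  then obtain \<mu> where m: "\<mu> \<in> supp f" "\<forall>\<beta>\<in>supp f. (\<beta>, \<mu>) \<in> r"
    using ex_max[of "supp f"] assms by auto
  have "lm f = \<mu>"
    unfolding lm_def
  proof (rule the_equality)
    fix \<alpha> assume a: "\<alpha> \<in> supp f \<and> (\<forall>\<beta>\<in>supp f. (\<beta>, \<alpha>) \<in> r)"
    show "\<alpha> = \<mu>" by (rule ord_antisym) (use a m in simp_all)
  qed (use m in simp)
  then show "lm f \<in> supp f" "\<And>\<beta>. \<beta> \<in> supp f \<Longrightarrow> (\<beta>, lm f) \<in> r" using m by simp_all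
qed

lemma lm_eqI:
  assumes "\<alpha> \<in> supp f" "\<And>\<beta>. \<beta> \<in> supp f \<Longrightarrow> (\<beta>, \<alpha>) \<in> r"
  shows "lm f = \<alpha>"
proof (rule ord_antisym)
  have "f \<noteq> 0" using assms(1) by (auto simp: supp_def)
  then show "(lm f, \<alpha>) \<in> r" "(\<alpha>, lm f) \<in> r" using assms lm_greatest by simp_all
qed

lemma lm_exps: "f \<noteq> 0 \<Longrightarrow> lm f \<in> exps N"
  using lm_greatest(1) supp_exps by blast

lemma lm_mon [simp]: "\<alpha> \<in> exps N \<Longrightarrow> lm (mon \<alpha>) = \<alpha>"
  by (rule lm_eqI) (simp_all add: ord_refl)

section \<open>Words in the generators and straightening\<close>

definition wprod :: "nat list \<Rightarrow> 'b" where
  "wprod w = prod_list (map x w)"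

definition wexp :: "nat list \<Rightarrow> (nat \<Rightarrow>\<^sub>0 nat)" where
  "wexp w = (\<Sum>i\<leftarrow>w. Poly_Mapping.single i 1)"

lemma wprod_simps [simp]: "wprod [] = 1" "wprod (i # w) = x i * wprod w"
  "wprod (u @ v) = wprod u * wprod v"
  by (simp_all add: wprod_def)

lemma wexp_simps [simp]: "wexp [] = 0" "wexp (i # w) = Poly_Mapping.single i 1 + wexp w"
  "wexp (u @ v) = wexp u + wexp v"
  by (simp_all add: wexp_def)

lemma wexp_in_exps: "set w \<subseteq> {..<N} \<Longrightarrow> wexp w \<in> exps N"
  by (induction w) auto

lemma lookup_wexp_eq_0: "i \<notin> set w \<Longrightarrow> lookup (wexp w) i = 0"
  by (induction w) (auto simp: lookup_add lookup_single when_def)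

lemma mon_zero [simp]: "mon 0 = 1"
proof -
  have "prod_list (map (\<lambda>i. x i ^ lookup 0 i) is) = 1" for "is" by (induction "is") auto
  then show ?thesis by (simp add: mon_def)
qed

lemma mon_Cons:
  assumes "i < N" "\<And>k. k < i \<Longrightarrow> lookup \<alpha> k = 0"
  shows "x i * mon \<alpha> = mon (Poly_Mapping.single i 1 + \<alpha>)"
proof -
  let ?\<beta> = "Poly_Mapping.single i (Suc 0) + \<alpha>"
  have lk: "lookup ?\<beta> k = (if k = i then Suc (lookup \<alpha> i) else lookup \<alpha> k)" for k
    by (auto simp: lookup_add lookup_single when_def)
  have "[0..<N] = [0..<i] @ [i..<N]" using upt_add_eq_append[of 0 i "N - i"] assms(1) by simp
  also have "[i..<N] = i # [Suc i..<N]" using assms(1) by (rule upt_conv_Cons)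
  finally have N: "[0..<N] = [0..<i] @ i # [Suc i..<N]" .
  have one: "prod_list (map (\<lambda>k. x k ^ lookup \<gamma> k) ks) = 1" if "\<forall>k\<in>set ks. lookup \<gamma> k = 0" for \<gamma> ks
    using that by (induction ks) auto
  have rest: "map (\<lambda>k. x k ^ lookup ?\<beta> k) [Suc i..<N] = map (\<lambda>k. x k ^ lookup \<alpha> k) [Suc i..<N]"
    by (auto simp: lk)
  have "mon \<alpha> = x i ^ lookup \<alpha> i * prod_list (map (\<lambda>k. x k ^ lookup \<alpha> k) [Suc i..<N])"
    unfolding mon_def N using one[of "[0..<i]" \<alpha>] assms(2) by simp
  moreover have "mon ?\<beta> = x i ^ lookup ?\<beta> i * prod_list (map (\<lambda>k. x k ^ lookup ?\<beta> k) [Suc i..<N])"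
    unfolding mon_def N using one[of "[0..<i]" ?\<beta>] assms(2) lk by simp
  ultimately have "x i * mon \<alpha> = mon ?\<beta>" unfolding rest by (simp add: lk mult.assoc)
  then show ?thesis by simp
qed

lemma wprod_sorted: "sorted w \<Longrightarrow> set w \<subseteq> {..<N} \<Longrightarrow> wprod w = mon (wexp w)"
proof (induction w)
  case (Cons i w)
  have "lookup (wexp w) k = 0" if "k < i" for k
    using Cons.prems(1) that by (intro lookup_wexp_eq_0) auto
  then show ?case using Cons mon_Cons[of i "wexp w"] by simp
qed simp

lemma ex_word:
  "\<alpha> \<in> exps N \<Longrightarrow> \<exists>w. set w \<subseteq> {..<N} \<and> wprod w = mon \<alpha> \<and> wexp w = \<alpha>"
proof (induction "exp_size \<alpha>" arbitrary: \<alpha>)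
  case 0
  have "\<alpha> = 0"
    using lookup_le_exp_size[of \<alpha>] 0 by (intro poly_mapping_eqI) simp
  then show ?case by (intro exI[of _ "[]"]) simp
next
  case (Suc n)
  then have "\<alpha> \<noteq> 0" by auto
  then have ex: "\<exists>i. lookup \<alpha> i \<noteq> 0" by (metis lookup_zero poly_mapping_eqI)
  define i where "i = (LEAST i. lookup \<alpha> i \<noteq> 0)"
  have i: "lookup \<alpha> i \<noteq> 0" "\<And>k. k < i \<Longrightarrow> lookup \<alpha> k = 0"
    unfolding i_def using LeastI_ex[OF ex] not_less_Least by blast+
  have iN: "i < N" using i(1) Suc.prems by (metis exps_iff linorder_not_less)
  define \<beta> where "\<beta> = \<alpha> - Poly_Mapping.single i 1"
  have a: "\<alpha> = Poly_Mapping.single i 1 + \<beta>"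
    using i(1) by (intro poly_mapping_eqI) (auto simp: \<beta>_def lookup_add lookup_minus lookup_single when_def)
  have "\<beta> \<in> exps N" "n = exp_size \<beta>" using Suc a iN by auto
  from Suc.hyps(1)[OF this(2,1)] obtain w where
    w: "set w \<subseteq> {..<N}" "wprod w = mon \<beta>" "wexp w = \<beta>" by blast
  have "lookup \<beta> k = 0" if "k < i" for k using i(2)[OF that] by (simp add: \<beta>_def lookup_minus)
  then have "x i * mon \<beta> = mon \<alpha>" using mon_Cons[OF iN, of \<beta>] a by simp
  then show ?case using w iN a by (intro exI[of _ "i # w"]) simp
qed

abbreviation below :: "(nat \<Rightarrow>\<^sub>0 nat) \<Rightarrow> 'b set" where
  "below \<alpha> \<equiv> supported (\<lambda>\<beta>. exp_size \<beta> = exp_size \<alpha> \<and> lt \<beta> \<alpha>)"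

text \<open>Decreases when a larger letter is moved to the right past a smaller one.\<close>

fun weight :: "nat list \<Rightarrow> nat" where
  "weight [] = 0"
| "weight (i # w) = Suc (length w) * i + weight w"

lemma weight_append: "weight (u @ v) = weight u + length v * sum_list u + weight v"
  by (induction u) (auto simp: algebra_simps)

text \<open>An adjacent inversion is removed by the commutation relation. The swapped word has the
  same exponent and smaller \<open>weight\<close>; the words coming from \<open>p\<close> have the
  same degree, by homogeneity, and a smaller exponent, hence smaller \<open>rank\<close>. Leading
  coefficients only pick up nonzero factors.\<close>

lemma straighten:
  "set w \<subseteq> {..<N} \<Longrightarrow> \<exists>c. c \<noteq> 0 \<and> wprod w - c *s mon (wexp w) \<in> below (wexp w)"
proof (induction w rule: wf_induct_rule[OF wf_measures[of "[\<lambda>w. rank (wexp w), weight]"]])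
  case (1 w)
  note IH = 1(1) and w = 1(2)
  show ?case
  proof (cases "sorted w")
    case True
    then show ?thesis using wprod_sorted[OF True w] subspace_0[OF subspace_supported]
      by (intro exI[of _ 1]) simp
  next
    case False
    then obtain k where k: "Suc k < length w" "w ! Suc k < w ! k"
      unfolding sorted_iff_nth_Suc by (auto simp: not_le)
    define u v i j where uv: "u = take k w" "v = drop (Suc (Suc k)) w" "i = w ! Suc k" "j = w ! k"
    have "drop k w = w ! k # w ! Suc k # drop (Suc (Suc k)) w"
      using Cons_nth_drop_Suc[of k w] Cons_nth_drop_Suc[of "Suc k" w] k(1) by simp
    then have weq: "w = u @ j # i # v"
      using append_take_drop_id[of k w] by (simp add: uv)
    have "j \<in> set w" using k(1) by (simp add: uv)
    then have ij: "i < j" "j < N" using k(2) w by (auto simp: uv(3,4))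
    have uvN: "set u \<subseteq> {..<N}" "set v \<subseteq> {..<N}"
      using w set_take_subset[of k w] set_drop_subset[of "Suc (Suc k)" w] unfolding uv(1,2) by (meson subset_trans)+
    define \<epsilon> where "\<epsilon> = Poly_Mapping.single i (1::nat) + Poly_Mapping.single j 1"
    obtain c p where cp: "commutation_relation i j c p" using solvable[OF ij] by blast
    have c: "c \<noteq> 0" "x j * x i = c *s (x i * x j) + p"
      and p: "p = 0 \<or> (lm p, \<epsilon>) \<in> r \<and> lm p \<noteq> \<epsilon>"
      using cp by (auto simp: commutation_relation_def \<epsilon>_def Let_def)
    define \<alpha> where "\<alpha> = wexp w"
    have V: "subspace (below \<alpha>)" by (rule subspace_supported)
    have \<alpha>: "\<alpha> = wexp u + \<epsilon> + wexp v"
      by (simp add: \<alpha>_def weq \<epsilon>_def add_ac)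
    have below_\<epsilon>: "exp_size \<gamma> = exp_size \<epsilon>" "lt \<gamma> \<epsilon>" if g: "\<gamma> \<in> supp p" for \<gamma>
    proof -
      have p0: "p \<noteq> 0" using g by (auto simp: supp_def)
      have "p \<in> component 2" using homogeneous[OF ij cp] .
      then show "exp_size \<gamma> = exp_size \<epsilon>"
        using g by (simp add: component_eq_supported supported_def \<epsilon>_def)
      have "lt (lm p) \<epsilon>" using p p0 by (simp add: lt_def)
      then show "lt \<gamma> \<epsilon>" by (rule le_lt_trans[OF lm_greatest(2)[OF p0 g]])
    qed
    have tail: "wprod u * mon \<gamma> * wprod v \<in> below \<alpha>" if g: "\<gamma> \<in> supp p" for \<gamma>
    proof -
      \<comment> \<open>Each monomial of \<open>p\<close> is written as a word again, so that the
        induction hypothesis applies to the whole product.\<close>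
      obtain wg where wg: "set wg \<subseteq> {..<N}" "wprod wg = mon \<gamma>" "wexp wg = \<gamma>"
        using ex_word[OF supp_exps[OF g]] by blast
      define w' where "w' = u @ wg @ v"
      have w'N: "set w' \<subseteq> {..<N}" using uvN wg by (simp add: w'_def)
      have e: "wexp w' = \<gamma> + (wexp u + wexp v)" by (simp add: w'_def wg add_ac)
      have l: "lt (wexp w') \<alpha>"
        unfolding e \<alpha> using lt_add[OF below_\<epsilon>(2)[OF g], of "wexp u + wexp v"] wexp_in_exps uvN
        by (simp add: add_ac)
      have sz: "exp_size (wexp w') = exp_size \<alpha>" unfolding e \<alpha> using below_\<epsilon>(1)[OF g] by simp
      have "(w', w) \<in> measures [\<lambda>w. rank (wexp w), weight]"
        using rank_mono[OF l sz] by (simp add: \<alpha>_def)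
      from IH[OF this w'N] obtain k where k: "wprod w' - k *s mon (wexp w') \<in> below (wexp w')" by blast
      have "(\<delta>, \<alpha>) \<in> r" if "lt \<delta> \<alpha>" for \<delta> using that by (simp add: lt_def)
      then have "wprod w' - k *s mon (wexp w') \<in> below \<alpha>"
        using k sz lt_le_trans[OF _ l[unfolded lt_def, THEN conjunct1]] by (auto simp: supported_def)
      moreover have "k *s mon (wexp w') \<in> below \<alpha>"
        using l sz wexp_in_exps[OF w'N] by (intro subspace_scale[OF V] mon_supported) auto
      ultimately have "(wprod w' - k *s mon (wexp w')) + k *s mon (wexp w') \<in> below \<alpha>"
        by (rule subspace_add[OF V])
      then show ?thesis by (simp add: w'_def wg mult.assoc)
    qed
    have "wprod u * (\<Sum>\<gamma>\<in>supp p. coeff p \<gamma> *s mon \<gamma>) * wprod v =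
        (\<Sum>\<gamma>\<in>supp p. coeff p \<gamma> *s (wprod u * mon \<gamma> * wprod v))"
      by (simp add: sum_distrib_left sum_distrib_right scale_mult_left scale_mult_right)
    also have "\<dots> \<in> below \<alpha>"
      by (intro subspace_sum[OF V] subspace_scale[OF V] tail)
    finally have up: "wprod u * p * wprod v \<in> below \<alpha>" by (simp only: expand)
    define w' where "w' = u @ i # j # v"
    have e: "wexp w' = \<alpha>" by (simp add: w'_def \<alpha> \<epsilon>_def add_ac)
    have "weight w' < weight w" using ij(1) by (simp add: w'_def weq weight_append)
    then have "(w', w) \<in> measures [\<lambda>w. rank (wexp w), weight]" using e by (simp add: \<alpha>_def)
    moreover have "set w' \<subseteq> {..<N}" using uvN ij by (simp add: w'_def)
    ultimately obtain k where k: "k \<noteq> 0" "wprod w' - k *s mon \<alpha> \<in> below \<alpha>" using IH[of w'] e by blast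
    have "wprod w = wprod u * (x j * x i) * wprod v" by (simp add: weq mult.assoc)
    also have "\<dots> = c *s wprod w' + wprod u * p * wprod v"
      by (simp add: c(2) w'_def distrib_left distrib_right scale_mult_left scale_mult_right mult.assoc)
    finally have "wprod w - (c * k) *s mon \<alpha> = c *s (wprod w' - k *s mon \<alpha>) + wprod u * p * wprod v"
      by (simp add: scale_right_diff_distrib)
    also have "\<dots> \<in> below \<alpha>" by (intro subspace_add[OF V] subspace_scale[OF V] k(2) up)
    finally show ?thesis using c(1) k(1) by (intro exI[of _ "c * k"]) (simp add: \<alpha>_def)
  qed
qed

lemma mon_mult:
  assumes "\<alpha> \<in> exps N" "\<beta> \<in> exps N"
  shows "\<exists>c. c \<noteq> 0 \<and> mon \<alpha> * mon \<beta> - c *s mon (\<alpha> + \<beta>) \<in> below (\<alpha> + \<beta>)"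
proof -
  obtain u where u: "set u \<subseteq> {..<N}" "wprod u = mon \<alpha>" "wexp u = \<alpha>" using ex_word[OF assms(1)] by blast
  obtain v where v: "set v \<subseteq> {..<N}" "wprod v = mon \<beta>" "wexp v = \<beta>" using ex_word[OF assms(2)] by blast
  show ?thesis using straighten[of "u @ v"] u v by simp
qed

lemma mon_mult_supported:
  assumes "\<alpha> \<in> exps N" "\<beta> \<in> exps N"
  shows "mon \<alpha> * mon \<beta> \<in> supported (\<lambda>\<gamma>. exp_size \<gamma> = exp_size \<alpha> + exp_size \<beta> \<and> (\<gamma>, \<alpha> + \<beta>) \<in> r)"
    (is "_ \<in> ?V")
proof -
  obtain c where c: "mon \<alpha> * mon \<beta> - c *s mon (\<alpha> + \<beta>) \<in> below (\<alpha> + \<beta>)"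
    using mon_mult[OF assms] by blast
  have V: "subspace ?V" by (rule subspace_supported)
  have "mon \<alpha> * mon \<beta> - c *s mon (\<alpha> + \<beta>) \<in> ?V"
    using c by (rule supported_mono) (simp add: lt_def)
  moreover have "c *s mon (\<alpha> + \<beta>) \<in> ?V"
    using assms by (intro subspace_scale[OF V] mon_supported) (simp_all add: ord_refl)
  ultimately have "mon \<alpha> * mon \<beta> - c *s mon (\<alpha> + \<beta>) + c *s mon (\<alpha> + \<beta>) \<in> ?V"
    by (rule subspace_add[OF V])
  then show ?thesis by simp
qed

lemma mult_in_component:
  assumes "f \<in> component s" "g \<in> component t"
  shows "f * g \<in> component (s + t)"
proof (rule mult_in_subspace[OF subspace_component])
  fix \<alpha> \<beta> assume "\<alpha> \<in> supp f" "\<beta> \<in> supp g"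
  then have "\<alpha> \<in> exps N" "\<beta> \<in> exps N" "exp_size \<alpha> = s" "exp_size \<beta> = t"
    using assms by (simp_all add: component_eq_supported supported_def supp_exps)
  then show "mon \<alpha> * mon \<beta> \<in> component (s + t)"
    using mon_mult_supported[of \<alpha> \<beta>] by (simp add: component_eq_supported supported_def)
qed

lemma minus_leading_term:
  assumes "f \<noteq> 0"
  shows "f - coeff f (lm f) *s mon (lm f) \<in> supported (\<lambda>\<gamma>. \<gamma> \<in> supp f \<and> lt \<gamma> (lm f))"
proof -
  have "\<gamma> \<in> supp f \<and> lt \<gamma> (lm f)" if g: "\<gamma> \<in> supp (f - coeff f (lm f) *s mon (lm f))" for \<gamma>
  proof -
    have c: "coeff f \<gamma> - coeff f (lm f) * coeff (mon (lm f)) \<gamma> \<noteq> 0" "\<gamma> \<in> exps N"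
      using g by (simp_all add: supp_def)
    have "\<gamma> \<noteq> lm f" using c lm_exps[OF assms] by (auto simp: coeff_mon)
    then have "\<gamma> \<in> supp f" using c lm_exps[OF assms] by (simp add: coeff_mon supp_def)
    then show ?thesis using lm_greatest(2)[OF assms] \<open>\<gamma> \<noteq> lm f\<close> by (simp add: lt_def)
  qed
  then show ?thesis by (simp add: supported_def)
qed

text \<open>Both factors are split into leading term and rest. Every product involving a rest, and
  the correction in the product of the leading monomials, lies strictly below \<alpha> + \<beta>,
  whose coefficient is a product of nonzero scalars. In particular there are no zero
  divisors.\<close>

lemma lm_mult:
  assumes "f \<noteq> 0" "g \<noteq> 0"
  shows "f * g \<noteq> 0" "lm (f * g) = lm f + lm g"
proof -
  define \<alpha> \<beta> where "\<alpha> = lm f" and "\<beta> = lm g"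
  define V where "V = supported (\<lambda>\<gamma>. lt \<gamma> (\<alpha> + \<beta>))"
  have V: "subspace V" unfolding V_def by (rule subspace_supported)
  have ab: "\<alpha> \<in> exps N" "\<beta> \<in> exps N" using assms lm_exps by (simp_all add: \<alpha>_def \<beta>_def)
  define a b where "a = coeff f \<alpha>" and "b = coeff g \<beta>"
  have nz: "a \<noteq> 0" "b \<noteq> 0" using lm_greatest(1)[OF assms(1)] lm_greatest(1)[OF assms(2)]
    by (simp_all add: a_def b_def \<alpha>_def \<beta>_def supp_def)
  define f' g' where "f' = f - a *s mon \<alpha>" and "g' = g - b *s mon \<beta>"
  have f': "\<And>\<gamma>. \<gamma> \<in> supp f' \<Longrightarrow> \<gamma> \<in> supp f \<and> lt \<gamma> \<alpha>"
    using minus_leading_term[OF assms(1)] by (simp add: f'_def a_def \<alpha>_def supported_def)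
  have g': "\<And>\<gamma>. \<gamma> \<in> supp g' \<Longrightarrow> \<gamma> \<in> supp g \<and> lt \<gamma> \<beta>"
    using minus_leading_term[OF assms(2)] by (simp add: g'_def b_def \<beta>_def supported_def)
  have in_V: "mon \<gamma> * mon \<delta> \<in> V" if "\<gamma> \<in> exps N" "\<delta> \<in> exps N" "lt (\<gamma> + \<delta>) (\<alpha> + \<beta>)" for \<gamma> \<delta>
    unfolding V_def using mon_mult_supported[OF that(1,2)]
    by (rule supported_mono) (use le_lt_trans[OF _ that(3)] in simp)
  have 1: "f' * g \<in> V"
  proof (rule mult_in_subspace[OF V])
    fix \<gamma> \<delta> assume gd: "\<gamma> \<in> supp f'" "\<delta> \<in> supp g"
    have "lt (\<gamma> + \<delta>) (\<alpha> + \<beta>)"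
      using f'[OF gd(1)] lm_greatest(2)[OF assms(2) gd(2)] by (intro lt_add_mono) (simp_all add: \<beta>_def)
    then show "mon \<gamma> * mon \<delta> \<in> V" using gd supp_exps by (intro in_V) auto
  qed
  have 2: "mon \<alpha> * g' \<in> V"
  proof (rule mult_in_subspace[OF V])
    fix \<gamma> \<delta> assume "\<gamma> \<in> supp (mon \<alpha>)" and d: "\<delta> \<in> supp g'"
    then have \<gamma>: "\<gamma> = \<alpha>" using ab by simp
    have "lt (\<delta> + \<alpha>) (\<beta> + \<alpha>)" using g'[OF d] ab by (intro lt_add) simp_all
    then show "mon \<gamma> * mon \<delta> \<in> V"
      unfolding \<gamma> using ab supp_exps[OF d] by (intro in_V) (simp_all add: add.commute)
  qed
  obtain c where c: "c \<noteq> 0" "mon \<alpha> * mon \<beta> - c *s mon (\<alpha> + \<beta>) \<in> below (\<alpha> + \<beta>)"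
    using mon_mult[OF ab] by blast
  have 3: "mon \<alpha> * mon \<beta> - c *s mon (\<alpha> + \<beta>) \<in> V"
    unfolding V_def using c(2) by (rule supported_mono) simp
  have "f * g = (a *s mon \<alpha>) * g + f' * g" by (simp add: f'_def left_diff_distrib)
  also have "(a *s mon \<alpha>) * g = a *s (mon \<alpha> * (b *s mon \<beta> + g'))"
    by (simp add: g'_def scale_mult_left)
  also have "\<dots> = (a * b) *s (mon \<alpha> * mon \<beta>) + a *s (mon \<alpha> * g')"
    by (simp add: distrib_left scale_mult_right scale_right_distrib)
  finally have "f * g - (a * b * c) *s mon (\<alpha> + \<beta>) =
      (a * b) *s (mon \<alpha> * mon \<beta> - c *s mon (\<alpha> + \<beta>)) + a *s (mon \<alpha> * g') + f' * g"
    by (simp add: scale_right_diff_distrib)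
  also have "\<dots> \<in> V" by (intro subspace_add[OF V] subspace_scale[OF V] 1 2 3)
  finally have d: "\<And>\<gamma>. \<gamma> \<in> supp (f * g - (a * b * c) *s mon (\<alpha> + \<beta>)) \<Longrightarrow> lt \<gamma> (\<alpha> + \<beta>)"
    by (simp add: V_def supported_def)
  have "coeff (f * g) (\<alpha> + \<beta>) = a * b * c"
  proof -
    have "\<alpha> + \<beta> \<notin> supp (f * g - (a * b * c) *s mon (\<alpha> + \<beta>))" using d[of "\<alpha> + \<beta>"] by auto
    then show ?thesis using ab by (simp add: supp_def coeff_mon)
  qed
  then have s: "\<alpha> + \<beta> \<in> supp (f * g)" using nz c(1) ab by (simp add: supp_def)
  then show "f * g \<noteq> 0" by (auto simp: supp_def)
  show "lm (f * g) = lm f + lm g"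
    unfolding \<alpha>_def[symmetric] \<beta>_def[symmetric]
  proof (rule lm_eqI[OF s])
    fix \<gamma> assume g: "\<gamma> \<in> supp (f * g)"
    show "(\<gamma>, \<alpha> + \<beta>) \<in> r"
    proof (cases "\<gamma> = \<alpha> + \<beta>")
      case True
      then show ?thesis using ab by (simp add: ord_refl)
    next
      case False
      then have "\<gamma> \<in> supp (f * g - (a * b * c) *s mon (\<alpha> + \<beta>))"
        using g ab by (simp add: supp_def coeff_mon)
      then show ?thesis using d by (simp add: lt_def)
    qed
  qed
qed

end

section \<open>Homogeneous left ideals\<close>

definition shift :: "nat \<Rightarrow> cones \<Rightarrow> cones" where
  "shift e P = image_mset (\<lambda>(a, m). (a + e, m)) P"

lemma in_shift: "(a, m) \<in># shift e P \<longleftrightarrow> (\<exists>a0. a = a0 + e \<and> (a0, m) \<in># P)"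
  by (auto simp: shift_def)

lemma hilb_shift: "hilb (shift e P) t = (if t < e then 0 else hilb P (t - e))"
proof (induction P)
  case (add p P)
  obtain a m where p: "p = (a, m)" by (cases p)
  have "cone_count (a + e) m t = (if t < e then 0 else cone_count a m (t - e))"
  proof (cases "t < e")
    case False
    have 1: "(t < a + e) = (t - e < a)" and 2: "t - (a + e) = t - e - a" using False by arith+
    show ?thesis unfolding cone_count_def 1 2 using False by simp
  qed (simp add: cone_count_def)
  then show ?case using add by (simp add: p shift_def)
qed (simp add: shift_def)

lemma standard_shift:
  assumes "standard c P"
  shows "standard (c + e) (shift e P)"
proof (rule standardI)
  fix a m assume "(a, m) \<in># shift e P" and m: "0 < m"
  then obtain a0 where a0: "a = a0 + e" "(a0, m) \<in># P" by (auto simp: in_shift)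
  from standardD(1)[OF assms a0(2) m] show "c + e \<le> a" using a0(1) by simp
next
  fix a m b assume "(a, m) \<in># shift e P" and m: "0 < m" and b: "c + e \<le> b" "b \<le> a"
  then obtain a0 where a0: "a = a0 + e" "(a0, m) \<in># P" by (auto simp: in_shift)
  have "c \<le> b - e" "b - e \<le> a0" using a0(1) b by simp_all
  from standardD(2)[OF assms a0(2) m this] obtain m' where m': "m' \<ge> m" "(b - e, m') \<in># P" by blast
  have "b = (b - e) + e" using b(1) by simp
  then have "(b, m') \<in># shift e P" using m'(2) unfolding in_shift by blast
  then show "\<exists>m'\<ge>m. (b, m') \<in># shift e P" using m'(1) by blast
qed

lemma dim_le_shift: "dim_le n P \<Longrightarrow> dim_le n (shift e P)"
  unfolding dim_le_def shift_def by auto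

lemma dim_le_union: "dim_le n P \<Longrightarrow> dim_le n Q \<Longrightarrow> dim_le n (P + Q)"
  by (auto simp: dim_le_def)

lemma left_ideal_hull: "left_ideal (left_ideal hull A)"
  by (rule hull_in) (auto simp: left_ideal_def)

lemma left_ideal_uminus:
  assumes "left_ideal I" "a \<in> I"
  shows "- a \<in> I"
proof -
  have "(- 1) * a \<in> I" using assms unfolding left_ideal_def by blast
  then show ?thesis by simp
qed

definition extend_ideal :: "'r::ring_1 set \<Rightarrow> 'r \<Rightarrow> 'r set" where
  "extend_ideal I f = {g + s * f | g s. g \<in> I}"

lemma left_ideal_extend:
  assumes "left_ideal I"
  shows "left_ideal (extend_ideal I f)"
  unfolding left_ideal_def
proof (intro conjI ballI allI)
  have "0 = 0 + 0 * f" "0 \<in> I" using assms by (simp_all add: left_ideal_def)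
  then show "0 \<in> extend_ideal I f" unfolding extend_ideal_def by blast
next
  fix a b assume "a \<in> extend_ideal I f" "b \<in> extend_ideal I f"
  then obtain g s g' s' where *: "a = g + s * f" "g \<in> I" "b = g' + s' * f" "g' \<in> I"
    by (auto simp: extend_ideal_def)
  have "a + b = (g + g') + (s + s') * f" by (simp add: * distrib_right add_ac)
  moreover have "g + g' \<in> I" using assms * by (simp add: left_ideal_def)
  ultimately show "a + b \<in> extend_ideal I f" unfolding extend_ideal_def by blast
next
  fix q a assume "a \<in> extend_ideal I f"
  then obtain g s where *: "a = g + s * f" "g \<in> I" by (auto simp: extend_ideal_def)
  have "q * a = q * g + (q * s) * f" by (simp add: * distrib_left mult.assoc)
  moreover have "q * g \<in> I" using assms * by (simp add: left_ideal_def)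
  ultimately show "q * a \<in> extend_ideal I f" unfolding extend_ideal_def by blast
qed

lemma hull_insert_left_ideal:
  "left_ideal hull (insert f A) = extend_ideal (left_ideal hull A) f"
proof (rule hull_unique)
  have zero: "0 \<in> left_ideal hull A" using left_ideal_hull[of A] by (simp add: left_ideal_def)
  show "insert f A \<subseteq> extend_ideal (left_ideal hull A) f"
  proof
    fix a assume "a \<in> insert f A"
    then consider "a = f" | "a \<in> A" by blast
    then show "a \<in> extend_ideal (left_ideal hull A) f"
    proof cases
      case 1
      then have "a = 0 + 1 * f" by simp
      then show ?thesis using zero unfolding extend_ideal_def by blast
    next
      case 2
      then have "a = a + 0 * f" "a \<in> left_ideal hull A" by (simp_all add: hull_inc)
      then show ?thesis unfolding extend_ideal_def by blast
    qed
  qed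
  show "left_ideal (extend_ideal (left_ideal hull A) f)"
    by (rule left_ideal_extend[OF left_ideal_hull])
next
  fix T assume T: "insert f A \<subseteq> T" "left_ideal T"
  have "left_ideal hull A \<subseteq> T" by (rule hull_minimal) (use T in auto)
  then show "extend_ideal (left_ideal hull A) f \<subseteq> T"
    using T by (auto simp: extend_ideal_def left_ideal_def)
qed

lemma hull_empty_left_ideal: "left_ideal hull {} = {0}"
  by (rule hull_unique) (auto simp: left_ideal_def)

context homogeneous_solvable_algebra
begin

section \<open>Homogeneous parts and homogeneous left ideals\<close>

definition part :: "nat \<Rightarrow> 'b \<Rightarrow> 'b" where
  "part t f = (\<Sum>\<alpha>\<in>{\<alpha> \<in> supp f. exp_size \<alpha> = t}. coeff f \<alpha> *s mon \<alpha>)"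

lemma coeff_part:
  assumes "\<alpha> \<in> exps N"
  shows "coeff (part t f) \<alpha> = (if exp_size \<alpha> = t then coeff f \<alpha> else 0)"
proof -
  let ?A = "{\<alpha> \<in> supp f. exp_size \<alpha> = t}"
  have A: "finite ?A" "?A \<subseteq> exps N" using supp_exps by auto
  show ?thesis
  proof (cases "\<alpha> \<in> ?A")
    case True
    then show ?thesis using supp_sum_mon(2)[OF A True, of "coeff f"] by (simp add: part_def)
  next
    case False
    then have "\<alpha> \<notin> supp (part t f)" using supp_sum_mon(1)[OF A, of "coeff f"] by (auto simp: part_def)
    then show ?thesis using assms False by (auto simp: supp_def)
  qed
qed

lemma supp_part: "supp (part t f) = {\<alpha> \<in> supp f. exp_size \<alpha> = t}"
  by (auto simp: supp_def coeff_part split: if_splits)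

lemma part_in_component: "part t f \<in> component t"
  by (simp add: component_eq_supported supported_def supp_part)

lemma part_add: "part t (f + g) = part t f + part t g"
  by (rule coeff_eqI) (simp add: coeff_part)

lemma part_eq_0: "(\<And>\<alpha>. \<alpha> \<in> supp f \<Longrightarrow> exp_size \<alpha> \<noteq> t) \<Longrightarrow> part t f = 0"
  using supp_empty_iff[of "part t f"] by (auto simp: supp_part)

lemma part_component_self:
  assumes "f \<in> component t"
  shows "part t f = f"
proof (rule coeff_eqI)
  fix \<alpha> assume a: "\<alpha> \<in> exps N"
  have "coeff f \<alpha> = 0" if "exp_size \<alpha> \<noteq> t"
    using assms a that by (auto simp: component_eq_supported supported_def supp_def)
  then show "coeff (part t f) \<alpha> = coeff f \<alpha>" using a by (simp add: coeff_part)
qed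

lemma mult_supported_size:
  assumes "\<And>\<alpha>. \<alpha> \<in> supp g \<Longrightarrow> P (exp_size \<alpha> + e)" "f \<in> component e"
  shows "g * f \<in> supported (\<lambda>\<gamma>. P (exp_size \<gamma>))"
proof (rule mult_in_subspace[OF subspace_supported])
  fix \<alpha> \<beta> assume ab: "\<alpha> \<in> supp g" "\<beta> \<in> supp f"
  have "exp_size \<beta> = e" using assms(2) ab by (simp add: component_eq_supported supported_def)
  then show "mon \<alpha> * mon \<beta> \<in> supported (\<lambda>\<gamma>. P (exp_size \<gamma>))"
    using mon_mult_supported[OF supp_exps[OF ab(1)] supp_exps[OF ab(2)]] assms(1)[OF ab(1)]
    by (auto simp: supported_def)
qed

text \<open>Right multiplication by a homogeneous element of degree \<open>e\<close> raises all
  degrees by \<open>e\<close>. This makes colon ideals and extensions by such an element homogeneous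
  again.\<close>

lemma part_mult:
  assumes "f \<in> component e"
  shows "part t (g * f) = (if e \<le> t then part (t - e) g * f else 0)"
proof (cases "e \<le> t")
  case True
  define g' where "g' = g - part (t - e) g"
  have "exp_size \<alpha> + e \<noteq> t" if "\<alpha> \<in> supp g'" for \<alpha>
    using that by (auto simp: g'_def supp_def coeff_part split: if_splits)
  then have "g' * f \<in> supported (\<lambda>\<gamma>. exp_size \<gamma> \<noteq> t)"
    by (intro mult_supported_size[where P = "\<lambda>k. k \<noteq> t", OF _ assms])
  then have 1: "part t (g' * f) = 0" by (intro part_eq_0) (simp add: supported_def)
  have "part (t - e) g * f \<in> component t"
    using mult_in_component[OF part_in_component assms, of "t - e" g] True by simp
  then have 2: "part t (part (t - e) g * f) = part (t - e) g * f" by (rule part_component_self)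
  have "g * f = part (t - e) g * f + g' * f" by (simp add: g'_def left_diff_distrib)
  then have "part t (g * f) = part t (part (t - e) g * f) + part t (g' * f)"
    by (simp only: part_add)
  then show ?thesis using 1 2 True by simp
next
  case False
  have "g * f \<in> supported (\<lambda>\<gamma>. e \<le> exp_size \<gamma>)"
    by (rule mult_supported_size[where P = "\<lambda>k. e \<le> k", OF _ assms]) simp
  then have "part t (g * f) = 0" using False by (intro part_eq_0) (auto simp: supported_def)
  then show ?thesis using False by simp
qed

definition homogeneous_ideal :: "'b set \<Rightarrow> bool" where
  "homogeneous_ideal I \<longleftrightarrow> left_ideal I \<and> (\<forall>f\<in>I. \<forall>t. part t f \<in> I)"

lemma homogeneous_idealD:
  assumes "homogeneous_ideal I"
  shows "left_ideal I" "f \<in> I \<Longrightarrow> part t f \<in> I" "0 \<in> I" "f \<in> I \<Longrightarrow> g \<in> I \<Longrightarrow> f + g \<in> I"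
    "f \<in> I \<Longrightarrow> g * f \<in> I"
  using assms by (auto simp: homogeneous_ideal_def left_ideal_def)

lemma subspace_left_ideal:
  assumes "left_ideal I"
  shows "subspace I"
proof (rule subspaceI)
  fix c f assume "f \<in> I"
  then have "(c *s 1) * f \<in> I" using assms by (simp only: left_ideal_def)
  then show "c *s f \<in> I" by (simp add: scale_mult_left)
qed (use assms in \<open>simp_all add: left_ideal_def\<close>)

lemma subspace_homogeneous_part: "homogeneous_ideal I \<Longrightarrow> subspace (I \<inter> component t)"
  by (intro subspace_inter subspace_left_ideal subspace_component homogeneous_idealD(1))

section \<open>Leading exponents and dimensions\<close>

definition lms :: "'b set \<Rightarrow> (nat \<Rightarrow>\<^sub>0 nat) set" where
  "lms V = lm ` (V - {0})"

lemma lms_exps: "lms V \<subseteq> exps N"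
  using lm_exps by (auto simp: lms_def)

lemma lmsI: "f \<in> V \<Longrightarrow> f \<noteq> 0 \<Longrightarrow> lm f \<in> lms V"
  by (auto simp: lms_def)

text \<open>The largest exponent of \<open>g\<close> lying in \<open>lms V\<close> is cancelled by a
  scalar multiple of an element of \<open>V\<close>. This brings in smaller exponents of the same
  degree only, so the ranks of the exponents still to be cancelled drop.\<close>

lemma reduction:
  assumes V: "subspace V" "V \<subseteq> component s" and g: "g \<in> component s"
  shows "\<exists>h\<in>V. supp (g - h) \<inter> lms V = {}"
proof -
  have "\<exists>h\<in>V. supp (g - h) \<inter> lms V = {}"
    if "g \<in> component s" "\<And>\<alpha>. \<alpha> \<in> supp g \<inter> lms V \<Longrightarrow> rank \<alpha> < n" for g n
    using that
  proof (induction n arbitrary: g)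
    case 0
    then have "supp (g - 0) \<inter> lms V = {}" by auto
    then show ?case using subspace_0[OF V(1)] by blast
  next
    case (Suc n)
    show ?case
    proof (cases "supp g \<inter> lms V = {}")
      case True
      then have "supp (g - 0) \<inter> lms V = {}" by simp
      then show ?thesis using subspace_0[OF V(1)] by blast
    next
      case False
      have "finite (supp g \<inter> lms V)" "supp g \<inter> lms V \<subseteq> exps N" using lms_exps by auto
      from ex_max[OF this(1) False this(2)] obtain \<mu> where
        m: "\<mu> \<in> supp g" "\<mu> \<in> lms V" "\<forall>\<beta>\<in>supp g \<inter> lms V. (\<beta>, \<mu>) \<in> r" by blast
      obtain b where b: "b \<in> V" "b \<noteq> 0" "lm b = \<mu>" using m(2) by (auto simp: lms_def)
      have bm: "coeff b \<mu> \<noteq> 0" using lm_greatest(1)[OF b(2)] b(3) by (simp add: supp_def)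
      define c where "c = coeff g \<mu> / coeff b \<mu>"
      define g' where "g' = g - c *s b"
      have cb: "c *s b \<in> V" using b(1) by (rule subspace_scale[OF V(1)])
      have g': "g' \<in> component s"
        unfolding g'_def using Suc.prems(1) cb V(2) by (intro subspace_diff[OF subspace_component]) auto
      have "rank \<alpha> < n" if a: "\<alpha> \<in> supp g' \<inter> lms V" for \<alpha>
      proof -
        have "coeff g' \<mu> = 0" using bm by (simp add: g'_def c_def)
        then have ne: "\<alpha> \<noteq> \<mu>" using a by (auto simp: supp_def)
        have "\<alpha> \<in> supp g \<or> \<alpha> \<in> supp b" using a supp_diff[of g "c *s b"] supp_scale[of c b]
          by (auto simp: g'_def)
        then have "(\<alpha>, \<mu>) \<in> r" using m(3) a lm_greatest(2)[OF b(2), of \<alpha>] b(3) by auto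
        then have l: "lt \<alpha> \<mu>" using ne by (simp add: lt_def)
        have "exp_size \<alpha> = s" using a g' by (simp add: component_eq_supported supported_def)
        moreover have "exp_size \<mu> = s" using m(1) Suc.prems(1) by (simp add: component_eq_supported supported_def)
        ultimately have "rank \<alpha> < rank \<mu>" using rank_mono[OF l] by simp
        moreover have "rank \<mu> < Suc n" using Suc.prems(2) m by blast
        ultimately show ?thesis by simp
      qed
      from Suc.IH[OF g' this] obtain h where h: "h \<in> V" "supp (g' - h) \<inter> lms V = {}" by blast
      have eq: "g - (h + c *s b) = g' - h" by (simp add: g'_def)
      have "supp (g - (h + c *s b)) \<inter> lms V = {}" unfolding eq by (rule h(2))
      moreover have "h + c *s b \<in> V" using h(1) cb by (rule subspace_add[OF V(1)])
      ultimately show ?thesis by blast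
    qed
  qed
  from this[OF g, of "Suc (Max (rank ` supp g))"] show ?thesis by (simp add: less_Suc_eq_le)
qed

text \<open>In a linear relation, the largest leading exponent among the terms with nonzero
  coefficient occurs in one of these terms only.\<close>

lemma independent_distinct_lm:
  assumes "finite B" "0 \<notin> B" "inj_on lm B"
  shows "independent B"
proof
  assume "dependent B"
  then obtain u v where u: "v \<in> B" "u v \<noteq> 0" "(\<Sum>b\<in>B. u b *s b) = 0"
    using dependent_finite[OF assms(1)] by blast
  define T where "T = {b \<in> B. u b \<noteq> 0}"
  have nz: "b \<noteq> 0" if "b \<in> B" for b using that assms(2) by auto
  have "finite (lm ` T)" "lm ` T \<noteq> {}" "lm ` T \<subseteq> exps N"
    using assms(1) u nz lm_exps by (auto simp: T_def)
  from ex_max[OF this] obtain b0 where b0: "b0 \<in> T" "\<forall>b\<in>T. (lm b, lm b0) \<in> r" by auto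
  then have b0B: "b0 \<in> B" by (simp add: T_def)
  have rest: "u b * coeff b (lm b0) = 0" if b: "b \<in> B - {b0}" for b
  proof (rule ccontr)
    assume ne: "u b * coeff b (lm b0) \<noteq> 0"
    then have bT: "b \<in> T" using b by (auto simp: T_def)
    have "lm b0 \<in> supp b" using ne lm_exps[OF nz[OF b0B]] by (simp add: supp_def)
    then have "(lm b0, lm b) \<in> r" using b nz by (intro lm_greatest(2)) auto
    then have "lm b = lm b0" using b0(2) bT by (intro ord_antisym) auto
    then show False using inj_onD[OF assms(3)] b b0B by auto
  qed
  have "(\<Sum>b\<in>B - {b0}. u b * coeff b (lm b0)) = 0" by (rule sum.neutral) (use rest in blast)
  then have "coeff (\<Sum>b\<in>B. u b *s b) (lm b0) = u b0 * coeff b0 (lm b0)"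
    by (simp add: coeff_sum sum.remove[OF assms(1) b0B])
  moreover have "u b0 \<noteq> 0" "coeff b0 (lm b0) \<noteq> 0"
    using b0(1) lm_greatest(1)[OF nz[OF b0B]] by (simp_all add: T_def supp_def)
  ultimately show False using u(3) by simp
qed

lemma finite_lms_component: "V \<subseteq> component s \<Longrightarrow> finite (lms V)"
proof (rule finite_subset[OF _ finite_exps_size[of N s]])
  assume V: "V \<subseteq> component s"
  have "exp_size (lm f) = s" if "f \<in> V" "f \<noteq> 0" for f
    using lm_greatest(1)[OF that(2)] V that(1) by (auto simp: component_eq_supported supported_def)
  then show "lms V \<subseteq> {\<alpha> \<in> exps N. exp_size \<alpha> = s}" using lm_exps by (auto simp: lms_def)
qed

text \<open>One element is chosen for each leading exponent. These are independent as their leading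
  exponents differ, and they span since a reduced remainder in \<open>V\<close> has no admissible
  leading exponent.\<close>

lemma card_lms_eq_dim:
  assumes V: "subspace V" "V \<subseteq> component s"
  shows "card (lms V) = dim V"
proof -
  have "\<forall>\<alpha>\<in>lms V. \<exists>b. b \<in> V \<and> b \<noteq> 0 \<and> lm b = \<alpha>" by (auto simp: lms_def)
  from bchoice[OF this] obtain b where b: "\<And>\<alpha>. \<alpha> \<in> lms V \<Longrightarrow> b \<alpha> \<in> V \<and> b \<alpha> \<noteq> 0 \<and> lm (b \<alpha>) = \<alpha>"
    by blast
  define B where "B = b ` lms V"
  have inj: "inj_on b (lms V)" using b by (metis inj_onI)
  have BV: "B \<subseteq> V" using b by (auto simp: B_def)
  have WV: "span B \<subseteq> V" using BV V(1) by (rule span_minimal)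
  \<comment> \<open>The reduction takes place modulo \<open>span B\<close>, so it must be known to
    remove every leading exponent of \<open>V\<close>.\<close>
  have LW: "lms V \<subseteq> lms (span B)"
  proof
    fix \<alpha> assume a: "\<alpha> \<in> lms V"
    then have "b \<alpha> \<in> span B" by (simp add: B_def span_base)
    then show "\<alpha> \<in> lms (span B)" using lmsI[of "b \<alpha>" "span B"] b[OF a] by simp
  qed
  have "V \<subseteq> span B"
  proof
    fix v assume v: "v \<in> V"
    then obtain h where h: "h \<in> span B" "supp (v - h) \<inter> lms (span B) = {}"
      using reduction[of "span B" s v] WV V(2) by auto
    have "v - h \<in> V" using v h(1) WV by (intro subspace_diff[OF V(1)]) auto
    then have "v - h = 0" using lm_greatest(1)[of "v - h"] lmsI[of "v - h" V] LW h(2) by blast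
    then show "v \<in> span B" using h(1) by simp
  qed
  moreover have "independent B"
  proof (rule independent_distinct_lm)
    show "finite B" using finite_lms_component[OF V(2)] by (simp add: B_def)
    show "0 \<notin> B" using b by (auto simp: B_def)
    show "inj_on lm B" using b by (auto simp: B_def inj_on_def)
  qed
  moreover have "card B = card (lms V)" unfolding B_def by (rule card_image[OF inj])
  ultimately show ?thesis using dim_unique[OF BV] by simp
qed

definition hf :: "'b set \<Rightarrow> nat \<Rightarrow> nat" where
  "hf I t = card {\<alpha> \<in> lms I. exp_size \<alpha> = t}"

text \<open>Passing to the part in the degree of the leading exponent keeps that exponent and stays
  inside the ideal.\<close>

lemma lms_homogeneous_part:
  assumes "homogeneous_ideal I"
  shows "lms (I \<inter> component t) = {\<alpha> \<in> lms I. exp_size \<alpha> = t}"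
proof (intro set_eqI iffI)
  fix \<alpha> assume "\<alpha> \<in> lms (I \<inter> component t)"
  then obtain f where f: "f \<in> I" "f \<in> component t" "f \<noteq> 0" "\<alpha> = lm f" by (auto simp: lms_def)
  then show "\<alpha> \<in> {\<alpha> \<in> lms I. exp_size \<alpha> = t}"
    using lm_greatest(1)[OF f(3)] lmsI[OF f(1,3)] by (simp add: component_eq_supported supported_def)
next
  fix \<alpha> assume "\<alpha> \<in> {\<alpha> \<in> lms I. exp_size \<alpha> = t}"
  then obtain f where f: "f \<in> I" "f \<noteq> 0" "\<alpha> = lm f" "exp_size \<alpha> = t" by (auto simp: lms_def)
  have a: "\<alpha> \<in> supp (part t f)" using lm_greatest(1)[OF f(2)] f(3,4) by (simp add: supp_part)
  then have nz: "part t f \<noteq> 0" by (auto simp: supp_def)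
  have "lm (part t f) = \<alpha>"
    by (rule lm_eqI[OF a]) (use lm_greatest(2)[OF f(2)] f(3) in \<open>simp add: supp_part\<close>)
  then show "\<alpha> \<in> lms (I \<inter> component t)"
    using lmsI[OF _ nz, of "I \<inter> component t"] homogeneous_idealD(2)[OF assms f(1)] part_in_component by simp
qed

lemma hf_eq_dim:
  assumes "homogeneous_ideal I"
  shows "hf I t = dim (I \<inter> component t)"
  unfolding hf_def lms_homogeneous_part[OF assms, symmetric]
  by (rule card_lms_eq_dim[OF subspace_homogeneous_part[OF assms] Int_lower2])

text \<open>Left multiplication by a monomial adds its exponent. Here a left ideal of
  \<open>R\<close> turns into a monomial ideal, to which the combinatorial decomposition
  applies.\<close>

lemma lms_upclosed:
  assumes "left_ideal I" "\<alpha> \<in> lms I" "\<beta> \<in> exps N" "exp_dvd \<alpha> \<beta>"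
  shows "\<beta> \<in> lms I"
proof -
  obtain f where f: "f \<in> I" "f \<noteq> 0" "\<alpha> = lm f" using assms(2) by (auto simp: lms_def)
  obtain \<gamma> where g: "\<beta> = \<alpha> + \<gamma>" using assms(4) by (auto simp: exp_dvd_iff)
  then have ge: "\<gamma> \<in> exps N" using assms(3) by simp
  then have "supp (mon \<gamma>) = {\<gamma>}" by simp
  then have nz: "mon \<gamma> \<noteq> 0" by (metis insert_not_empty supp_empty_iff)
  have "mon \<gamma> * f \<in> I" using assms(1) f(1) by (simp add: left_ideal_def)
  then have "lm (mon \<gamma> * f) \<in> lms I" using lm_mult(1)[OF nz f(2)] by (rule lmsI)
  then show ?thesis using lm_mult(2)[OF nz f(2)] lm_mon[OF ge] g f(3) by (simp add: add.commute)
qed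

lemma lms_complement_decomposition:
  assumes "left_ideal I"
  shows "\<exists>P. (\<forall>t. hilb P t = card {\<beta> \<in> exps N - lms I. exp_size \<beta> = t}) \<and> standard 0 P \<and> dim_le N P \<and>
    (\<forall>\<alpha>\<in>lms I. (\<forall>\<beta>\<in>lms I. exp_dvd \<beta> \<alpha> \<longrightarrow> \<beta> = \<alpha>) \<longrightarrow> \<alpha> \<noteq> 0 \<longrightarrow>
       (\<exists>a m. (a, m) \<in># P \<and> exp_size \<alpha> \<le> Suc a))"
  by (rule complement_decomposition[OF lms_exps]) (rule lms_upclosed[OF assms])

section \<open>Adding one generator to a homogeneous left ideal\<close>

definition colon :: "'b set \<Rightarrow> 'b \<Rightarrow> 'b set" where
  "colon I f = {g. g * f \<in> I}"

lemma homogeneous_colon: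
  assumes I: "homogeneous_ideal I" and f: "f \<in> component e"
  shows "homogeneous_ideal (colon I f)"
  unfolding homogeneous_ideal_def
proof (intro conjI ballI allI)
  show "left_ideal (colon I f)"
    using homogeneous_idealD(1)[OF I]
    by (auto simp: left_ideal_def colon_def distrib_right mult.assoc)
next
  fix g t assume "g \<in> colon I f"
  then have "part (t + e) (g * f) \<in> I" using homogeneous_idealD(2)[OF I] by (simp add: colon_def)
  then show "part t g \<in> colon I f" by (simp add: part_mult[OF f] colon_def)
qed

lemma homogeneous_extend:
  assumes I: "homogeneous_ideal I" and f: "f \<in> component e"
  shows "homogeneous_ideal (extend_ideal I f)"
  unfolding homogeneous_ideal_def
proof (intro conjI ballI allI)
  show "left_ideal (extend_ideal I f)" by (rule left_ideal_extend[OF homogeneous_idealD(1)[OF I]])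
next
  fix v t assume "v \<in> extend_ideal I f"
  then obtain g s where v: "v = g + s * f" "g \<in> I" by (auto simp: extend_ideal_def)
  define s' where "s' = (if e \<le> t then part (t - e) s else 0)"
  have "part t v = part t g + s' * f" by (simp add: v(1) part_add part_mult[OF f] s'_def)
  then show "part t v \<in> extend_ideal I f"
    unfolding extend_ideal_def using homogeneous_idealD(2)[OF I v(2)] by blast
qed

text \<open>The left-linear map that multiplies by \<open>f\<close> on the right induces an
  isomorphism of R/(I:f) with (I + R f)/I which raises degrees by \<open>e\<close>. Concretely, a
  basis of the old part is completed by the products \<open>mon \<beta> * f\<close> with \<beta>
  outside the leading exponents of the colon ideal.\<close>

lemma hf_extend:
  assumes I: "homogeneous_ideal I" and f: "f \<in> component e" "f \<noteq> 0"
  shows "hf (extend_ideal I f) t = hf I t +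
    (if t < e then 0 else card {\<beta> \<in> exps N - lms (colon I f). exp_size \<beta> = t - e})"
proof -
  note I' = homogeneous_extend[OF I f(1)] and J = homogeneous_colon[OF I f(1)]
  define V V' where "V = I \<inter> component t" and "V' = extend_ideal I f \<inter> component t"
  have V: "subspace V" unfolding V_def by (rule subspace_homogeneous_part[OF I])
  have VI: "v \<in> V \<Longrightarrow> v \<in> I" for v by (simp add: V_def)
  have sub: "I \<subseteq> extend_ideal I f"
  proof
    fix g assume "g \<in> I"
    moreover have "g = g + 0 * f" by simp
    ultimately show "g \<in> extend_ideal I f" unfolding extend_ideal_def by blast
  qed
  have V'E: "\<exists>g s. v = part t g + (if e \<le> t then part (t - e) s * f else 0) \<and> part t g \<in> V" if vV': "v \<in> V'" for v
  proof -
    obtain g s where v: "v = g + s * f" "g \<in> I" using vV' by (auto simp: V'_def extend_ideal_def)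
    have "v = part t v" using vV' by (simp add: V'_def part_component_self)
    also have "\<dots> = part t g + (if e \<le> t then part (t - e) s * f else 0)"
      by (simp add: v(1) part_add part_mult[OF f(1)])
    finally show ?thesis
      using homogeneous_idealD(2)[OF I v(2)] part_in_component by (auto simp: V_def)
  qed
  have "dim V' = dim V + (if t < e then 0 else card {\<beta> \<in> exps N - lms (colon I f). exp_size \<beta> = t - e})"
  proof (cases "t < e")
    case True
    have "V' \<subseteq> V"
    proof
      fix v assume "v \<in> V'"
      from V'E[OF this] show "v \<in> V" using True by auto
    qed
    moreover have "V \<subseteq> V'" using sub by (auto simp: V_def V'_def)
    ultimately have "V' = V" by blast
    then show ?thesis using True by simp
  next
    case False
    define s where "s = t - e"
    define Nm where "Nm = {\<beta> \<in> exps N - lms (colon I f). exp_size \<beta> = s}"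
    define C where "C = (\<lambda>\<beta>. mon \<beta> * f) ` Nm"
    have finN: "finite Nm" unfolding Nm_def by (rule finite_subset[OF _ finite_exps_size[of N s]]) auto
    have NmN: "Nm \<subseteq> exps N" by (auto simp: Nm_def)
    \<comment> \<open>Such a \<rho> belongs to the colon ideal, so if nonzero it would have a
      leading exponent among those excluded from \<open>Nm\<close>. Independence of the enlarged
      basis rests on this.\<close>
    have normal: "\<rho> = 0" if "supp \<rho> \<subseteq> Nm" "\<rho> * f \<in> I" for \<rho>
    proof (rule ccontr)
      assume "\<rho> \<noteq> 0"
      then have "lm \<rho> \<in> supp \<rho>" "lm \<rho> \<in> lms (colon I f)"
        using that(2) lm_greatest(1) by (auto intro!: lmsI simp: colon_def)
      then show False using that(1) by (auto simp: Nm_def)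
    qed
    obtain B where B: "B \<subseteq> V" "independent B" "V \<subseteq> span B" "card B = dim V"
      by (rule basis_exists)
    have finB: "finite B"
    proof -
      have "B \<subseteq> span (mon ` {\<alpha> \<in> exps N. exp_size \<alpha> = t})" using B(1) by (auto simp: V_def component_def)
      from independent_span_bound[OF _ B(2) this] show ?thesis by simp
    qed
    have monN: "\<beta> \<in> Nm \<Longrightarrow> supp (mon \<beta>) = {\<beta>}" for \<beta> using NmN by auto
    have inj: "inj_on (\<lambda>\<beta>. mon \<beta> * f) Nm"
    proof (rule inj_onI)
      fix \<beta> \<gamma> assume bg: "\<beta> \<in> Nm" "\<gamma> \<in> Nm" "mon \<beta> * f = mon \<gamma> * f"
      have "(mon \<beta> - mon \<gamma>) * f \<in> I" using bg(3) homogeneous_idealD(3)[OF I] by (simp add: left_diff_distrib)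
      moreover have "supp (mon \<beta> - mon \<gamma>) \<subseteq> Nm" using supp_diff[of "mon \<beta>" "mon \<gamma>"] monN bg by auto
      ultimately have "mon \<beta> - mon \<gamma> = 0" by (intro normal)
      then show "\<beta> = \<gamma>" using inj_mon bg NmN by (auto dest: inj_onD)
    qed
    have disj: "B \<inter> C = {}"
    proof (rule ccontr)
      assume "B \<inter> C \<noteq> {}"
      then obtain \<beta> where b: "\<beta> \<in> Nm" "mon \<beta> * f \<in> B" by (auto simp: C_def)
      then have "mon \<beta> = 0" using normal[of "mon \<beta>"] monN B(1) VI by auto
      then show False using monN[OF b(1)] by (simp add: supp_def)
    qed
    have "independent (B \<union> C)"
    proof
      assume "dependent (B \<union> C)"
      then obtain u v where u: "v \<in> B \<union> C" "u v \<noteq> 0" "(\<Sum>b\<in>B \<union> C. u b *s b) = 0"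
        using dependent_finite[of "B \<union> C"] finB finN by (auto simp: C_def)
      define \<rho> where "\<rho> = (\<Sum>\<beta>\<in>Nm. u (mon \<beta> * f) *s mon \<beta>)"
      have "(\<Sum>c\<in>C. u c *s c) = \<rho> * f"
        unfolding C_def \<rho>_def sum.reindex[OF inj] by (simp add: sum_distrib_right scale_mult_left)
      moreover have "(\<Sum>b\<in>B \<union> C. u b *s b) = (\<Sum>b\<in>B. u b *s b) + (\<Sum>c\<in>C. u c *s c)"
        using finB finN disj by (intro sum.union_disjoint) (simp_all add: C_def)
      ultimately have sum0: "(\<Sum>b\<in>B. u b *s b) + \<rho> * f = 0" using u(3) by simp
      have "(\<Sum>b\<in>B. u b *s b) \<in> I"
        using subspace_left_ideal[OF homogeneous_idealD(1)[OF I]] B(1) VI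
        by (intro subspace_sum subspace_scale) auto
      moreover have "\<rho> * f = - (\<Sum>b\<in>B. u b *s b)" using sum0 by (simp add: eq_neg_iff_add_eq_0 add.commute)
      ultimately have "\<rho> * f \<in> I" using left_ideal_uminus[OF homogeneous_idealD(1)[OF I]] by simp
      then have r0: "\<rho> = 0" using supp_sum_mon(1)[OF finN NmN] by (intro normal) (simp_all add: \<rho>_def)
      have "u c = 0" if cC: "c \<in> C" for c
      proof -
        obtain \<beta> where b: "\<beta> \<in> Nm" "c = mon \<beta> * f" using cC by (auto simp: C_def)
        have "coeff \<rho> \<beta> = u (mon \<beta> * f)" unfolding \<rho>_def by (rule supp_sum_mon(2)[OF finN NmN b(1)])
        then show ?thesis using r0 b(2) by simp
      qed
      then have "v \<in> B" using u(1,2) by auto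
      moreover have "(\<Sum>b\<in>B. u b *s b) = 0" using sum0 r0 by simp
      ultimately show False using dependent_finite[OF finB] B(2) u(2) by blast
    qed
    moreover have "V' \<subseteq> span (B \<union> C)"
    proof
      fix v assume "v \<in> V'"
      from V'E[OF this] obtain g q where v: "v = part t g + part s q * f" "part t g \<in> V"
        using False by (auto simp: s_def)
      define \<rho> where "\<rho> = part s q"
      have JV: "subspace (colon I f \<inter> component s)" by (rule subspace_homogeneous_part[OF J])
      \<comment> \<open>The multiplier of \<open>f\<close> is reduced modulo the colon ideal. What
        is subtracted contributes an element of \<open>I\<close> after multiplication, and the
        remainder involves only exponents in \<open>Nm\<close>.\<close>
      from reduction[OF JV _ part_in_component[of s q]] obtain h where
        h: "h \<in> colon I f" "h \<in> component s" "supp (\<rho> - h) \<inter> lms (colon I f \<inter> component s) = {}"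
        by (auto simp: \<rho>_def)
      have "\<rho> - h \<in> component s"
        unfolding \<rho>_def by (rule subspace_diff[OF subspace_component part_in_component h(2)])
      then have sN: "supp (\<rho> - h) \<subseteq> Nm"
        using h(3) supp_exps unfolding lms_homogeneous_part[OF J]
        by (auto simp: Nm_def component_eq_supported supported_def)
      have hf: "h * f \<in> V"
        using h(1) mult_in_component[OF h(2) f(1)] False by (simp add: V_def colon_def s_def)
      have "part t g + h * f \<in> V" using v(2) hf by (rule subspace_add[OF V])
      then have 1: "part t g + h * f \<in> span (B \<union> C)" using B(3) span_mono[of B "B \<union> C"] by auto
      have "(\<rho> - h) * f = (\<Sum>\<beta>\<in>supp (\<rho> - h). coeff (\<rho> - h) \<beta> *s mon \<beta>) * f" by (simp only: expand)
      also have "\<dots> = (\<Sum>\<beta>\<in>supp (\<rho> - h). coeff (\<rho> - h) \<beta> *s (mon \<beta> * f))"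
        by (simp only: sum_distrib_right scale_mult_left)
      also have "\<dots> \<in> span (B \<union> C)"
        using sN by (intro span_sum span_scale span_base) (auto simp: C_def)
      finally have 2: "(\<rho> - h) * f \<in> span (B \<union> C)" .
      have "v = (part t g + h * f) + (\<rho> - h) * f" by (simp add: v(1) \<rho>_def left_diff_distrib)
      then show "v \<in> span (B \<union> C)" using span_add[OF 1 2] by simp
    qed
    moreover have "B \<union> C \<subseteq> V'"
    proof -
      have "mon \<beta> * f \<in> V'" if "\<beta> \<in> Nm" for \<beta>
      proof -
        have "mon \<beta> \<in> component s" using that monN[OF that] by (simp add: component_eq_supported supported_def Nm_def)
        from mult_in_component[OF this f(1)] have "mon \<beta> * f \<in> component t" using False by (simp add: s_def)
        moreover have "mon \<beta> * f = 0 + mon \<beta> * f" by simp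
        then have "mon \<beta> * f \<in> extend_ideal I f"
          unfolding extend_ideal_def using homogeneous_idealD(3)[OF I] by blast
        ultimately show ?thesis by (simp add: V'_def)
      qed
      moreover have "V \<subseteq> V'" using sub by (auto simp: V_def V'_def)
      ultimately show ?thesis using B(1) by (auto simp: C_def)
    qed
    moreover have "card (B \<union> C) = dim V + card Nm"
      using card_Un_disjoint[OF finB _ disj] finN card_image[OF inj] B(4) by (simp add: C_def)
    ultimately have "dim V' = dim V + card Nm" by (intro dim_unique)
    then show ?thesis using False by (simp add: Nm_def s_def)
  qed
  then show ?thesis by (simp add: hf_eq_dim[OF I] hf_eq_dim[OF I'] V_def V'_def)
qed

section \<open>Decomposition of the ideal and the degree bound\<close>

lemma card_exps_size: "card {\<beta> \<in> exps N. exp_size \<beta> = t} = cone_count 0 N t"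
  using card_orthant[of 0 N "{..<N}" t] by (simp add: orthant_all)

lemma hf_complement: "hf I t + card {\<beta> \<in> exps N - lms I. exp_size \<beta> = t} = cone_count 0 N t"
proof -
  let ?A = "{\<alpha> \<in> lms I. exp_size \<alpha> = t}" and ?B = "{\<beta> \<in> exps N - lms I. exp_size \<beta> = t}"
  have "finite ?A" "finite ?B"
    by (rule finite_subset[OF _ finite_exps_size[of N t]], use lms_exps in auto)+
  then have "card (?A \<union> ?B) = card ?A + card ?B" by (intro card_Un_disjoint) auto
  moreover have "?A \<union> ?B = {\<beta> \<in> exps N. exp_size \<beta> = t}" using lms_exps by auto
  ultimately show ?thesis by (simp add: hf_def card_exps_size)
qed

text \<open>The cones are not realised inside \<open>R\<close>: a new generator contributes the
  numerical decomposition of the complement of a colon ideal, shifted by the degree of the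
  generator. As this degree is at most \<open>d\<close>, the result can be pushed to a
  \<open>d\<close>-standard one.\<close>

lemma ideal_decomposition:
  assumes f0: "f0 \<noteq> 0" "f0 \<in> component d" and "finite F"
    and F: "\<And>f. f \<in> F \<Longrightarrow> f \<noteq> 0 \<and> (\<exists>e\<le>d. f \<in> component e)"
  shows "homogeneous_ideal (left_ideal hull (insert f0 F)) \<and>
    (\<exists>Q. standard d Q \<and> dim_le N Q \<and>
      (\<forall>t. hf (left_ideal hull (insert f0 F)) t = cone_count d N t + hilb Q t))"
  using assms(3) F
proof (induction F rule: finite_induct)
  case empty
  have zero: "homogeneous_ideal {0}"
    using part_eq_0[of 0] by (simp add: homogeneous_ideal_def left_ideal_def supp_def)
  have eq: "left_ideal hull {f0} = extend_ideal {0} f0"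
    by (simp add: hull_insert_left_ideal hull_empty_left_ideal)
  \<comment> \<open>Without zero divisors nothing annihilates \<open>f0\<close>, so R f0 counts as
    one full cone of degree \<open>d\<close>.\<close>
  have "colon {0} f0 \<subseteq> {0}" using lm_mult(1)[OF _ f0(1)] by (auto simp: colon_def)
  then have "lms (colon {0} f0) = {}" by (auto simp: lms_def)
  moreover have "hf {0} t = 0" for t by (simp add: hf_def lms_def)
  ultimately have "hf (left_ideal hull {f0}) t = cone_count d N t" for t
    unfolding eq hf_extend[OF zero f0(2,1)] by (simp add: card_exps_size) (simp add: cone_count_def)
  moreover have "standard d {#}" "dim_le N {#}" by (simp_all add: standard_def dim_le_def)
  ultimately show ?case
    using homogeneous_extend[OF zero f0(2)] unfolding eq by (intro conjI exI[of _ "{#}"]) simp_all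
next
  case (insert f F)
  define I where "I = left_ideal hull (insert f0 F)"
  have "homogeneous_ideal I \<and> (\<exists>Q. standard d Q \<and> dim_le N Q \<and> (\<forall>t. hf I t = cone_count d N t + hilb Q t))"
    unfolding I_def by (rule insert.IH) (use insert.prems in blast)
  then obtain Q where I: "homogeneous_ideal I" and Q: "standard d Q" "dim_le N Q"
    "\<And>t. hf I t = cone_count d N t + hilb Q t" by blast
  obtain e where e: "f \<noteq> 0" "e \<le> d" "f \<in> component e" using insert.prems by blast
  have eq: "left_ideal hull (insert f0 (insert f F)) = extend_ideal I f"
    by (simp add: I_def insert_commute[of f0] hull_insert_left_ideal)
  define J where "J = colon I f"
  have "left_ideal J" unfolding J_def by (rule homogeneous_idealD(1)[OF homogeneous_colon[OF I e(3)]])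
  from lms_complement_decomposition[OF this] obtain P where
    P: "\<forall>t. hilb P t = card {\<beta> \<in> exps N - lms J. exp_size \<beta> = t}" "standard 0 P" "dim_le N P"
    by (elim exE conjE) rule
  have "standard e (shift e P)" using standard_shift[OF P(2), of e] by simp
  from push_standard[OF this dim_le_shift[OF P(3)] e(2)] obtain P' where
    P': "standard d P'" "dim_le N P'" "hilb P' = hilb (shift e P)" by blast
  have "hf (extend_ideal I f) t = cone_count d N t + hilb (Q + P') t" for t
    by (simp add: hf_extend[OF I e(3,1)] Q(3) P'(3) hilb_shift P(1)[rule_format] J_def)
  then show ?case
    unfolding eq using homogeneous_extend[OF I e(3)] standard_union[OF Q(1) P'(1)] dim_le_union[OF Q(2) P'(2)]
    by blast
qed

text \<open>An exponent of \<open>g\<close> that is a multiple of some leading exponent of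
  \<open>I\<close> can only be a multiple of \<open>lm g\<close>, as the basis is reduced. This
  gives minimality, and homogeneity when applied to the terms of \<open>g\<close> of other
  degrees.\<close>

lemma reduced_groebner_basis_element:
  assumes I: "homogeneous_ideal I" and G: "reduced_groebner_basis G I" and g: "g \<in> G"
  shows "g \<noteq> 0" "degree g = exp_size (lm g)" "lm g \<in> lms I"
    "\<And>\<beta>. \<beta> \<in> lms I \<Longrightarrow> exp_dvd \<beta> (lm g) \<Longrightarrow> \<beta> = lm g"
proof -
  have gb: "groebner_basis G I"
    and rg: "\<forall>g\<in>G. lc g = 1 \<and> (\<forall>\<alpha>\<in>supp g. \<forall>g'\<in>G - {g}. g' \<noteq> 0 \<longrightarrow> \<not> exp_dvd (lm g') \<alpha>)"
    using G[unfolded reduced_groebner_basis_def, THEN conjunct1] G[unfolded reduced_groebner_basis_def, THEN conjunct2] .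
  have GI: "G \<subseteq> I" using gb by (simp add: groebner_basis_def)
  note cover = gb[unfolded groebner_basis_def, THEN conjunct2, THEN conjunct2, THEN conjunct2, rule_format]
  note rgg = bspec[OF rg g]
  have lc: "lc g = 1" using rgg by (rule conjunct1)
  have red: "\<not> exp_dvd (lm g') \<alpha>" if "g' \<in> G" "g' \<noteq> g" "g' \<noteq> 0" "\<alpha> \<in> supp g" for g' \<alpha>
    using conjunct2[OF rgg, rule_format, of \<alpha> g'] that by simp
  show nz: "g \<noteq> 0" using lc by (auto simp: lc_def)
  note lmg = lm_greatest[OF nz]
  show "lm g \<in> lms I" by (rule lmsI[OF subsetD[OF GI g] nz])
  have divides: "exp_dvd (lm g) (lm f)" if f: "f \<in> I" "f \<noteq> 0" "exp_dvd (lm f) \<alpha>" "\<alpha> \<in> supp g" for f \<alpha>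
  proof -
    obtain g' where g': "g' \<in> G" "g' \<noteq> 0" "exp_dvd (lm g') (lm f)" using cover[OF f(1,2)] by blast
    from exp_dvd_trans[OF g'(3) f(3)] have "exp_dvd (lm g') \<alpha>" .
    then have "g' = g" using red[OF g'(1) _ g'(2) f(4)] by blast
    then show ?thesis using g'(3) by simp
  qed
  show "\<beta> = lm g" if b: "\<beta> \<in> lms I" "exp_dvd \<beta> (lm g)" for \<beta>
  proof -
    obtain f where "f \<in> I" "f \<noteq> 0" "\<beta> = lm f" using b(1) by (auto simp: lms_def)
    then have "exp_dvd (lm g) \<beta>" using divides[of f "lm g"] b(2) lmg(1) by simp
    from exp_dvd_antisym[OF b(2) this] show ?thesis .
  qed
  define h where "h = part (exp_size (lm g)) g"
  have "g - h = 0"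
  proof (rule ccontr)
    assume ne: "g - h \<noteq> 0"
    have gI: "g \<in> I" using GI g by blast
    have "g - h \<in> I"
      unfolding h_def using gI homogeneous_idealD(2)[OF I gI]
      by (intro subspace_diff[OF subspace_left_ideal[OF homogeneous_idealD(1)[OF I]]])
    define \<nu> where "\<nu> = lm (g - h)"
    have "\<nu> \<in> supp (g - h)" unfolding \<nu>_def by (rule lm_greatest(1)[OF ne])
    then have nu: "\<nu> \<in> supp g" "exp_size \<nu> \<noteq> exp_size (lm g)"
      by (auto simp: h_def supp_def coeff_part split: if_splits)
    \<comment> \<open>Being divisible by \<open>lm g\<close> puts \<nu> above \<open>lm g\<close>,
      while occurring in \<open>g\<close> puts it below; equality contradicts the different
      degrees.\<close>
    have "exp_dvd (lm g) \<nu>" using divides[OF \<open>g - h \<in> I\<close> ne _ nu(1)] by (simp add: \<nu>_def)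
    then have "(lm g, \<nu>) \<in> r" using supp_exps[OF nu(1)] by (rule dvd_imp_ord)
    then have "lm g = \<nu>" using lmg(2)[OF nu(1)] by (rule ord_antisym)
    then show False using nu(2) by simp
  qed
  then have "h = g" by (simp only: right_minus_eq)
  have "h \<in> component (exp_size (lm g))" unfolding h_def by (rule part_in_component)
  then have hom: "g \<in> component (exp_size (lm g))" unfolding \<open>h = g\<close> .
  have "exp_size \<alpha> = exp_size (lm g)" if "\<alpha> \<in> supp g" for \<alpha>
    using hom that by (simp only: component_eq_supported supported_def mem_Collect_eq)
  then have "exp_size ` supp g = {exp_size (lm g)}" using lmg(1) by blast
  then show "degree g = exp_size (lm g)" by (simp add: degree_def)
qed

lemma degree_component:
  assumes "f \<noteq> 0" "f \<in> component e"
  shows "degree f = e"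
proof -
  have "exp_size ` supp f = {e}"
    using lm_greatest(1)[OF assms(1)] assms(2) by (auto simp: component_eq_supported supported_def)
  then show ?thesis by (simp add: degree_def)
qed

lemma reduced_groebner_basis_degree_bound:
  assumes N: "N > 1" and f0: "f0 \<noteq> 0" "f0 \<in> component d" and F: "finite F"
      "\<And>f. f \<in> F \<Longrightarrow> f \<noteq> 0 \<and> (\<exists>e\<le>d. f \<in> component e)"
    and I: "I = left_ideal hull (insert f0 F)"
    and G: "reduced_groebner_basis G I" and g: "g \<in> G"
  shows "real (degree g) \<le> 2 * ((real d)\<^sup>2 / 2 + real d) ^ (2 ^ (N - 2))"
proof -
  have dec: "homogeneous_ideal I \<and> (\<exists>Q. standard d Q \<and> dim_le N Q \<and> (\<forall>t. hf I t = cone_count d N t + hilb Q t))"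
    unfolding I by (rule ideal_decomposition[OF f0 F])
  then have hI: "homogeneous_ideal I" by blast
  note ge = reduced_groebner_basis_element[OF hI G g]
  show ?thesis
  proof (cases "lm g = 0")
    case True
    then show ?thesis using ge(2) by simp
  next
    case False
    \<comment> \<open>For d = 0 the ideal contains a nonzero constant, so 0 is a leading exponent
      and minimality would force \<open>lm g = 0\<close>.\<close>
    have "d \<noteq> 0"
    proof
      assume "d = 0"
      then have "exp_size (lm f0) = 0"
        using lm_greatest(1)[OF f0(1)] f0(2) by (simp add: component_eq_supported supported_def)
      then have "lm f0 = 0"
        using lookup_le_exp_size[of "lm f0"] by (intro poly_mapping_eqI) simp
      moreover have "f0 \<in> I" unfolding I by (rule hull_inc) simp
      ultimately have "0 \<in> lms I" using lmsI[OF _ f0(1), of I] by simp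
      then show False using ge(4)[of 0] False by (simp add: exp_dvd_def)
    qed
    obtain Q where Q: "standard d Q" "dim_le N Q" "\<And>t. hf I t = cone_count d N t + hilb Q t"
      using dec by blast
    from lms_complement_decomposition[OF homogeneous_idealD(1)[OF hI]] obtain P where
      P: "\<forall>t. hilb P t = card {\<beta> \<in> exps N - lms I. exp_size \<beta> = t}" "standard 0 P" "dim_le N P"
      "\<forall>\<alpha>\<in>lms I. (\<forall>\<beta>\<in>lms I. exp_dvd \<beta> \<alpha> \<longrightarrow> \<beta> = \<alpha>) \<longrightarrow> \<alpha> \<noteq> 0 \<longrightarrow>
         (\<exists>a m. (a, m) \<in># P \<and> exp_size \<alpha> \<le> Suc a)"
      by (elim exE conjE) rule
    obtain a m where am: "(a, m) \<in># P" "exp_size (lm g) \<le> Suc a"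
      using P(4) ge(3,4) False by blast
    obtain P' where P': "standard d P'" "dim_le N P'" "hilb P' = hilb P"
      "\<forall>(a, m)\<in>#P. \<exists>m'. (a, m') \<in># P'"
      using push_standard[OF P(2,3), of d] by blast
    \<comment> \<open>Only the degree of the cone has to survive the pushing; its dimension may have
      changed.\<close>
    obtain m' where m': "(a, m') \<in># P'" using bspec[OF P'(4) am(1)] by auto
    have "cone_count 0 N t = cone_count d N t + hilb Q t + hilb P' t" for t
      using hf_complement[of I t] by (simp add: Q(3) P'(3) P(1)[rule_format])
    from standard_pair_degree_bound[OF _ _ P'(1,2) Q(1,2) this m'] \<open>d \<noteq> 0\<close> N
    have "real (Suc a) \<le> 2 * ((real d)\<^sup>2 / 2 + real d) ^ (2 ^ (N - 2))" by simp
    moreover have "real (degree g) \<le> real (Suc a)" unfolding ge(2) using am(2) by (simp only: of_nat_le_iff)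
    ultimately show ?thesis by linarith
  qed
qed

end

theorem proposition5p1:
  fixes scale :: "'k::field \<Rightarrow> 'r::ring_1 \<Rightarrow> 'r"
    and N n d :: nat
    and x f :: "nat \<Rightarrow> 'r"
    and r :: "((nat \<Rightarrow>\<^sub>0 nat) \<times> (nat \<Rightarrow>\<^sub>0 nat)) set"
    and I G :: "'r set"
  assumes "N > 1"
    and "homogeneous_solvable_algebra scale N x r"
    and "n > 0"
    and "\<And>i. i < n \<Longrightarrow> f i \<noteq> 0"
    and "\<And>i. i < n \<Longrightarrow> algebra_monomials.homogeneous_element scale N x (f i)"
    and "I = left_ideal hull (f ` {..<n})"
    and "d = Max ((\<lambda>i. algebra_monomials.degree scale N x (f i)) ` {..<n})"
    and "algebra_monomials.reduced_groebner_basis scale N x r G I"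
  shows "\<forall>g\<in>G. real (algebra_monomials.degree scale N x g)
           \<le> 2 * ((real d)\<^sup>2 / 2 + real d) ^ (2 ^ (N - 2))"
proof
  fix g assume g: "g \<in> G"
  interpret homogeneous_solvable_algebra scale N x r by (rule assms(2))
  have comp: "f i \<in> component (degree (f i))" if "i < n" for i
    using assms(5)[OF that] degree_component[OF assms(4)[OF that]] by (auto simp: homogeneous_element_def)
  have le: "degree (f i) \<le> d" if "i < n" for i
    unfolding assms(7) using that by (intro Max_ge) auto
  have "d \<in> (\<lambda>i. degree (f i)) ` {..<n}"
    unfolding assms(7) using assms(3) by (intro Max_in) auto
  then obtain k where k: "k < n" "degree (f k) = d" by auto
  \<comment> \<open>A generator of maximal degree plays the role of the one that yields the full
    cone.\<close>
  have "insert (f k) (f ` {..<n}) = f ` {..<n}" using k(1) by auto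
  then have I: "I = left_ideal hull (insert (f k) (f ` {..<n}))" using assms(6) by simp
  have "f k \<in> component d" using comp[OF k(1)] k(2) by simp
  moreover have "h \<noteq> 0 \<and> (\<exists>e\<le>d. h \<in> component e)" if "h \<in> f ` {..<n}" for h
    using that assms(4) comp le by auto
  ultimately show "real (degree g) \<le> 2 * ((real d)\<^sup>2 / 2 + real d) ^ (2 ^ (N - 2))"
    using reduced_groebner_basis_degree_bound[OF assms(1) assms(4)[OF k(1)] _ _ _ I assms(8) g] by simp
qed

end
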